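(* Let $X$ be the set of convergent power series $r(z,\overline z)=\sum_{i+j>3}r_{ij}z^i\overline z^j$ with $r_{ji}=\overline{r_{ij}}$ for all $i,j$ and $r_{z\overline z}(z,-z)=0$, equipped with the metric $d(r,s)=\sup\{|r_{ij}-s_{ij}|^{1/(i+j)} : i+j>3\}$. For $r\in X$ let $M_r\subset\mathbb{C}^2$ be the (germ at $0$ of the) real Lagrangian surface $p=2z\overline z+\overline z^2+r_z(z,\overline z)$, and let $Q\subset\mathbb{C}^2$ be the quadratic surface $p=2z\overline z+\overline z^2$. Let $S$ be the set of all $r\in X$ such that $M_r$ cannot be transformed into $Q$ by any holomorphic (convergent) transformation of $\mathbb{C}^2$ near $0$. Then $S$ is dense in the metric space $(X,d)$.
   Context: Coordinates on $\mathbb{C}^2$ are $(z,p)$. A real surface $M\subset\mathbb{C}^2$ is real Lagrangian if $\mathrm{Re}\,\omega|_M=0$, where $\omega=dz\wedge dp$. "Convergent" means convergent in some neighbourhood of the origin; indices $i,j$ range over nonnegative integers. In a power series in $z,\overline z$, the variables $z$ and $\overline z$ are treated as independent: $r_z$ and $r_{z\overline z}$ denote the (termwise) partial derivatives $\partial r/\partial z$ and $\partial^2 r/\partial z\,\partial\overline z$, and $r_{z\overline z}(z,-z)=0$ means that the power series $r_{z\overline z}(z,w)$ vanishes identically after substituting $w=-z$. A holomorphic transformation of $\mathbb{C}^2$ near $0$ is a germ of a biholomorphic map $(\mathbb{C}^2,0)\to(\mathbb{C}^2,0)$; it transforms $M_r$ into $Q$ if it maps the germ of $M_r$ at $0$ onto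 the germ of $Q$ at $0$. *)

theory Defs
  imports "HOL-Analysis.Analysis"
begin

section \<open>Power series in \<open>z\<close> and \<open>cnj z\<close>\<close>

text \<open>
  A power series in two independent variables \<open>z\<close>, \<open>w\<close> is its array of coefficients:
  \<open>r i j\<close> is the coefficient of \<open>z ^ i * w ^ j\<close>. A series in \<open>z\<close> and the conjugate of \<open>z\<close> is
  evaluated at \<open>w = cnj z\<close>.
\<close>

type_synonym pseries2 = "nat \<Rightarrow> nat \<Rightarrow> complex"

definition eval2 :: "pseries2 \<Rightarrow> complex \<Rightarrow> complex \<Rightarrow> complex" where
  "eval2 r z w = (\<Sum>\<^sub>\<infinity>(i, j)\<in>UNIV. r i j * z ^ i * w ^ j)"

definition convergent2 :: "pseries2 \<Rightarrow> bool" where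
  "convergent2 r \<longleftrightarrow>
     (\<exists>U :: (complex \<times> complex) set. open U \<and> (0, 0) \<in> U \<and>
        (\<forall>(z, w)\<in>U. (\<lambda>(i, j). r i j * z ^ i * w ^ j) summable_on UNIV))"

definition deriv_fst :: "pseries2 \<Rightarrow> pseries2" where
  "deriv_fst r = (\<lambda>i j. of_nat (Suc i) * r (Suc i) j)"

definition deriv_snd :: "pseries2 \<Rightarrow> pseries2" where
  "deriv_snd r = (\<lambda>i j. of_nat (Suc j) * r i (Suc j))"

text \<open>The one-variable formal power series \<open>r(z, - z)\<close>.\<close>

definition subst_neg :: "pseries2 \<Rightarrow> complex fps" where
  "subst_neg r = Abs_fps (\<lambda>n. \<Sum>i\<le>n. r i (n - i) * (- 1) ^ (n - i))"


section \<open>The metric space \<open>(X, d)\<close>\<close>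

definition X :: "pseries2 set" where
  "X = {r. (\<forall>i j. i + j \<le> 3 \<longrightarrow> r i j = 0) \<and> convergent2 r \<and>
           (\<forall>i j. r j i = cnj (r i j)) \<and>
           subst_neg (deriv_fst (deriv_snd r)) = 0}"

text \<open>
  The value outside of \<open>X\<close> is irrelevant. It is set to \<open>0\<close> because the locale \<open>Metric_space\<close>
  asks for nonnegativity and symmetry on the whole type, and the supremum of an unbounded set of
  reals is unspecified.
\<close>

definition d :: "pseries2 \<Rightarrow> pseries2 \<Rightarrow> real" where
  "d r s = (if r \<in> X \<and> s \<in> X
            then Sup {root (i + j) (cmod (r i j - s i j)) | i j. i + j > 3} else 0)"

lemma convergent2_root_bounded:
  assumes "convergent2 r"
  obtains B where "\<And>i j. i + j > 3 \<Longrightarrow> root (i + j) (cmod (r i j)) \<le> B"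
proof -
  obtain U where U: "open U" "(0, 0) \<in> U"
    and sm: "\<And>z w. (z, w) \<in> U \<Longrightarrow> (\<lambda>(i, j). r i j * z ^ i * w ^ j) summable_on UNIV"
    using assms unfolding convergent2_def by fast
  obtain e where e: "e > 0" "ball (0, 0) e \<subseteq> U"
    using U open_contains_ball by blast
  define t where "t = e / 2"
  have t: "t > 0" using e by (simp add: t_def)
  have "norm (complex_of_real (t/2), complex_of_real (t/2))
        \<le> norm (complex_of_real (t/2)) + norm (complex_of_real (t/2))"
    by (rule norm_Pair_le)
  also have "\<dots> = t" using t by (simp only: norm_of_real)
  also have "t < e" using e by (simp add: t_def)
  finally have "(complex_of_real (t/2), complex_of_real (t/2)) \<in> ball (0, 0) e"
    by (simp add: dist_norm norm_Pair)
  then have "(complex_of_real (t/2), complex_of_real (t/2)) \<in> U" using e by blast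
  from sm[OF this]
  have S: "(\<lambda>p. cmod (case p of (i, j) \<Rightarrow>
              r i j * complex_of_real (t/2) ^ i * complex_of_real (t/2) ^ j)) summable_on UNIV"
    by (simp add: summable_on_iff_abs_summable_on_complex)
  define q where "q = t / 2"
  have q: "q > 0" using t by (simp add: q_def)
  define C where "C = max 1 (\<Sum>\<^sub>\<infinity>p. cmod (case p of (i, j) \<Rightarrow>
              r i j * complex_of_real q ^ i * complex_of_real q ^ j))"
  have C1: "C \<ge> 1" by (simp add: C_def)
  have bd: "cmod (r i j) * q ^ (i + j) \<le> C" for i j
  proof -
    have "sum (\<lambda>p. cmod (case p of (i, j) \<Rightarrow>
              r i j * complex_of_real q ^ i * complex_of_real q ^ j)) {(i, j)} \<le> C"
      unfolding C_def
      by (rule max.coboundedI2, rule finite_sum_le_infsum)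
         (use S in \<open>auto simp: q_def\<close>)
    then show ?thesis using q by (simp add: norm_mult norm_power power_add mult.assoc)
  qed
  show ?thesis
  proof (rule that)
    fix i j :: nat assume ij: "i + j > 3"
    have "cmod (r i j) \<le> C / q ^ (i + j)"
      using bd[of i j] q by (simp add: field_simps)
    also have "\<dots> \<le> C ^ (i + j) / q ^ (i + j)"
      using C1 q ij by (intro divide_right_mono self_le_power) auto
    finally have "cmod (r i j) \<le> (C / q) ^ (i + j)" by (simp add: power_divide)
    then have "root (i + j) (cmod (r i j)) \<le> root (i + j) ((C / q) ^ (i + j))"
      using ij by (intro real_root_le_mono) auto
    also have "\<dots> = C / q"
      using ij C1 q by (intro real_root_power_cancel) auto
    finally show "root (i + j) (cmod (r i j)) \<le> C / q" .
  qed
qed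

lemma root_norm_triangle:
  fixes a b :: complex
  assumes "n > 0"
  shows "root n (cmod (a + b)) \<le> root n (cmod a) + root n (cmod b)"
proof -
  let ?x = "root n (cmod a)" and ?y = "root n (cmod b)"
  have xy: "?x \<ge> 0" "?y \<ge> 0" by (auto intro: real_root_ge_zero)
  have pw: "x ^ n + y ^ n \<le> (x + y) ^ n" if "x \<ge> 0" "y \<ge> 0" for x y :: real
    using assms
  proof (induction n rule: nat_induct_non_zero)
    case 1 show ?case by simp
  next
    case (Suc n)
    have "x ^ Suc n + y ^ Suc n \<le> x * (x ^ n + y ^ n) + y * (x ^ n + y ^ n)"
      using that by (simp add: algebra_simps)
    also have "\<dots> = (x + y) * (x ^ n + y ^ n)" by (simp add: algebra_simps)
    also have "\<dots> \<le> (x + y) * (x + y) ^ n"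
      using Suc that by (intro mult_left_mono) auto
    finally show ?case by simp
  qed
  have "cmod (a + b) \<le> cmod a + cmod b" by (rule norm_triangle_ineq)
  also have "\<dots> = ?x ^ n + ?y ^ n" using assms by simp
  also have "\<dots> \<le> (?x + ?y) ^ n" using xy by (rule pw)
  finally have "root n (cmod (a + b)) \<le> root n ((?x + ?y) ^ n)"
    using assms by simp
  also have "\<dots> = ?x + ?y" using assms xy by (intro real_root_power_cancel) auto
  finally show ?thesis .
qed

lemma X_convergent2: "r \<in> X \<Longrightarrow> convergent2 r"
  unfolding X_def by blast

lemma X_low: "r \<in> X \<Longrightarrow> i + j \<le> 3 \<Longrightarrow> r i j = 0"
  unfolding X_def by blast

lemma d_bdd_above:
  assumes "r \<in> X" "s \<in> X"
  shows "bdd_above {root (i + j) (cmod (r i j - s i j)) | i j. i + j > 3}"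
proof -
  obtain A where A: "\<And>i j. i + j > 3 \<Longrightarrow> root (i + j) (cmod (r i j)) \<le> A"
    using convergent2_root_bounded[of r] X_convergent2[OF assms(1)] by blast
  obtain B where B: "\<And>i j. i + j > 3 \<Longrightarrow> root (i + j) (cmod (s i j)) \<le> B"
    using convergent2_root_bounded[of s] X_convergent2[OF assms(2)] by blast
  have "root (i + j) (cmod (r i j - s i j)) \<le> A + B" if "i + j > 3" for i j
    using root_norm_triangle[of "i + j" "r i j" "- s i j"] A[OF that] B[OF that] that
    by fastforce
  then show ?thesis by (intro bdd_aboveI[of _ "A + B"]) auto
qed

lemma d_upper:
  assumes "r \<in> X" "s \<in> X" "i + j > 3"
  shows "root (i + j) (cmod (r i j - s i j)) \<le> d r s"
proof -
  have "root (i + j) (cmod (r i j - s i j))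
        \<le> Sup {root (i + j) (cmod (r i j - s i j)) | i j. i + j > 3}"
    by (rule cSup_upper) (use assms d_bdd_above in auto)
  then show ?thesis using assms by (simp add: d_def)
qed

lemma d_least:
  assumes "r \<in> X" "s \<in> X" "\<And>i j. i + j > 3 \<Longrightarrow> root (i + j) (cmod (r i j - s i j)) \<le> c"
  shows "d r s \<le> c"
proof -
  have "\<exists>i j :: nat. i + j > 3" by (rule exI[of _ 4]) auto
  then have "Sup {root (i + j) (cmod (r i j - s i j)) | i j. i + j > 3} \<le> c"
    by (intro cSup_least) (use assms in auto)
  then show ?thesis using assms by (simp add: d_def)
qed

lemma Metric_space_X_d: "Metric_space X d"
proof
  show "0 \<le> d r s" for r s
  proof (cases "r \<in> X \<and> s \<in> X")
    case True
    have "0 \<le> root (4 + 0) (cmod (r 4 0 - s 4 0))" by (rule real_root_ge_zero) simp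
    also have "\<dots> \<le> d r s" using True by (intro d_upper) auto
    finally show ?thesis .
  qed (auto simp: d_def)
  show "d r s = d s r" for r s
  proof -
    have "cmod (r i j - s i j) = cmod (s i j - r i j)" for i j
      by (rule norm_minus_commute)
    then show ?thesis unfolding d_def by (simp only: conj_commute)
  qed
  show "d r s = 0 \<longleftrightarrow> r = s" if "r \<in> X" "s \<in> X" for r s
  proof
    assume 0: "d r s = 0"
    have "r i j = s i j" for i j
    proof (cases "i + j > 3")
      case True
      then have "root (i + j) (cmod (r i j - s i j)) \<le> 0"
        using d_upper[OF that True] 0 by simp
      then have "cmod (r i j - s i j) \<le> 0"
        using True by (subst (asm) real_root_le_0_iff) auto
      then show ?thesis by simp
    next
      case False
      then show ?thesis using X_low[OF that(1), of i j] X_low[OF that(2), of i j] by simp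
    qed
    then show "r = s" by blast
  next
    assume "r = s"
    then have "d r s \<le> 0" using that by (intro d_least) auto
    moreover have "root (4 + 0) (cmod (r 4 0 - s 4 0)) \<le> d r s"
      using that by (intro d_upper) auto
    ultimately show "d r s = 0" using \<open>r = s\<close> by (simp only: diff_self norm_zero real_root_zero)
  qed
  show "d r u \<le> d r s + d s u" if "r \<in> X" "s \<in> X" "u \<in> X" for r s u
  proof (rule d_least)
    fix i j :: nat assume ij: "i + j > 3"
    have "root (i + j) (cmod (r i j - u i j))
          \<le> root (i + j) (cmod (r i j - s i j)) + root (i + j) (cmod (s i j - u i j))"
      using root_norm_triangle[of "i + j" "r i j - s i j" "s i j - u i j"] ij by fastforce
    also have "\<dots> \<le> d r s + d s u"
      using that ij by (intro add_mono d_upper)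
    finally show "root (i + j) (cmod (r i j - u i j)) \<le> d r s + d s u" .
  qed (use that in auto)
qed


section \<open>Surfaces and holomorphic transformations of \<open>\<complex>\<^sup>2\<close> near the origin\<close>

text \<open>
  Points of \<open>\<complex>\<^sup>2\<close> are pairs \<open>(z, p)\<close>. Only the germ at the origin of \<open>surface r\<close> is meaningful: away
  from the origin the series need not converge, and \<open>eval2\<close> then has a junk value.
\<close>

definition surface :: "pseries2 \<Rightarrow> (complex \<times> complex) set" where
  "surface r = {(z, p). p = 2 * z * cnj z + (cnj z)\<^sup>2 + eval2 (deriv_fst r) z (cnj z)}"

definition Q :: "(complex \<times> complex) set" where
  "Q = {(z, p). p = 2 * z * cnj z + (cnj z)\<^sup>2}"

definition scaleC2 :: "complex \<Rightarrow> complex \<times> complex \<Rightarrow> complex \<times> complex" where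
  "scaleC2 c x = (c * fst x, c * snd x)"

text \<open>Holomorphic on an open set: the real derivative exists and is complex-linear at each point.\<close>

definition holomorphic2_on ::
    "(complex \<times> complex \<Rightarrow> complex \<times> complex) \<Rightarrow> (complex \<times> complex) set \<Rightarrow> bool" where
  "holomorphic2_on F U \<longleftrightarrow>
     (\<forall>x\<in>U. \<exists>D. (F has_derivative D) (at x) \<and> (\<forall>c v. D (scaleC2 c v) = scaleC2 c (D v)))"

text \<open>
  \<open>F\<close>, restricted to \<open>U\<close>, represents the germ of a biholomorphic map; its values outside of \<open>U\<close>
  play no role. Since \<open>U\<close> may be shrunk, the equation on images says exactly that the germ of \<open>A\<close>
  at the origin is mapped onto the germ of \<open>B\<close>.
\<close>

definition transformable_into ::
    "(complex \<times> complex) set \<Rightarrow> (complex \<times> complex) set \<Rightarrow> bool" where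
  "transformable_into A B \<longleftrightarrow>
     (\<exists>F G U V. open U \<and> open V \<and> (0, 0) \<in> U \<and> F (0, 0) = (0, 0) \<and>
        homeomorphism U V F G \<and> holomorphic2_on F U \<and> holomorphic2_on G V \<and>
        F ` (A \<inter> U) = B \<inter> V)"

definition S :: "pseries2 set" where
  "S = {r \<in> X. \<not> transformable_into (surface r) Q}"

end

theory Submission
  imports Defs "HOL-Complex_Analysis.Complex_Analysis"
begin

text \<open>
  The function \<open>p + z\<^sup>2\<close> is real on \<open>Q\<close>. A holomorphic map from \<open>M\<^sub>r\<close> to \<open>Q\<close> therefore yields a
  convergent \<open>A = p + z\<^sup>2 + \<dots>\<close> that is real on \<open>M\<^sub>r\<close>. It is unique up to composition with real series
  \<open>\<phi>\<close>, so the germ \<open>\<kappa>\<close> with \<open>cnj (A (0, cnj (\<kappa> p))) = A (0, p)\<close> depends on \<open>r\<close> only.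

  Adding \<open>\<i> * c * (z + w) ^ 4 * (z - w) ^ (2 * m - 3)\<close> to \<open>r\<close>, with \<open>w = cnj z\<close>, does not change the
  coefficients of \<open>\<kappa>\<close> below degree \<open>m\<close>. Solving the linearized equation, a difference equation with
  symbol \<open>2 * cosh\<close>, shows that it changes the coefficient of degree \<open>m\<close> by
  \<open>- 2 * \<i> * c * (2 * m - 3) * E\<close>, where \<open>E\<close> is the Euler number of index \<open>2 * m - 4\<close>. Choosing \<open>c\<close>
  as \<open>0\<close> or \<open>\<epsilon> ^ (2 * m + 1)\<close> for each \<open>m\<close> in turn makes all these coefficients at least as large as
  half of the possible change. Euler numbers grow faster than geometrically, so \<open>\<kappa>\<close> diverges, which
  contradicts the existence of \<open>A\<close>.
\<close>

text \<open>No germ \<open>A\<close> is available before the surface is assumed transformable. The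
  argument therefore supposes that a whole ball around \<open>r\<close> misses \<open>S\<close>:
  then every perturbation inside that ball carries a \<open>\<kappa>\<close>, and coefficients of
  different surfaces can be compared.

  The size of the ball is harmless because \<open>d\<close> takes the root of order N of a
  coefficient of degree N. Coefficients bounded by (2 * \<epsilon>) ^ N cost a distance of at most 2
  * \<epsilon>, while the resulting geometric factor \<epsilon> ^ (2 * m + 1) cannot compensate for
  the growth of the Euler numbers.

  The exponent 4 is forced by two demands. Membership in \<open>X\<close> needs the mixed derivative
  to vanish on w = - z, which a factor (z + w) ^ 3 already ensures. With exponent 3, however, the
  imaginary part on the line Re z = 1/2 would be an odd power of z - w. The difference equation then
  becomes homogeneous, and \<open>\<kappa>\<close> would not move in degree m. Exponent 4 produces
  an even power, and the factor \<i> makes the resulting odd power of z - w Hermitian.\<close>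

section \<open>Power series in two variables\<close>

lemma half_geometric_has_sum:
  "((\<lambda>(i, j). (1/2) ^ i * (1/2) ^ j :: real) has_sum 4) (UNIV :: (nat \<times> nat) set)"
proof -
  have g: "((\<lambda>i. (1/2) ^ i :: real) has_sum 2) UNIV"
    using geometric_sums[of "1/2 :: real"] by (intro sums_nonneg_imp_has_sum) auto
  have row: "((\<lambda>j. (\<lambda>(i, j). (1/2) ^ i * (1/2) ^ j :: real) (i, j)) has_sum (1/2) ^ i * 2) UNIV"
    for i :: nat
    using has_sum_cmult_right[OF g, of "(1/2) ^ i"] by simp
  have col: "((\<lambda>i. (1/2) ^ i * 2 :: real) has_sum 4) (UNIV :: nat set)"
    using has_sum_cmult_left[OF g, of 2] by simp
  have "(\<lambda>(i, j). (1/2) ^ i * (1/2) ^ j :: real) summable_on (UNIV :: nat set) \<times> (UNIV :: nat set)"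
    using row by (intro summable_on_SigmaI[where g = "\<lambda>i. (1/2) ^ i * 2"])
      (auto intro: has_sum_imp_summable[OF col])
  from has_sum_SigmaI[OF row col this] show ?thesis by simp
qed

text \<open>The product of two geometric series of ratio 1/2 is the common majorant of the double
  series below; its sum 4 is the constant in the tail estimate.\<close>

lemma half_geometric_bound:
  fixes f :: "nat \<times> nat \<Rightarrow> complex"
  assumes "\<And>i j. (i, j) \<in> A \<Longrightarrow> norm (f (i, j)) \<le> K * ((1/2) ^ i * (1/2) ^ j)" "K \<ge> 0"
  shows "(\<lambda>p. norm (f p)) summable_on A" "norm (infsum f A) \<le> 4 * K"
proof -
  let ?g = "\<lambda>(i, j). (1/2) ^ i * (1/2) ^ j :: real"
  have gU: "?g summable_on UNIV"
    by (rule has_sum_imp_summable[OF half_geometric_has_sum])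
  have gA: "?g summable_on A"
    using gU by (rule summable_on_subset_banach) simp
  have KgA: "(\<lambda>p. K * ?g p) summable_on A"
    by (rule summable_on_cmult_right[OF gA])
  have le: "norm (f p) \<le> K * ?g p" if "p \<in> A" for p
    using assms(1)[of "fst p" "snd p"] that by (auto simp: case_prod_beta)
  show ab: "(\<lambda>p. norm (f p)) summable_on A"
    by (rule summable_on_comparison_test[OF KgA]) (use le in auto)
  have "norm (infsum f A) \<le> infsum (\<lambda>p. norm (f p)) A"
    using ab by (rule norm_infsum_bound)
  also have "\<dots> \<le> infsum (\<lambda>p. K * ?g p) A"
    by (rule infsum_mono[OF ab KgA le])
  also have "\<dots> = K * infsum ?g A"
    by (rule infsum_cmult_right) (use gA in auto)
  also have "\<dots> \<le> K * infsum ?g UNIV"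
    by (intro mult_left_mono infsum_mono_neutral gA gU assms) auto
  also have "infsum ?g UNIV = 4"
    by (rule infsumI[OF half_geometric_has_sum])
  finally show "norm (infsum f A) \<le> 4 * K" by simp
qed

text \<open>A coefficient form of convergence that, unlike \<open>convergent2\<close>, is visibly
  stable under differences and differentiation.\<close>

definition geometric2 :: "pseries2 \<Rightarrow> bool" where
  "geometric2 a \<longleftrightarrow> (\<exists>C R. C \<ge> 0 \<and> R > 0 \<and> (\<forall>i j. norm (a i j) \<le> C * R ^ (i + j)))"

lemma geometric_term_bound:
  fixes z w :: complex
  assumes "norm (a i j) \<le> C * R ^ (i + j)" "C \<ge> 0" "R > 0" "R * norm z \<le> 1/2" "R * norm w \<le> 1/2"
  shows "norm (a i j * z ^ i * w ^ j) \<le> C * ((1/2) ^ i * (1/2) ^ j)"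
proof -
  have "norm (a i j * z ^ i * w ^ j) \<le> C * R ^ (i + j) * norm z ^ i * norm w ^ j"
    unfolding norm_mult norm_power by (intro mult_right_mono assms) auto
  also have "\<dots> = C * ((R * norm z) ^ i * (R * norm w) ^ j)"
    by (simp add: power_add power_mult_distrib algebra_simps)
  also have "\<dots> \<le> C * ((1/2) ^ i * (1/2) ^ j)"
    using assms by (intro mult_left_mono mult_mono power_mono) auto
  finally show ?thesis .
qed

lemma geometric2_summable:
  assumes "geometric2 a"
  obtains \<rho> where "\<rho> > 0"
    "\<And>z w. norm z \<le> \<rho> \<Longrightarrow> norm w \<le> \<rho> \<Longrightarrow> (\<lambda>(i, j). a i j * z ^ i * w ^ j) summable_on UNIV"
proof -
  obtain C R where C: "C \<ge> 0" "R > 0" "\<And>i j. norm (a i j) \<le> C * R ^ (i + j)"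
    using assms by (auto simp: geometric2_def)
  show ?thesis
  proof
    show "1 / (2 * R) > 0" using C by simp
    fix z w :: complex assume "norm z \<le> 1 / (2 * R)" "norm w \<le> 1 / (2 * R)"
    then have zw: "R * norm z \<le> 1/2" "R * norm w \<le> 1/2" using C by (auto simp: field_simps)
    have "(\<lambda>p. norm (case p of (i, j) \<Rightarrow> a i j * z ^ i * w ^ j)) summable_on UNIV"
      by (rule half_geometric_bound(1)[OF _ C(1)])
        (use geometric_term_bound[OF _ C(1,2) zw, of a] C(3) in auto)
    then show "(\<lambda>(i, j). a i j * z ^ i * w ^ j) summable_on UNIV"
      by (rule abs_summable_summable)
  qed
qed

lemma geometric2_imp_convergent2:
  assumes "geometric2 a"
  shows "convergent2 a"
proof -
  obtain \<rho> where \<rho>: "\<rho> > 0"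
    "\<And>z w. norm z \<le> \<rho> \<Longrightarrow> norm w \<le> \<rho> \<Longrightarrow> (\<lambda>(i, j). a i j * z ^ i * w ^ j) summable_on UNIV"
    using geometric2_summable[OF assms] by blast
  then show ?thesis unfolding convergent2_def
    by (intro exI[of _ "ball 0 \<rho> \<times> ball 0 \<rho>"]) (auto intro: open_Times)
qed

lemma geometric2_diff:
  assumes "geometric2 a" "geometric2 b"
  shows "geometric2 (\<lambda>i j. a i j - b i j)"
proof -
  obtain C R where C: "C \<ge> 0" "R > 0" "\<And>i j. norm (a i j) \<le> C * R ^ (i + j)"
    using assms by (auto simp: geometric2_def)
  obtain D T where D: "D \<ge> 0" "T > 0" "\<And>i j. norm (b i j) \<le> D * T ^ (i + j)"
    using assms by (auto simp: geometric2_def)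
  have "norm (a i j - b i j) \<le> (C + D) * (max R T) ^ (i + j)" for i j
  proof -
    have "norm (a i j - b i j) \<le> C * R ^ (i + j) + D * T ^ (i + j)"
      using norm_triangle_ineq4[of "a i j" "b i j"] C(3)[of i j] D(3)[of i j] by linarith
    also have "\<dots> \<le> C * max R T ^ (i + j) + D * max R T ^ (i + j)"
      using C D by (intro add_mono mult_left_mono power_mono) auto
    finally show ?thesis by (simp add: algebra_simps)
  qed
  moreover have "C + D \<ge> 0" "max R T > 0" using C(1,2) D(1,2) by auto
  ultimately show ?thesis unfolding geometric2_def by blast
qed

text \<open>The factor i + 1 is at most 2 ^ i, so doubling the ratio absorbs it.\<close>

lemma geometric2_deriv_fst:
  assumes "geometric2 a"
  shows "geometric2 (deriv_fst a)"
proof -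
  obtain C R where C: "C \<ge> 0" "R > 0" "\<And>i j. norm (a i j) \<le> C * R ^ (i + j)"
    using assms by (auto simp: geometric2_def)
  have "norm (deriv_fst a i j) \<le> (C * R) * (2 * R) ^ (i + j)" for i j
  proof -
    have "Suc i \<le> 2 ^ i"
      by (simp add: Suc_le_eq less_exp)
    also have "(2::nat) ^ i \<le> 2 ^ (i + j)" by (rule power_increasing) auto
    finally have "real (Suc i) \<le> 2 ^ (i + j)"
      by (metis of_nat_le_iff of_nat_numeral of_nat_power)
    moreover have "norm (deriv_fst a i j) = real (Suc i) * norm (a (Suc i) j)"
      unfolding deriv_fst_def norm_mult norm_of_nat ..
    ultimately have "norm (deriv_fst a i j) \<le> 2 ^ (i + j) * (C * R ^ (Suc i + j))"
      using C(3)[of "Suc i" j] by (auto intro!: mult_mono)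
    then show ?thesis by (simp add: power_mult_distrib algebra_simps)
  qed
  moreover have "C * R \<ge> 0" "2 * R > 0" using C(1,2) by auto
  ultimately show ?thesis unfolding geometric2_def by blast
qed

lemma X_geometric2:
  assumes "r \<in> X"
  shows "geometric2 r"
proof -
  obtain B where B: "\<And>i j. i + j > 3 \<Longrightarrow> root (i + j) (cmod (r i j)) \<le> B"
    using convergent2_root_bounded[OF X_convergent2[OF assms]] by blast
  have "norm (r i j) \<le> 1 * (\<bar>B\<bar> + 1) ^ (i + j)" for i j
  proof (cases "i + j > 3")
    case True
    then have "norm (r i j) = root (i + j) (cmod (r i j)) ^ (i + j)"
      by (intro real_root_pow_pos2[symmetric]) (linarith, rule norm_ge_zero)
    also have "\<dots> \<le> (\<bar>B\<bar> + 1) ^ (i + j)"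
      using B[OF True] by (intro power_mono real_root_ge_zero) auto
    finally show ?thesis by simp
  next
    case False
    then show ?thesis using X_low[OF assms, of i j] by simp
  qed
  moreover have "(1::real) \<ge> 0" "\<bar>B\<bar> + 1 > 0" by auto
  ultimately show ?thesis unfolding geometric2_def by blast
qed

text \<open>With weights 1 and \<open>e\<close> for the two variables, terms of weight above
  \<open>n\<close> contribute only O(t). The weight is 2 for germs in (z, p) and 1 for series in z
  and cnj z. The second argument may vary with \<open>t\<close> because it will be a point of a
  surface rather than of a fixed curve.\<close>

lemma eval2_weighted_limit:
  fixes z p :: complex and e n :: nat
  assumes a: "geometric2 a" and e: "e \<ge> 1"
    and van: "\<And>i j. i + e * j < n \<Longrightarrow> a i j = 0"
    and y: "(y \<longlongrightarrow> p) (at_right (0::real))"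
  shows "((\<lambda>t. eval2 a (of_real t * z) (of_real t ^ e * y t) / of_real t ^ n) \<longlongrightarrow>
           (\<Sum>(i, j)\<in>{(i, j). i + e * j = n}. a i j * z ^ i * p ^ j)) (at_right (0::real))"
proof -
  obtain C R where C: "C \<ge> 0" "R > 0" "\<And>i j. norm (a i j) \<le> C * R ^ (i + j)"
    using a by (auto simp: geometric2_def)
  define L where "L = {(i, j). i + e * j = n}"
  have "j \<le> e * j" for j using e by simp
  then have "L \<subseteq> {..n} \<times> {..n}"
    by (auto simp: L_def intro: le_trans[OF _ le_add2])
  then have L: "finite L" by (rule finite_subset) auto
  define Y where "Y = norm p + 1"
  \<comment> \<open>At scale \<open>t0\<close> both variables satisfy the hypothesis of the
    majorant, R times the modulus being at most 1/2.\<close>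
  define t0 where "t0 = min 1 (min (1 / (2 * R * (norm z + 1))) (1 / (2 * R * Y)))"
  have Y: "Y > 0" by (simp add: Y_def add_nonneg_pos)
  have nz: "norm z + 1 > 0" by (simp add: add_nonneg_pos)
  have t0: "t0 > 0" "t0 \<le> 1" using C Y nz by (auto simp: t0_def)
  have scale: "R * (t0 * N) \<le> 1/2" if "t0 \<le> 1 / (2 * R * N)" "N > 0" for N
    using that C(2) by (simp add: field_simps)
  have t0Y: "R * (t0 * Y) \<le> 1/2"
  proof -
    have "t0 \<le> 1 / (2 * R * Y)" by (simp add: t0_def)
    then show ?thesis using Y by (rule scale)
  qed
  have t0z: "R * (t0 * norm z) \<le> 1/2"
  proof -
    have "t0 \<le> 1 / (2 * R * (norm z + 1))" by (simp add: t0_def)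
    then have "R * (t0 * (norm z + 1)) \<le> 1/2" using nz by (rule scale)
    moreover have "R * (t0 * norm z) \<le> R * (t0 * (norm z + 1))"
      using C t0 by (intro mult_left_mono) auto
    ultimately show ?thesis by linarith
  qed
  have evY: "\<forall>\<^sub>F t in at_right 0. norm (y t) < Y"
    using order_tendstoD(2)[OF tendsto_norm[OF y], of Y] by (simp add: Y_def)
  have evt: "\<forall>\<^sub>F t in at_right (0::real). 0 < t \<and> t < t0"
    using t0 by (auto simp: eventually_at_right_field)
  define lead where "lead = (\<lambda>t. \<Sum>(i, j)\<in>L. a i j * z ^ i * y t ^ j)"
  have main: "norm (eval2 a (of_real t * z) (of_real t ^ e * y t) / of_real t ^ n - lead t)
      \<le> t * (4 * C / t0 ^ Suc n)" if t: "0 < t" "t < t0" and yt: "norm (y t) < Y" for t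
  proof -
    let ?T = "\<lambda>(i, j). a i j * (of_real t * z) ^ i * (of_real t ^ e * y t) ^ j"
    have te: "t ^ e \<le> t" using t t0 e by (metis less_eq_real_def order_trans power_decreasing power_one_right)
    have t0e: "t0 ^ e \<le> t0" using t0 e by (metis less_eq_real_def power_decreasing power_one_right)
    have b1: "R * norm (of_real t * z) \<le> 1/2"
    proof -
      have "R * norm (of_real t * z) \<le> R * (t0 * norm z)"
        using C t by (auto simp: norm_mult intro!: mult_left_mono mult_right_mono)
      then show ?thesis using t0z by linarith
    qed
    have b2: "R * norm (of_real t ^ e * y t) \<le> 1/2"
    proof -
      have "t ^ e * norm (y t) \<le> t0 * Y"
        using t yt te by (intro mult_mono) auto
      then have "R * (t ^ e * norm (y t)) \<le> R * (t0 * Y)" using C by (intro mult_left_mono) auto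
      then show ?thesis using t0Y t by (simp add: norm_mult norm_power)
    qed
    have sm: "(\<lambda>p. norm (?T p)) summable_on UNIV"
      by (rule half_geometric_bound(1)[OF _ C(1)])
        (use geometric_term_bound[OF _ C(1,2) b1 b2, of a] C(3) in auto)
    \<comment> \<open>Terms outside \<open>L\<close> that do not vanish have weight at least n + 1.
      Passing from the fixed scale \<open>t0\<close> to \<open>t\<close> therefore gains the factor
      (t / t0) ^ (n + 1), one power more than the division by t ^ n uses up.\<close>
    let ?K = "(t / t0) ^ Suc n * C"
    have tail: "norm (infsum ?T (- L)) \<le> 4 * ?K"
    proof (rule half_geometric_bound(2))
      show "?K \<ge> 0" using t t0 C by simp
      fix i j assume ij: "(i, j) \<in> - L"
      show "norm (?T (i, j)) \<le> ?K * ((1/2) ^ i * (1/2) ^ j)"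
      proof (cases "i + e * j < n")
        case True
        then have "norm (?T (i, j)) = 0" using van by simp
        also have "0 \<le> ?K * ((1/2) ^ i * (1/2) ^ j)"
          by (rule mult_nonneg_nonneg[OF \<open>?K \<ge> 0\<close>]) simp
        finally show ?thesis .
      next
        case False
        then have ge: "i + e * j \<ge> Suc n" using ij by (simp add: L_def)
        have "norm (?T (i, j)) = norm (a i j) * t ^ (i + e * j) * norm z ^ i * norm (y t) ^ j"
          using t by (simp add: norm_mult norm_power power_mult_distrib power_add power_mult)
        also have "\<dots> \<le> (C * R ^ (i + j)) * t ^ (i + e * j) * norm z ^ i * Y ^ j"
          using t yt C Y by (intro mult_mono power_mono) auto
        also have "t ^ (i + e * j) = (t / t0) ^ (i + e * j) * t0 ^ (i + e * j)"
          using t0 by (simp add: power_divide)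
        also have "(C * R ^ (i + j)) * ((t / t0) ^ (i + e * j) * t0 ^ (i + e * j)) * norm z ^ i * Y ^ j
           = (t / t0) ^ (i + e * j) * (C * ((R * (t0 * norm z)) ^ i * (R * (t0 ^ e * Y)) ^ j))"
          by (simp add: power_add power_mult_distrib power_mult algebra_simps)
        also have "\<dots> \<le> (t / t0) ^ Suc n * (C * ((1/2) ^ i * (1/2) ^ j))"
        proof (intro mult_mono power_mono)
          show "(t / t0) ^ (i + e * j) \<le> (t / t0) ^ Suc n"
            using ge t t0 by (intro power_decreasing) auto
          have "R * (t0 ^ e * Y) \<le> R * (t0 * Y)"
            using t0e C Y by (intro mult_left_mono mult_right_mono) auto
          then show "R * (t0 ^ e * Y) \<le> 1/2" using t0Y by linarith
        qed (use t0z C Y t t0 in auto)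
        finally show ?thesis by (simp add: mult.assoc)
      qed
    qed
    have "eval2 a (of_real t * z) (of_real t ^ e * y t) = infsum ?T (L \<union> - L)"
      by (simp add: eval2_def)
    also have "\<dots> = infsum ?T L + infsum ?T (- L)"
      by (rule infsum_Un_disjoint)
        (use sm L in \<open>auto intro: abs_summable_summable summable_on_subset_banach[of _ UNIV]\<close>)
    also have "infsum ?T L = (\<Sum>p\<in>L. ?T p)" using L by simp
    also have "\<dots> = of_real t ^ n * lead t"
      unfolding lead_def sum_distrib_left
    proof (rule sum.cong[OF refl])
      fix p assume p: "p \<in> L"
      obtain i j where [simp]: "p = (i, j)" by (cases p)
      have n: "n = i + e * j" using p by (simp add: L_def)
      show "?T p = of_real t ^ n * (case p of (i, j) \<Rightarrow> a i j * z ^ i * y t ^ j)"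
        unfolding n by (simp add: power_add power_mult power_mult_distrib)
    qed
    finally have ev: "eval2 a (of_real t * z) (of_real t ^ e * y t)
        = of_real t ^ n * lead t + infsum ?T (- L)" .
    have "eval2 a (of_real t * z) (of_real t ^ e * y t) / of_real t ^ n - lead t
        = infsum ?T (- L) / of_real t ^ n"
      unfolding ev using t by (simp add: field_simps)
    also have "norm \<dots> = norm (infsum ?T (- L)) / t ^ n"
      using t by (simp add: norm_divide norm_power)
    also have "\<dots> \<le> 4 * ?K / t ^ n"
      using tail t by (intro divide_right_mono) auto
    also have "\<dots> = t * (4 * C / t0 ^ Suc n)"
    proof -
      have "t \<noteq> 0" "t0 \<noteq> 0" using t t0 by auto
      then show ?thesis by (simp add: power_divide field_simps)
    qed
    finally show ?thesis .
  qed
  have "\<forall>\<^sub>F t in at_right 0. norm (eval2 a (of_real t * z) (of_real t ^ e * y t) / of_real t ^ n - lead t)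
      \<le> t * (4 * C / t0 ^ Suc n)"
    using evY evt by eventually_elim (use main in auto)
  moreover have "((\<lambda>t. t * (4 * C / t0 ^ Suc n)) \<longlongrightarrow> 0) (at_right (0::real))"
    by (rule tendsto_mult_left_zero) simp
  ultimately have "((\<lambda>t. eval2 a (of_real t * z) (of_real t ^ e * y t) / of_real t ^ n - lead t) \<longlongrightarrow> 0) (at_right 0)"
    by (rule Lim_null_comparison)
  moreover have "(lead \<longlongrightarrow> (\<Sum>(i, j)\<in>L. a i j * z ^ i * p ^ j)) (at_right 0)"
    unfolding lead_def by (intro tendsto_sum) (auto intro!: tendsto_intros y)
  ultimately have "((\<lambda>t. (eval2 a (of_real t * z) (of_real t ^ e * y t) / of_real t ^ n - lead t) + lead t)
      \<longlongrightarrow> 0 + (\<Sum>(i, j)\<in>L. a i j * z ^ i * p ^ j)) (at_right 0)"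
    by (rule tendsto_add)
  then show ?thesis by (simp add: L_def)
qed

section \<open>Taylor expansion of holomorphic functions on a bidisc\<close>

definition holomorphic_bidisc :: "(complex \<Rightarrow> complex \<Rightarrow> complex) \<Rightarrow> real \<Rightarrow> bool" where
  "holomorphic_bidisc B \<rho> \<longleftrightarrow> \<rho> > 0 \<and> continuous_on (ball 0 \<rho> \<times> ball 0 \<rho>) (\<lambda>(z, p). B z p) \<and>
     (\<forall>p\<in>ball 0 \<rho>. (\<lambda>z. B z p) holomorphic_on ball 0 \<rho>) \<and>
     (\<forall>z\<in>ball 0 \<rho>. B z holomorphic_on ball 0 \<rho>)"

lemma taylor_coeff_bound:
  assumes "f holomorphic_on ball 0 \<sigma>" "0 < \<rho>" "\<rho> < \<sigma>" "\<And>x. x \<in> cball 0 \<rho> \<Longrightarrow> norm (f x) \<le> M"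
  shows "norm ((deriv ^^ n) f 0 / fact n) \<le> M / \<rho> ^ n"
proof -
  have "norm ((deriv ^^ n) f 0) \<le> fact n * M / \<rho> ^ n"
  proof (rule Cauchy_inequality)
    show "f holomorphic_on ball 0 \<rho>"
      using assms by (auto intro: holomorphic_on_subset)
    show "continuous_on (cball 0 \<rho>) f"
      using assms by (intro holomorphic_on_imp_continuous_on holomorphic_on_subset[OF assms(1)]) auto
  qed (use assms in auto)
  then show ?thesis by (simp add: norm_divide field_simps)
qed

text \<open>
  By induction on \<open>i\<close>: \<open>c i\<close> is the uniform limit of \<open>(B z p - (\<Sum>l<i. c l p * z ^ l)) / z ^ i\<close>
  as \<open>z\<close> tends to \<open>0\<close>.
\<close>
lemma taylor_coeff_holomorphic:
  fixes B :: "complex \<Rightarrow> complex \<Rightarrow> complex"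
  assumes \<rho>: "0 < \<rho>"
    and sums: "\<And>z p. norm z < \<rho> \<Longrightarrow> norm p < \<rho> \<Longrightarrow> (\<lambda>i. c i p * z ^ i) sums B z p"
    and bound: "\<And>i p. norm p < \<rho> \<Longrightarrow> norm (c i p) \<le> M / \<rho> ^ i"
    and hol: "\<And>z. norm z < \<rho> \<Longrightarrow> B z holomorphic_on ball 0 \<rho>"
  shows "c i holomorphic_on ball 0 \<rho>"
proof (induction i rule: less_induct)
  case (less i)
  have M: "M \<ge> 0" using order_trans[OF norm_ge_zero bound[of 0 0]] \<rho> by simp
  define u where "u = (\<lambda>n. complex_of_real (\<rho> / 2 / real (Suc n)))"
  have nu: "norm (u n) = \<rho> / 2 / real (Suc n)" for n
    using \<rho> unfolding u_def norm_of_real by simp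
  have u0: "u n \<noteq> 0" for n using \<rho> by (simp add: u_def del: of_nat_Suc)
  have nu2: "norm (u n) \<le> \<rho> / 2" for n
    using \<rho> unfolding nu by (simp add: field_simps)
  define f where "f = (\<lambda>n p. (B (u n) p - (\<Sum>l<i. c l p * u n ^ l)) / u n ^ i)"
  \<comment> \<open>Since |u n| \<le> \<rho> / 2, the tail after degree i is dominated by a
    geometric series of ratio 1/2. The error is thus O(|u n|) uniformly in \<open>p\<close>, which
    is what makes the limit holomorphic.\<close>
  have fc: "norm (f n p - c i p) \<le> 2 * M / \<rho> ^ Suc i * norm (u n)" if p: "norm p < \<rho>" for n p
  proof -
    have un: "norm (u n) < \<rho>" using nu2[of n] \<rho> by linarith
    have s: "(\<lambda>l. c (l + Suc i) p * u n ^ (l + Suc i)) sums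
        (B (u n) p - (\<Sum>l<Suc i. c l p * u n ^ l))"
      using sums[OF un p] by (rule sums_split_initial_segment)
    define q where "q = norm (u n) / \<rho>"
    have q: "0 \<le> q" "q \<le> 1/2" using nu2[of n] \<rho> by (auto simp: q_def field_simps)
    have tb: "norm (c (l + Suc i) p * u n ^ (l + Suc i)) \<le> M * q ^ Suc i * (1/2) ^ l" for l
    proof -
      have "norm (c (l + Suc i) p * u n ^ (l + Suc i)) \<le> M / \<rho> ^ (l + Suc i) * norm (u n) ^ (l + Suc i)"
        unfolding norm_mult norm_power by (intro mult_right_mono bound p) auto
      also have "\<dots> = M * (q ^ Suc i * q ^ l)"
        by (simp add: q_def power_divide power_add mult_ac)
      also have "\<dots> \<le> M * (q ^ Suc i * (1/2) ^ l)"
        using q M by (intro mult_left_mono power_mono) auto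
      finally show ?thesis by (simp add: mult.assoc)
    qed
    have g: "(\<lambda>l. M * q ^ Suc i * (1/2) ^ l) sums (M * q ^ Suc i * 2)"
      using sums_mult[OF geometric_sums[of "1/2 :: real"], of "M * q ^ Suc i"] by simp
    have "norm (B (u n) p - (\<Sum>l<Suc i. c l p * u n ^ l)) \<le> M * q ^ Suc i * 2"
      using norm_suminf_le[OF tb sums_summable[OF g]] sums_unique[OF s] sums_unique[OF g] by simp
    then have "norm (B (u n) p - (\<Sum>l<Suc i. c l p * u n ^ l)) / norm (u n) ^ i
        \<le> M * q ^ Suc i * 2 / norm (u n) ^ i"
      by (intro divide_right_mono) auto
    also have "norm (B (u n) p - (\<Sum>l<Suc i. c l p * u n ^ l)) / norm (u n) ^ i
        = norm (f n p - c i p)"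
      using u0[of n] unfolding f_def norm_power[symmetric] norm_divide[symmetric]
      by (simp add: field_simps)
    also have "M * q ^ Suc i * 2 / norm (u n) ^ i = 2 * M / \<rho> ^ Suc i * norm (u n)"
      using u0[of n] by (simp add: q_def power_divide)
    finally show ?thesis .
  qed
  show ?case
  proof (rule holomorphic_uniform_sequence)
    show "f n holomorphic_on ball 0 \<rho>" for n
      unfolding f_def using less u0[of n] nu2[of n] \<rho>
      by (intro holomorphic_intros hol) auto
    fix x :: complex assume "x \<in> ball 0 \<rho>"
    then obtain e where e: "e > 0" "cball x e \<subseteq> ball 0 \<rho>"
      using open_contains_cball by blast
    have "uniform_limit (cball x e) f (c i) sequentially"
    proof (rule uniform_limitI)
      fix \<epsilon> :: real assume \<epsilon>: "\<epsilon> > 0"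
      have "(\<lambda>n. \<rho> / 2 * inverse (real (Suc n))) \<longlonglongrightarrow> 0"
        by (rule tendsto_mult_right_zero[OF LIMSEQ_inverse_real_of_nat])
      then have "(\<lambda>n. norm (u n)) \<longlonglongrightarrow> 0"
        unfolding nu divide_inverse[of "\<rho> / 2"] .
      then have "(\<lambda>n. 2 * M / \<rho> ^ Suc i * norm (u n)) \<longlonglongrightarrow> 0"
        by (rule tendsto_mult_right_zero)
      then have "\<forall>\<^sub>F n in sequentially. 2 * M / \<rho> ^ Suc i * norm (u n) < \<epsilon>"
        using \<epsilon> by (rule order_tendstoD)
      then show "\<forall>\<^sub>F n in sequentially. \<forall>p\<in>cball x e. dist (f n p) (c i p) < \<epsilon>"
      proof eventually_elim
        case (elim n)
        show ?case
        proof
          fix p assume "p \<in> cball x e"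
          then have "norm p < \<rho>" using e by auto
          from fc[OF this, of n] elim show "dist (f n p) (c i p) < \<epsilon>"
            by (simp add: dist_norm)
        qed
      qed
    qed
    then show "\<exists>d>0. cball x d \<subseteq> ball 0 \<rho> \<and> uniform_limit (cball x d) f (c i) sequentially"
      using e by blast
  qed simp
qed

text \<open>Osgood's argument: joint continuity supplies one bound \<open>M\<close> on a closed
  bidisc, Cauchy's estimate is applied in z and again to the coefficients as functions of p, and
  absolute summability merges the iterated sums into the double series.\<close>

lemma holomorphic_bidisc_expansion:
  assumes "holomorphic_bidisc B \<sigma>"
  obtains a \<rho> where "geometric2 a" "\<rho> > 0"
    "\<And>z p. norm z < \<rho> \<Longrightarrow> norm p < \<rho> \<Longrightarrow> B z p = eval2 a z p"
proof -
  have \<sigma>: "\<sigma> > 0" and cont: "continuous_on (ball 0 \<sigma> \<times> ball 0 \<sigma>) (\<lambda>(z, p). B z p)"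
    and hol1: "\<And>p. p \<in> ball 0 \<sigma> \<Longrightarrow> (\<lambda>z. B z p) holomorphic_on ball 0 \<sigma>"
    and hol2: "\<And>z. z \<in> ball 0 \<sigma> \<Longrightarrow> B z holomorphic_on ball 0 \<sigma>"
    using assms by (auto simp: holomorphic_bidisc_def)
  define \<rho> where "\<rho> = \<sigma> / 2"
  have \<rho>: "0 < \<rho>" "\<rho> < \<sigma>" using \<sigma> by (auto simp: \<rho>_def)
  have "compact ((\<lambda>(z, p). B z p) ` (cball 0 \<rho> \<times> cball 0 \<rho>))"
    using \<rho> by (intro compact_continuous_image compact_Times continuous_on_subset[OF cont]) auto
  then obtain M where M: "\<And>z p. norm z \<le> \<rho> \<Longrightarrow> norm p \<le> \<rho> \<Longrightarrow> norm (B z p) \<le> M"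
    by (force dest!: compact_imp_bounded simp: bounded_iff)
  have M0: "M \<ge> 0" using order_trans[OF norm_ge_zero M[of 0 0]] \<rho> by simp
  define c where "c = (\<lambda>i p. (deriv ^^ i) (\<lambda>z. B z p) 0 / fact i)"
  have cb: "norm (c i p) \<le> M / \<rho> ^ i" if "norm p \<le> \<rho>" for i p
    unfolding c_def using that \<rho> M by (intro taylor_coeff_bound[OF hol1]) auto
  have cs: "(\<lambda>i. c i p * z ^ i) sums B z p" if "norm z < \<rho>" "norm p < \<rho>" for z p
    using holomorphic_power_series[OF hol1[of p], of z] that \<rho> by (simp add: c_def)
  have ch: "c i holomorphic_on ball 0 \<rho>" for i
    by (rule taylor_coeff_holomorphic[where M = M, OF \<rho>(1) cs])
      (use cb \<rho> in \<open>auto intro: holomorphic_on_subset[OF hol2]\<close>)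
  define a where "a = (\<lambda>i j. (deriv ^^ j) (c i) 0 / fact j)"
  \<comment> \<open>The coefficients \<open>c i\<close> are known to be holomorphic only on the open
    disc of radius \<open>\<rho>\<close>, so the second Cauchy estimate uses radius \<rho> /
    2.\<close>
  define R where "R = 2 / \<rho>"
  have R: "R > 0" using \<rho> by (simp add: R_def)
  have ab: "norm (a i j) \<le> M * R ^ (i + j)" for i j
  proof -
    have "norm (a i j) \<le> (M / \<rho> ^ i) / (\<rho> / 2) ^ j"
      unfolding a_def using \<rho> cb by (intro taylor_coeff_bound[OF ch]) auto
    also have "\<dots> = M * (1 / \<rho>) ^ i * R ^ j"
      by (simp add: R_def power_divide)
    also have "\<dots> \<le> M * R ^ i * R ^ j"
      using M0 \<rho> R by (intro mult_right_mono mult_left_mono power_mono) (auto simp: R_def field_simps)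
    finally show ?thesis by (simp add: power_add mult.assoc)
  qed
  have as: "(\<lambda>j. a i j * p ^ j) sums c i p" if "norm p < \<rho>" for i p
    using holomorphic_power_series[OF ch, of p] that by (simp add: a_def)
  show ?thesis
  proof
    show "geometric2 a" unfolding geometric2_def using M0 R ab by blast
    \<comment> \<open>This makes \<open>R * \<tau>\<close> equal to 1/2, as the majorant
      requires.\<close>
    define \<tau> where "\<tau> = \<rho> / 4"
    show "\<tau> > 0" using \<rho> by (simp add: \<tau>_def)
    fix z p :: complex assume zp: "norm z < \<tau>" "norm p < \<tau>"
    then have zp': "norm z < \<rho>" "norm p < \<rho>" using \<rho> by (auto simp: \<tau>_def)
    have b: "R * norm z \<le> 1/2" "R * norm p \<le> 1/2"
      using zp \<rho> by (auto simp: R_def \<tau>_def field_simps)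
    have tb: "norm (a i j * z ^ i * p ^ j) \<le> M * ((1/2) ^ i * (1/2) ^ j)" for i j
      by (rule geometric_term_bound[OF ab M0 R b])
    have "(\<lambda>q. norm (case q of (i, j) \<Rightarrow> a i j * z ^ i * p ^ j)) summable_on UNIV"
      by (rule half_geometric_bound(1)[OF _ M0]) (use tb in auto)
    then have sm: "(\<lambda>(i, j). a i j * z ^ i * p ^ j) summable_on UNIV \<times> UNIV"
      by (simp add: abs_summable_summable)
    have row: "((\<lambda>j. a i j * z ^ i * p ^ j) has_sum c i p * z ^ i) UNIV" for i
    proof (rule norm_summable_imp_has_sum)
      show "(\<lambda>j. a i j * z ^ i * p ^ j) sums (c i p * z ^ i)"
        using sums_mult2[OF as[where i = i, OF zp'(2)], of "z ^ i"] by (simp add: mult_ac)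
      have "summable (\<lambda>j. M * (1/2) ^ i * (1/2 :: real) ^ j)"
        by (intro summable_mult summable_geometric) auto
      then show "summable (\<lambda>j. norm (a i j * z ^ i * p ^ j))"
        by (rule summable_comparison_test'[where N = 0]) (use tb in \<open>auto simp: mult.assoc\<close>)
    qed
    have "((\<lambda>i. c i p * z ^ i) has_sum B z p) UNIV"
    proof (rule norm_summable_imp_has_sum[OF _ cs[OF zp']])
      have gs: "summable (\<lambda>i. M * (1/2 :: real) ^ i)"
        by (intro summable_mult summable_geometric) auto
      have cz: "norm (c i p * z ^ i) \<le> M * (1/2) ^ i" for i
      proof -
        have "norm (c i p * z ^ i) \<le> M / \<rho> ^ i * norm z ^ i"
          unfolding norm_mult norm_power using cb[of p i] zp' by (intro mult_right_mono) auto
        also have "\<dots> = M * (norm z / \<rho>) ^ i" by (simp add: power_divide)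
        also have "\<dots> \<le> M * (1/2) ^ i"
        proof (intro mult_left_mono power_mono)
          show "norm z / \<rho> \<le> 1/2"
            using zp(1) \<rho>(1) by (simp add: \<tau>_def pos_divide_le_eq)
        qed (use M0 \<rho> in auto)
        finally show ?thesis .
      qed
      show "summable (\<lambda>i. norm (c i p * z ^ i))"
        by (rule summable_comparison_test'[OF gs, where N = 0]) (use cz in simp)
    qed
    with row have "((\<lambda>(i, j). a i j * z ^ i * p ^ j) has_sum B z p) (UNIV \<times> UNIV)"
      by (intro has_sum_SigmaI[OF _ _ sm, where g = "\<lambda>i. c i p * z ^ i"]) simp_all
    then show "B z p = eval2 a z p"
      by (simp add: eval2_def infsumI)
  qed
qed

section \<open>Germs and their leading parts\<close>

definition holomorphic_germ :: "(complex \<Rightarrow> complex \<Rightarrow> complex) \<Rightarrow> bool" where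
  "holomorphic_germ B \<longleftrightarrow> (\<exists>\<rho>. holomorphic_bidisc B \<rho>)"

lemma holomorphic_bidisc_mono:
  assumes "holomorphic_bidisc B \<rho>" "0 < \<sigma>" "\<sigma> \<le> \<rho>"
  shows "holomorphic_bidisc B \<sigma>"
proof -
  have sub: "ball 0 \<sigma> \<subseteq> ball (0::complex) \<rho>" using assms by auto
  then show ?thesis
    using assms unfolding holomorphic_bidisc_def
    by (auto intro: continuous_on_subset holomorphic_on_subset)
qed

lemma holomorphic_germ_diff:
  assumes "holomorphic_germ B" "holomorphic_germ C"
  shows "holomorphic_germ (\<lambda>z p. B z p - C z p)"
proof -
  obtain \<rho> \<sigma> where BC: "holomorphic_bidisc B \<rho>" "holomorphic_bidisc C \<sigma>"
    using assms by (auto simp: holomorphic_germ_def)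
  then have "min \<rho> \<sigma> > 0" by (auto simp: holomorphic_bidisc_def)
  then have "holomorphic_bidisc B (min \<rho> \<sigma>)" "holomorphic_bidisc C (min \<rho> \<sigma>)"
    using BC by (auto intro: holomorphic_bidisc_mono)
  then have "holomorphic_bidisc (\<lambda>z p. B z p - C z p) (min \<rho> \<sigma>)"
    unfolding holomorphic_bidisc_def case_prod_unfold
    by (auto intro!: continuous_intros holomorphic_intros)
  then show ?thesis by (auto simp: holomorphic_germ_def)
qed

text \<open>Outer functions are entire, so the bidisc need not shrink. They will be polynomials with
  real coefficients and division by a nonzero real constant.\<close>

lemma holomorphic_germ_compose:
  assumes "holomorphic_germ B" "\<phi> holomorphic_on UNIV"
  shows "holomorphic_germ (\<lambda>z p. \<phi> (B z p))"
proof -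
  obtain \<rho> where B: "holomorphic_bidisc B \<rho>"
    using assms by (auto simp: holomorphic_germ_def)
  have h: "(\<lambda>x. \<phi> (f x)) holomorphic_on S" if "f holomorphic_on S" for f S
    using holomorphic_on_compose[OF that holomorphic_on_subset[OF assms(2)]] by (simp add: o_def)
  have c: "continuous_on S (\<lambda>x. \<phi> (f x))" if "continuous_on S f" for f and S :: "(complex \<times> complex) set"
    by (rule continuous_on_compose2[OF holomorphic_on_imp_continuous_on[OF assms(2)] that]) auto
  have "holomorphic_bidisc (\<lambda>z p. \<phi> (B z p)) \<rho>"
    using B unfolding holomorphic_bidisc_def case_prod_unfold by (auto intro!: h c)
  then show ?thesis by (auto simp: holomorphic_germ_def)
qed

text \<open>
  The variables \<open>z\<close>, \<open>p\<close> have weights 1 and 2. Since \<open>p = 2 * z * cnj z + (cnj z)\<^sup>2\<close> is the same as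
  \<open>p = (2 * Re z)\<^sup>2 - z\<^sup>2\<close>, the curve \<open>p = 1 - z\<^sup>2\<close> contains the points of \<open>Q\<close> with \<open>Re z = 1/2\<close>, and
  a weighted homogeneous polynomial is determined by its values on this curve.
\<close>
definition leading :: "(complex \<Rightarrow> complex \<Rightarrow> complex) \<Rightarrow> nat \<Rightarrow> (complex \<Rightarrow> complex) \<Rightarrow> bool" where
  "leading B n \<beta> \<longleftrightarrow> (\<forall>z y. (y \<longlongrightarrow> 1 - z\<^sup>2) (at_right 0) \<longrightarrow>
     ((\<lambda>t. B (of_real t * z) (of_real t ^ 2 * y t) / of_real t ^ n) \<longlongrightarrow> \<beta> z) (at_right (0::real)))"

lemma leadingD:
  assumes "leading B n \<beta>" "(y \<longlongrightarrow> 1 - z\<^sup>2) (at_right 0)"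
  shows "((\<lambda>t. B (of_real t * z) (of_real t ^ 2 * y t) / of_real t ^ n) \<longlongrightarrow> \<beta> z) (at_right (0::real))"
  using assms unfolding leading_def by blast

lemma leading_diff:
  assumes "leading B n \<beta>" "leading C n \<gamma>"
  shows "leading (\<lambda>z p. B z p - C z p) n (\<lambda>z. \<beta> z - \<gamma> z)"
  using assms unfolding leading_def diff_divide_distrib by (auto intro!: tendsto_diff)

lemma leading_power:
  assumes "leading A 2 (\<lambda>_. 1)"
  shows "leading (\<lambda>z p. s * A z p ^ k) (2 * k) (\<lambda>_. s)"
  unfolding leading_def
proof (intro allI impI)
  fix z :: complex and y :: "real \<Rightarrow> complex"
  assume y: "(y \<longlongrightarrow> 1 - z\<^sup>2) (at_right 0)"
  have "((\<lambda>t. s * (A (of_real t * z) (of_real t ^ 2 * y t) / of_real t ^ 2) ^ k) \<longlongrightarrow> s * 1 ^ k) (at_right 0)"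
    by (intro tendsto_mult tendsto_const tendsto_power leadingD[OF assms y])
  then show "((\<lambda>t. s * A (of_real t * z) (of_real t ^ 2 * y t) ^ k / of_real t ^ (2 * k)) \<longlongrightarrow> s)
      (at_right (0::real))"
    by (simp add: power_divide power_mult)
qed

lemma tendsto_zero_lower_power:
  assumes "((\<lambda>t. g t / complex_of_real t ^ n) \<longlongrightarrow> c) (at_right (0::real))" "k < n"
  shows "((\<lambda>t. g t / complex_of_real t ^ k) \<longlongrightarrow> 0) (at_right (0::real))"
proof -
  have "((\<lambda>t. complex_of_real t) \<longlongrightarrow> complex_of_real 0) (at_right (0::real))"
    by (intro tendsto_intros)
  then have "((\<lambda>t. complex_of_real t ^ (n - k) * (g t / complex_of_real t ^ n)) \<longlongrightarrow>
      complex_of_real 0 ^ (n - k) * c) (at_right 0)"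
    by (intro tendsto_mult tendsto_power assms)
  moreover have "complex_of_real 0 ^ (n - k) * c = 0" using assms(2) by simp
  ultimately have "((\<lambda>t. complex_of_real t ^ (n - k) * (g t / complex_of_real t ^ n)) \<longlongrightarrow> 0) (at_right 0)"
    by (simp only:)
  moreover have "\<forall>\<^sub>F t in at_right (0::real). t > 0"
    by (simp add: eventually_at_right_less)
  then have "\<forall>\<^sub>F t in at_right (0::real).
      complex_of_real t ^ (n - k) * (g t / complex_of_real t ^ n) = g t / complex_of_real t ^ k"
  proof eventually_elim
    case (elim t)
    have "complex_of_real t ^ n = complex_of_real t ^ (n - k) * complex_of_real t ^ k"
      using assms(2) by (simp flip: power_add)
    then show ?case using elim by simp
  qed
  ultimately show ?thesis by (rule Lim_transform_eventually)
qed

lemma finite_weighted_degree: "finite {(i, j). i + 2 * j = (n::nat)}"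
  by (rule finite_subset[of _ "{..n} \<times> {..n}"]) auto

text \<open>Writing 1 - z^2 = z^2 * u, that is z^2 = 1 / (1 + u), turns the sum into z ^ n times a
  polynomial in u whose coefficients are the \<open>a i j\<close>.\<close>

lemma weighted_homogeneous_zero:
  fixes a :: pseries2
  assumes "\<And>z. (\<Sum>(i, j)\<in>{(i, j). i + 2 * j = n}. a i j * z ^ i * (1 - z\<^sup>2) ^ j) = 0"
  assumes "i + 2 * j = n"
  shows "a i j = 0"
proof -
  let ?L = "{(i, j). i + 2 * j = n}"
  define q where "q = (\<Sum>(i, j)\<in>?L. monom (a i j) j)"
  have pq: "poly q u = (\<Sum>(i, j)\<in>?L. a i j * u ^ j)" for u
    unfolding q_def poly_sum by (intro sum.cong) (auto simp: poly_monom)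
  have q0: "poly q u = 0" if "u \<noteq> - 1" for u
  proof -
    define z where "z = csqrt (1 / (1 + u))"
    have u1: "1 + u \<noteq> 0" using that by (metis add.commute eq_neg_iff_add_eq_0)
    then have z2: "z\<^sup>2 = 1 / (1 + u)" and z0: "z \<noteq> 0" by (auto simp: z_def)
    have zu: "1 - z\<^sup>2 = z\<^sup>2 * u" unfolding z2 using u1 by (simp add: field_simps)
    have "0 = (\<Sum>(i, j)\<in>?L. a i j * z ^ i * (1 - z\<^sup>2) ^ j)" using assms(1) by simp
    also have "\<dots> = (\<Sum>(i, j)\<in>?L. z ^ n * (a i j * u ^ j))"
      unfolding zu by (intro sum.cong refl) (auto simp: power_mult_distrib power_add power_mult)
    also have "\<dots> = z ^ n * poly q u"
      unfolding pq sum_distrib_left by (simp add: case_prod_beta)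
    finally show ?thesis using z0 by simp
  qed
  \<comment> \<open>The value u = - 1 corresponds to no z; the extra linear factor takes care of
    it.\<close>
  have "poly (q * [:1, 1:]) u = 0" for u
    using q0[of u] by (cases "u = - 1") auto
  then have "q * [:1, 1:] = 0" using poly_all_0_iff_0 by blast
  moreover have "[:1, 1 :: complex:] \<noteq> 0" by simp
  ultimately have "q = 0" using mult_eq_0_iff by blast
  then have "0 = coeff q j" by simp
  also have "\<dots> = (\<Sum>p\<in>?L. if p = (i, j) then a i j else 0)"
    unfolding q_def coeff_sum using assms(2) by (intro sum.cong) (auto split: if_splits)
  also have "\<dots> = a i j"
    using assms(2) finite_weighted_degree[of n] by (simp add: sum.delta)
  finally show ?thesis by simp
qed

text \<open>The leading part is the weight \<open>n\<close> part of the Taylor series on the curve p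
  = 1 - z^2. Its parity is that of \<open>n\<close>, because i and n = i + 2 * j have the same
  parity and 1 - z^2 is even.\<close>

lemma leading_exists:
  assumes B: "holomorphic_germ B" and n: "n = 0 \<or> leading B (n - 1) (\<lambda>_. 0)"
  obtains \<beta> :: "complex poly" where "\<And>z. poly \<beta> (- z) = (- 1) ^ n * poly \<beta> z" "leading B n (poly \<beta>)"
proof -
  obtain \<sigma> where "holomorphic_bidisc B \<sigma>" using B by (auto simp: holomorphic_germ_def)
  then obtain a \<rho> where a: "geometric2 a" and \<rho>: "\<rho> > 0"
    and Ba: "\<And>z p. norm z < \<rho> \<Longrightarrow> norm p < \<rho> \<Longrightarrow> B z p = eval2 a z p"
    using holomorphic_bidisc_expansion by blast
  have lim: "((\<lambda>t. B (of_real t * z) (of_real t ^ 2 * y t) / of_real t ^ k) \<longlongrightarrow>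
      (\<Sum>(i, j)\<in>{(i, j). i + 2 * j = k}. a i j * z ^ i * (1 - z\<^sup>2) ^ j)) (at_right (0::real))"
    if van: "\<And>i j. i + 2 * j < k \<Longrightarrow> a i j = 0" and y: "(y \<longlongrightarrow> 1 - z\<^sup>2) (at_right 0)" for k z y
  proof -
    have t: "((\<lambda>t. complex_of_real t) \<longlongrightarrow> complex_of_real 0) (at_right (0::real))"
      by (intro tendsto_intros)
    have "((\<lambda>t. norm (of_real t * z)) \<longlongrightarrow> norm (complex_of_real 0 * z)) (at_right (0::real))"
      by (intro tendsto_intros t)
    then have e1: "\<forall>\<^sub>F t in at_right (0::real). norm (of_real t * z) < \<rho>"
      using \<rho> by (intro order_tendstoD(2)) auto
    have "((\<lambda>t. norm (of_real t ^ 2 * y t)) \<longlongrightarrow> norm (complex_of_real 0 ^ 2 * (1 - z\<^sup>2))) (at_right (0::real))"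
      by (intro tendsto_intros t y)
    then have e2: "\<forall>\<^sub>F t in at_right (0::real). norm (of_real t ^ 2 * y t) < \<rho>"
      using \<rho> by (intro order_tendstoD(2)) auto
    have "\<forall>\<^sub>F t in at_right (0::real). eval2 a (of_real t * z) (of_real t ^ 2 * y t) / of_real t ^ k
        = B (of_real t * z) (of_real t ^ 2 * y t) / of_real t ^ k"
      using e1 e2 by eventually_elim (simp add: Ba)
    moreover have "((\<lambda>t. eval2 a (of_real t * z) (of_real t ^ 2 * y t) / of_real t ^ k) \<longlongrightarrow>
      (\<Sum>(i, j)\<in>{(i, j). i + 2 * j = k}. a i j * z ^ i * (1 - z\<^sup>2) ^ j)) (at_right (0::real))"
      by (rule eval2_weighted_limit[OF a _ van y]) auto
    ultimately show ?thesis by (rule Lim_transform_eventually[rotated])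
  qed
  \<comment> \<open>Induction on the weight: once all smaller weights vanish, the part of weight
    \<open>?k\<close> is the limit of B / t ^ \<open>?k\<close>, and this is 0 since even B / t ^ (n
    - 1) tends to 0.\<close>
  have van: "a i j = 0" if "i + 2 * j < n" for i j
    using that
  proof (induction "i + 2 * j" arbitrary: i j rule: less_induct)
    case less
    let ?k = "i + 2 * j"
    have lead: "leading B (n - 1) (\<lambda>_. 0)" using n less.prems by auto
    show ?case
    proof (rule weighted_homogeneous_zero[OF _ refl])
      fix z :: complex
      have y: "((\<lambda>_. 1 - z\<^sup>2) \<longlongrightarrow> 1 - z\<^sup>2) (at_right (0::real))" by simp
      have l1: "((\<lambda>t. B (of_real t * z) (of_real t ^ 2 * (1 - z\<^sup>2)) / of_real t ^ ?k) \<longlongrightarrow>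
          (\<Sum>(i', j')\<in>{(i', j'). i' + 2 * j' = ?k}. a i' j' * z ^ i' * (1 - z\<^sup>2) ^ j')) (at_right (0::real))"
        by (rule lim[OF _ y]) (use less in auto)
      have l2: "((\<lambda>t. B (of_real t * z) (of_real t ^ 2 * (1 - z\<^sup>2)) / of_real t ^ ?k) \<longlongrightarrow> 0) (at_right (0::real))"
      proof (cases "?k = n - 1")
        case True
        then show ?thesis using leadingD[OF lead y] by simp
      next
        case False
        then show ?thesis
          by (intro tendsto_zero_lower_power[OF leadingD[OF lead y]]) (use less.prems in auto)
      qed
      show "(\<Sum>(i', j')\<in>{(i', j'). i' + 2 * j' = ?k}. a i' j' * z ^ i' * (1 - z\<^sup>2) ^ j') = 0"
        using tendsto_unique[OF trivial_limit_at_right_real l1 l2] .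
    qed
  qed
  define \<beta> where "\<beta> = (\<Sum>(i, j)\<in>{(i, j). i + 2 * j = n}. smult (a i j) (monom 1 i * [:1, 0, - 1:] ^ j))"
  have pb: "poly \<beta> z = (\<Sum>(i, j)\<in>{(i, j). i + 2 * j = n}. a i j * z ^ i * (1 - z\<^sup>2) ^ j)" for z
    unfolding \<beta>_def poly_sum
    by (intro sum.cong) (auto simp: poly_monom power2_eq_square)
  show ?thesis
  proof
    fix z
    show "poly \<beta> (- z) = (- 1) ^ n * poly \<beta> z"
      unfolding pb sum_distrib_left
      by (intro sum.cong) (auto simp: power_add power_mult power_minus[of z])
    show "leading B n (poly \<beta>)"
      unfolding leading_def pb using lim[OF van] by blast
  qed
qed

section \<open>Normalized germs as functions of \<open>p\<close>\<close>

lemma normalized_germ_at_zero: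
  assumes A: "holomorphic_germ A" and lead: "leading A 2 (\<lambda>_. 1)"
  shows "A 0 0 = 0" "deriv (A 0) 0 = 1"
proof -
  obtain \<rho> where \<rho>: "\<rho> > 0" and hol: "A 0 holomorphic_on ball 0 \<rho>"
    using A by (auto simp: holomorphic_germ_def holomorphic_bidisc_def)
  have "((\<lambda>t. A (of_real t * 0) (of_real t ^ 2 * 1) / of_real t ^ 2) \<longlongrightarrow> 1) (at_right (0::real))"
    by (rule leadingD[OF lead]) simp
  then have lim: "((\<lambda>t. A 0 (of_real t ^ 2) / of_real t ^ 2) \<longlongrightarrow> 1) (at_right (0::real))" by simp
  have t: "((\<lambda>t. complex_of_real t) \<longlongrightarrow> complex_of_real 0) (at_right (0::real))"
    by (intro tendsto_intros)
  have t2: "((\<lambda>t. complex_of_real t ^ 2) \<longlongrightarrow> 0) (at_right (0::real))"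
    using tendsto_power[OF t, of 2] by simp
  have "isCont (A 0) 0"
    using hol \<rho> by (metis centre_in_ball continuous_on_interior holomorphic_on_imp_continuous_on
        interior_open open_ball)
  then have l1: "((\<lambda>t. A 0 (of_real t ^ 2)) \<longlongrightarrow> A 0 0) (at_right (0::real))"
    using t2 by (rule isCont_tendsto_compose)
  have "((\<lambda>t. A 0 (of_real t ^ 2) / of_real t ^ 0) \<longlongrightarrow> 0) (at_right (0::real))"
    by (rule tendsto_zero_lower_power[OF lim]) simp
  then show A0: "A 0 0 = 0"
    using tendsto_unique[OF trivial_limit_at_right_real l1] by simp
  have "(A 0 has_field_derivative deriv (A 0) 0) (at 0)"
    using hol \<rho> by (intro holomorphic_derivI[OF hol]) auto
  then have d: "((\<lambda>h. A 0 h / h) \<longlongrightarrow> deriv (A 0) 0) (at 0)"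
    by (simp add: DERIV_def A0)
  have "filterlim (\<lambda>t. complex_of_real t ^ 2) (at 0) (at_right (0::real))"
    unfolding filterlim_at using t2 by (auto simp: eventually_at_right_less eventually_at_filter)
  from filterlim_compose[OF d this]
  show "deriv (A 0) 0 = 1"
    using tendsto_unique[OF trivial_limit_at_right_real _ lim] by blast
qed

text \<open>The derivative of A z p - p in p is small near the origin: \<open>deriv (A 0)\<close> is
  continuous with value 1 at 0, and A z - A 0 is uniformly small, hence so is its derivative by
  Cauchy's inequality.\<close>

lemma normalized_germ_almost_isometric:
  assumes A: "holomorphic_germ A" and lead: "leading A 2 (\<lambda>_. 1)" and e: "e > 0"
  obtains \<delta> where "\<delta> > 0"
    "\<And>z u v. norm z < \<delta> \<Longrightarrow> norm u < \<delta> \<Longrightarrow> norm v < \<delta> \<Longrightarrow>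
       norm (A z u - A z v - (u - v)) \<le> e * norm (u - v)"
proof -
  obtain \<rho> where \<rho>: "\<rho> > 0" and cont: "continuous_on (ball 0 \<rho> \<times> ball 0 \<rho>) (\<lambda>(z, p). A z p)"
    and hol: "\<And>z. z \<in> ball 0 \<rho> \<Longrightarrow> A z holomorphic_on ball 0 \<rho>"
    using A by (auto simp: holomorphic_germ_def holomorphic_bidisc_def)
  have hol0: "A 0 holomorphic_on ball 0 \<rho>" using hol \<rho> by auto
  have "continuous_on (ball 0 \<rho>) (deriv (A 0))"
    using hol0 by (intro holomorphic_on_imp_continuous_on holomorphic_deriv) auto
  then have "isCont (deriv (A 0)) 0"
    using \<rho> by (metis centre_in_ball continuous_on_interior interior_open open_ball)
  then obtain \<delta>1 where \<delta>1: "\<delta>1 > 0" "\<And>p. norm p < \<delta>1 \<Longrightarrow> norm (deriv (A 0) p - 1) < e / 2"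
    using e unfolding continuous_at_eps_delta normalized_germ_at_zero(2)[OF A lead]
    by (metis diff_zero dist_norm half_gt_zero)
  let ?K = "cball (0::complex) (\<rho>/2) \<times> cball (0::complex) (\<rho>/2)"
  have "uniformly_continuous_on ?K (\<lambda>(z, p). A z p)"
    using \<rho> by (intro compact_uniformly_continuous compact_Times continuous_on_subset[OF cont]) auto
  \<comment> \<open>Cauchy's inequality on discs of radius \<rho> / 4 turns the bound e * \<rho> / 8
    into e / 2, the half of \<open>e\<close> left over by \<open>deriv (A 0)\<close>.\<close>
  moreover have "e * \<rho> / 8 > 0" using e \<rho> by simp
  ultimately obtain \<delta>2 where \<delta>2: "\<delta>2 > 0"
    "\<And>x x'. x \<in> ?K \<Longrightarrow> x' \<in> ?K \<Longrightarrow> dist x' x < \<delta>2 \<Longrightarrow>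
        dist (case x' of (z, p) \<Rightarrow> A z p) (case x of (z, p) \<Rightarrow> A z p) < e * \<rho> / 8"
    unfolding uniformly_continuous_on_def by metis
  define \<delta> where "\<delta> = min \<delta>1 (min \<delta>2 (\<rho> / 4))"
  have \<delta>: "\<delta> > 0" "\<delta> \<le> \<delta>1" "\<delta> \<le> \<delta>2" "\<delta> \<le> \<rho> / 4" using \<delta>1 \<delta>2 \<rho> by (auto simp: \<delta>_def)
  show ?thesis
  proof
    show "\<delta> > 0" by fact
    fix z u v :: complex assume z: "norm z < \<delta>" and uv: "norm u < \<delta>" "norm v < \<delta>"
    have zb: "z \<in> ball 0 \<rho>" using z \<delta> \<rho> by simp
    define h where "h = (\<lambda>p. A z p - A 0 p)"
    have hh: "h holomorphic_on ball 0 \<rho>"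
      unfolding h_def using hol[OF zb] hol0 by (intro holomorphic_intros)
    have hs: "norm (h p) \<le> e * \<rho> / 8" if "norm p \<le> \<rho> / 2" for p
      using \<delta>2(2)[of "(0, p)" "(z, p)"] that z \<delta> \<rho> by (auto simp: h_def dist_norm norm_Pair)
    have hd: "norm (deriv h p) \<le> e / 2" if p: "norm p < \<delta>" for p
    proof -
      have sub: "cball p (\<rho>/4) \<subseteq> cball 0 (\<rho>/2)"
      proof
        fix x assume "x \<in> cball p (\<rho>/4)"
        then have "norm (x - p) \<le> \<rho>/4" by (simp add: dist_norm norm_minus_commute)
        then show "x \<in> cball 0 (\<rho>/2)"
          using norm_triangle_ineq[of "x - p" p] p \<delta> by simp
      qed
      have sub2: "cball p (\<rho>/4) \<subseteq> ball 0 \<rho>"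
        using sub \<rho> by (auto simp: subset_iff)
      have "norm ((deriv ^^ 1) h p) \<le> fact 1 * (e * \<rho> / 8) / (\<rho>/4) ^ 1"
      proof (rule Cauchy_inequality)
        show "h holomorphic_on ball p (\<rho>/4)"
          using holomorphic_on_subset[OF hh] sub2 ball_subset_cball by blast
        show "continuous_on (cball p (\<rho>/4)) h"
          using holomorphic_on_imp_continuous_on[OF holomorphic_on_subset[OF hh sub2]] .
        show "norm (h x) \<le> e * \<rho> / 8" if "norm (p - x) = \<rho> / 4" for x
          using sub that by (intro hs) (auto simp: subset_iff dist_norm)
      qed (use \<rho> in auto)
      then show ?thesis using \<rho> by simp
    qed
    have "norm ((\<lambda>p. A z p - p) u - (\<lambda>p. A z p - p) v) \<le> e * norm (u - v)"
    proof (rule field_differentiable_bound[where S = "ball 0 \<delta>" and f' = "\<lambda>p. (deriv (A 0) p - 1) + deriv h p"])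
      fix p :: complex assume p: "p \<in> ball 0 \<delta>"
      then have pb: "p \<in> ball 0 \<rho>" using \<delta> \<rho> by auto
      have "((\<lambda>p. (A 0 p - p) + h p) has_field_derivative (deriv (A 0) p - 1) + deriv h p) (at p)"
        by (intro derivative_intros holomorphic_derivI[OF hol0 _ pb] holomorphic_derivI[OF hh _ pb]) auto
      moreover have "(\<lambda>p. (A 0 p - p) + h p) = (\<lambda>p. A z p - p)" by (simp add: h_def)
      ultimately show "((\<lambda>p. A z p - p) has_field_derivative (deriv (A 0) p - 1) + deriv h p)
          (at p within ball 0 \<delta>)"
        by (simp add: has_field_derivative_at_within)
      show "norm ((deriv (A 0) p - 1) + deriv h p) \<le> e"
        using norm_triangle_ineq[of "deriv (A 0) p - 1" "deriv h p"] hd[of p] \<delta>1(2)[of p] p \<delta>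
        by auto
    qed (use uv in auto)
    then show "norm (A z u - A z v - (u - v)) \<le> e * norm (u - v)"
      by (simp add: algebra_simps)
  qed
qed

section \<open>Polynomials on the line \<open>Re z = 1/2\<close>\<close>

lemma poly_eq_0_on_line:
  fixes p :: "complex poly"
  assumes "\<And>z. Re z = 1/2 \<Longrightarrow> poly p z = 0"
  shows "p = 0"
proof (rule ccontr)
  assume "p \<noteq> 0"
  then have fin: "finite {z. poly p z = 0}" by (rule poly_roots_finite)
  have "inj (\<lambda>x. Complex (1/2) x)" by (auto simp: inj_on_def)
  then have "infinite (range (\<lambda>x. Complex (1/2) x))"
    using infinite_UNIV_char_0 finite_imageD by blast
  moreover have "range (\<lambda>x. Complex (1/2) x) \<subseteq> {z. poly p z = 0}"
    using assms by auto
  ultimately show False using fin finite_subset by blast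
qed

lemma poly_periodic_constant:
  fixes p :: "complex poly"
  assumes "\<And>z. poly p (z + c) = poly p z" "c \<noteq> 0"
  shows "poly p z = poly p 0"
proof -
  have per: "poly p (of_nat k * c) = poly p 0" for k
  proof (induction k)
    case (Suc k)
    then show ?case using assms(1)[of "of_nat k * c"] by (simp add: algebra_simps)
  qed simp
  let ?q = "p - [:poly p 0:]"
  have "?q = 0"
  proof (rule ccontr)
    assume "?q \<noteq> 0"
    then have fin: "finite {z. poly ?q z = 0}" by (rule poly_roots_finite)
    have "inj (\<lambda>k::nat. of_nat k * c)" using assms(2) by (auto simp: inj_on_def)
    then have "infinite (range (\<lambda>k::nat. of_nat k * c))"
      using infinite_UNIV_nat finite_imageD by blast
    moreover have "range (\<lambda>k::nat. of_nat k * c) \<subseteq> {z. poly ?q z = 0}"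
      using per by auto
    ultimately show False using fin finite_subset by blast
  qed
  then have "poly ?q z = 0" by simp
  then show ?thesis by simp
qed

lemma poly_antiperiodic_zero:
  fixes p :: "complex poly"
  assumes "\<And>z. poly p (z + c) = - poly p z" "c \<noteq> 0"
  shows "poly p z = 0"
proof -
  have "poly p (z + 2 * c) = poly p z" for z
    using assms(1)[of z] assms(1)[of "z + c"] by (simp add: algebra_simps)
  then have "poly p z = poly p 0" for z
    using assms(2) by (intro poly_periodic_constant[of p "2 * c"]) auto
  then have "poly p z = poly p (z + c)" by metis
  then show ?thesis using assms(1)[of z] by simp
qed

text \<open>On the line \<open>Re z = 1/2\<close> one has \<open>cnj z = 1 - z\<close>, which makes the next identity polynomial.\<close>
lemma poly_im_on_line:
  fixes \<beta> g :: "complex poly"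
  assumes "\<And>z. Re z = 1/2 \<Longrightarrow> 2 * \<i> * of_real (Im (poly \<beta> z)) = poly g z"
  shows "poly \<beta> z - poly (map_poly cnj \<beta>) (1 - z) = poly g z"
proof -
  let ?p = "\<beta> - pcompose (map_poly cnj \<beta>) [:1, - 1:] - g"
  have "?p = 0"
  proof (rule poly_eq_0_on_line)
    fix z :: complex assume z: "Re z = 1/2"
    then have "cnj (1 - z) = z" by (auto simp: complex_eq_iff)
    moreover have "poly \<beta> z - cnj (poly \<beta> z) = 2 * \<i> * of_real (Im (poly \<beta> z))"
      by (simp add: complex_eq_iff)
    ultimately show "poly ?p z = 0"
      using assms[OF z] by (simp add: poly_pcompose)
  qed
  then have "poly ?p z = 0" by simp
  then show ?thesis by (simp add: poly_pcompose)
qed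

text \<open>Reality on the line gives a symmetry under the reflection z \<mapsto> 1 - cnj z.
  Combined with the parity under z \<mapsto> - z it gives the period 2, so the polynomial is
  constant; a constant that is odd is 0. This rigidity leaves only real multiples of powers of p +
  z^2.\<close>

lemma poly_real_on_line:
  fixes \<beta> :: "complex poly"
  assumes par: "\<And>z. poly \<beta> (- z) = (- 1) ^ n * poly \<beta> z"
    and real: "\<And>z. Re z = 1/2 \<Longrightarrow> Im (poly \<beta> z) = 0"
  obtains s :: real where "\<And>z. poly \<beta> z = of_real s" "odd n \<Longrightarrow> s = 0"
proof -
  have id: "poly \<beta> z = cnj (poly \<beta> (1 - cnj z))" for z
    using poly_im_on_line[of \<beta> 0 z] real by simp
  have "poly \<beta> (z + 2) = poly \<beta> z" for z
  proof -
    have "poly \<beta> (z + 2) = cnj (poly \<beta> (- (1 + cnj z)))"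
      using id[of "z + 2"] by (simp add: algebra_simps)
    also have "\<dots> = (- 1) ^ n * cnj (poly \<beta> (1 + cnj z))"
      unfolding par by simp
    also have "\<dots> = (- 1) ^ n * poly \<beta> (- z)"
      using id[of "- z"] by simp
    also have "\<dots> = poly \<beta> z"
      unfolding par by (simp flip: mult.assoc power_mult_distrib)
    finally show ?thesis .
  qed
  then have const: "poly \<beta> z = poly \<beta> 0" for z
    by (intro poly_periodic_constant[of \<beta> 2]) auto
  have "Im (poly \<beta> 0) = 0"
    using real[of "1/2"] const[of "1/2"] by simp
  then have r: "poly \<beta> 0 = of_real (Re (poly \<beta> 0))" by (simp add: complex_eq_iff)
  show ?thesis
  proof
    show "poly \<beta> z = of_real (Re (poly \<beta> 0))" for z using const[of z] r by metis
    show "Re (poly \<beta> 0) = 0" if "odd n" using par[of 0] that by simp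
  qed
qed

section \<open>Euler numbers and the difference equation\<close>

text \<open>
  The inverse of the operator \<open>h \<mapsto> h (s + 1) + h (s - 1)\<close> is, symbolically, \<open>sech\<close> of the
  derivative, up to the factor 2. The Euler numbers grow faster than geometrically because \<open>sech\<close>
  has a pole at \<open>\<i> * pi / 2\<close>.
\<close>
definition sech_fps :: "complex fps" where
  "sech_fps = 2 * inverse (fps_exp 1 + fps_exp (- 1))"

lemma sech_fps_mult: "sech_fps * (fps_exp 1 + fps_exp (- 1)) = 2"
proof -
  have "inverse (fps_exp 1 + fps_exp (- 1)) * (fps_exp 1 + fps_exp (- 1) :: complex fps) = 1"
    by (rule inverse_mult_eq_1) simp
  then show ?thesis by (simp add: sech_fps_def mult.assoc)
qed

definition euler_number :: "nat \<Rightarrow> complex" where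
  "euler_number k = fact k * sech_fps $ k"

text \<open>\<open>H\<close> is the Euler polynomial of degree k, rescaled, with generating function
  sech x * exp (s * x). Shifting s by 1 and - 1 multiplies this by exp x and exp (- x), and the sum
  of the two factors cancels the denominator of sech.\<close>

lemma euler_poly_exists:
  obtains H :: "complex poly" where
    "\<And>s. poly H (s + 1) + poly H (s - 1) = 2 * s ^ k" "poly H 0 = euler_number k"
proof -
  define H :: "complex poly" where
    "H = (\<Sum>j\<le>k. monom (fact k * sech_fps $ j / fact (k - j)) (k - j))"
  have H: "poly H s = fact k * (sech_fps * fps_exp s) $ k" for s
    unfolding H_def poly_sum fps_mult_nth sum_distrib_left atMost_atLeast0
    by (intro sum.cong) (auto simp: poly_monom)
  show ?thesis
  proof
    fix s
    have "poly H (s + 1) + poly H (s - 1)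
        = fact k * (sech_fps * (fps_exp s * fps_exp 1 + fps_exp s * fps_exp (- 1))) $ k"
      using fps_exp_add_mult[of s 1] fps_exp_add_mult[of s "- 1"]
      unfolding H by (simp add: algebra_simps)
    also have "sech_fps * (fps_exp s * fps_exp 1 + fps_exp s * fps_exp (- 1))
        = (sech_fps * (fps_exp 1 + fps_exp (- 1))) * fps_exp s"
      by (simp only: algebra_simps)
    also have "\<dots> = 2 * fps_exp s" unfolding sech_fps_mult ..
    finally show "poly H (s + 1) + poly H (s - 1) = 2 * s ^ k"
      by (simp add: fps_numeral_nth mult.left_commute flip: numeral_fps_const)
  next
    show "poly H 0 = euler_number k" unfolding H by (simp add: euler_number_def)
  qed
qed

text \<open>For odd k the even part of \<open>H\<close> solves the homogeneous difference equation
  and therefore vanishes. The surfaces only see even indices; this supplies the remaining ones in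
  the convergence argument.\<close>

lemma euler_number_odd:
  assumes "odd k"
  shows "euler_number k = 0"
proof -
  obtain H :: "complex poly" where H: "\<And>s. poly H (s + 1) + poly H (s - 1) = 2 * s ^ k"
    and H0: "poly H 0 = euler_number k"
    using euler_poly_exists[of k] by blast
  let ?D = "H + pcompose H [:0, - 1:]"
  have "poly ?D 0 = 0"
  proof (rule poly_antiperiodic_zero[where c = 2])
    fix z
    have "poly H (z + 2) + poly H z = 2 * (z + 1) ^ k" using H[of "z + 1"] by (simp add: algebra_simps)
    moreover have "poly H (- z) + poly H (- (z + 2)) = - (2 * (z + 1) ^ k)"
      using H[of "- (z + 1)"] assms power_minus_odd[of k "z + 1"] by (simp add: algebra_simps)
    ultimately have "(poly H (z + 2) + poly H z) + (poly H (- z) + poly H (- (z + 2))) = 0" by simp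
    then have "poly ?D (z + 2) + poly ?D z = 0" by (simp add: poly_pcompose algebra_simps)
    then show "poly ?D (z + 2) = - poly ?D z" by (simp only: eq_neg_iff_add_eq_0)
  qed simp
  then show ?thesis by (simp add: poly_pcompose H0)
qed

lemma euler_number_not_geometric:
  "\<not> (\<exists>C R. \<forall>k. even k \<longrightarrow> norm (euler_number k) \<le> C * R ^ k)"
proof
  assume "\<exists>C R. \<forall>k. even k \<longrightarrow> norm (euler_number k) \<le> C * R ^ k"
  then obtain C R where CR: "\<And>k. even k \<Longrightarrow> norm (euler_number k) \<le> C * R ^ k" by blast
  have bd: "norm (euler_number k) \<le> \<bar>C\<bar> * \<bar>R\<bar> ^ k" for k
  proof (cases "even k")
    case True
    then show ?thesis
      using CR[OF True] abs_ge_self[of "C * R ^ k"] by (simp add: abs_mult power_abs)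
  qed (simp add: euler_number_odd)
  define w where "w = \<i> * complex_of_real (pi / 2)"
  \<comment> \<open>The point \<open>2 * w\<close> instead of \<open>w\<close> yields a radius of
    convergence strictly larger than |w|. Evaluating the identity sech * (exp x + exp (- x)) = 2 at
    the zero \<open>w\<close> of cosh is then legitimate and absurd.\<close>
  have "summable (\<lambda>k. sech_fps $ k * (2 * w) ^ k)"
  proof (rule summable_comparison_test')
    show "summable (\<lambda>k. \<bar>C\<bar> * (inverse (fact k) * (\<bar>R\<bar> * norm (2 * w)) ^ k))"
      by (intro summable_mult summable_exp)
    show "norm (sech_fps $ k * (2 * w) ^ k) \<le> \<bar>C\<bar> * (inverse (fact k) * (\<bar>R\<bar> * norm (2 * w)) ^ k)"
      if "k \<ge> 0" for k
    proof -
      have "norm (sech_fps $ k) = inverse (fact k) * norm (euler_number k)"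
        by (simp add: euler_number_def norm_mult)
      then have "norm (sech_fps $ k * (2 * w) ^ k)
          = inverse (fact k) * norm (euler_number k) * norm (2 * w) ^ k"
        by (simp add: norm_mult norm_power)
      also have "\<dots> \<le> inverse (fact k) * (\<bar>C\<bar> * \<bar>R\<bar> ^ k) * norm (2 * w) ^ k"
        by (intro mult_right_mono mult_left_mono bd) auto
      finally show ?thesis by (simp add: power_mult_distrib mult_ac)
    qed
  qed
  then have "ereal (norm (2 * w)) \<le> fps_conv_radius sech_fps"
    unfolding fps_conv_radius_def by (rule conv_radius_geI)
  moreover have "norm w < norm (2 * w)" by (simp add: w_def norm_mult)
  ultimately have w: "ereal (norm w) < fps_conv_radius sech_fps"
    by (meson ereal_less_eq(3) less_ereal.simps(1) less_le_trans)
  let ?E = "fps_exp 1 + fps_exp (- 1) :: complex fps"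
  have wE: "ereal (norm w) < fps_conv_radius ?E"
    using fps_conv_radius_add[of "fps_exp 1 :: complex fps" "fps_exp (- 1)"] by simp
  have "eval_fps (sech_fps * ?E) w = eval_fps sech_fps w * eval_fps ?E w"
    by (rule eval_fps_mult[OF w wE])
  also have "eval_fps ?E w = exp w + exp (- w)"
    by (subst eval_fps_add) simp_all
  also have "exp w = \<i>"
    by (simp add: w_def exp_Euler cos_of_real sin_of_real del: of_real_divide)
  also have "exp (- w) = - \<i>"
    using \<open>exp w = \<i>\<close> by (simp add: exp_minus)
  finally show False unfolding sech_fps_mult by simp
qed

text \<open>Let D be \<open>\<beta>\<close> minus its coefficientwise conjugate. Adding the
  polynomial identity for the arguments z + 1 and - z and using parity gives D (z + 1) + D z = 2 * K
  * (2 * z + 1) ^ k. The only polynomial solution is K * H (2 * z), evaluated at 0.\<close>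

lemma poly_im_power_on_line:
  fixes \<beta> :: "complex poly"
  assumes par: "\<And>z. poly \<beta> (- z) = poly \<beta> z" and k: "even k"
    and im: "\<And>z. Re z = 1/2 \<Longrightarrow> Im (poly \<beta> z) = - c * Re ((2 * z - 1) ^ k)"
  shows "poly \<beta> 0 - cnj (poly \<beta> 0) = - 2 * \<i> * of_real c * euler_number k"
proof -
  obtain H :: "complex poly" where H: "\<And>s. poly H (s + 1) + poly H (s - 1) = 2 * s ^ k"
    and H0: "poly H 0 = euler_number k"
    using euler_poly_exists[of k] by blast
  define K where "K = - 2 * \<i> * complex_of_real c"
  let ?g = "smult K ([:- 1, 2:] ^ k)"
  let ?cb = "map_poly cnj \<beta>"
  have id: "poly \<beta> z - poly ?cb (1 - z) = poly ?g z" for z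
  proof (rule poly_im_on_line)
    fix z :: complex assume z: "Re z = 1/2"
    obtain l where l: "k = 2 * l" using k by blast
    have "2 * z - 1 = \<i> * of_real (2 * Im z)" using z by (auto simp: complex_eq_iff)
    then have "(2 * z - 1) ^ k = of_real ((- (2 * Im z)\<^sup>2) ^ l)"
      by (simp add: l power_mult power_mult_distrib)
    then have "(2 * z - 1) ^ k = of_real (Re ((2 * z - 1) ^ k))" by simp
    then show "2 * \<i> * of_real (Im (poly \<beta> z)) = poly ?g z"
      unfolding im[OF z] by (simp add: K_def poly_power algebra_simps)
  qed
  have cpar: "poly ?cb (- z) = poly ?cb z" for z using par by simp
  let ?D = "\<beta> - ?cb - smult K (pcompose H [:0, 2:])"
  have "poly ?D 0 = 0"
  proof (rule poly_antiperiodic_zero)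
    fix z :: complex
    have k': "(1 - 2 * (z + 1)) ^ k = (2 * z + 1) ^ k"
      using k power_minus_even[of k "2 * z + 1"] by (simp add: algebra_simps)
    have 1: "poly \<beta> (z + 1) - poly ?cb z = K * (2 * z + 1) ^ k"
      using id[of "z + 1"] cpar[of z] by (simp add: poly_power algebra_simps del: poly_map_poly_cnj)
    have 2: "poly \<beta> z - poly ?cb (z + 1) = K * (2 * z + 1) ^ k"
      using id[of "- z"] par[of z] k' k power_minus_even[of k "2 * z + 1"]
      by (simp add: poly_power algebra_simps del: poly_map_poly_cnj)
    have 3: "K * poly H (2 * z + 2) + K * poly H (2 * z) = 2 * (K * (2 * z + 1) ^ k)"
      using arg_cong[OF H[of "2 * z + 1"], of "\<lambda>x. K * x"] by (simp add: algebra_simps)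
    have "poly ?D (z + 1) + poly ?D z = (poly \<beta> (z + 1) - poly ?cb z) + (poly \<beta> z - poly ?cb (z + 1))
        - (K * poly H (2 * z + 2) + K * poly H (2 * z))"
      by (simp add: poly_pcompose algebra_simps del: poly_map_poly_cnj)
    also have "\<dots> = 0" unfolding 1 2 3 by simp
    finally show "poly ?D (z + 1) = - poly ?D z" by (simp only: eq_neg_iff_add_eq_0)
  qed simp
  then show ?thesis by (simp add: poly_pcompose H0 K_def eq_neg_iff_add_eq_0)
qed

section \<open>The invariant germ of a surface\<close>

text \<open>A finite limit at order m forces the lower coefficients to vanish, and they are divided
  out one at a time. Convergence is demanded only for x \<noteq> 0 so that f x / x satisfies the
  hypotheses again.\<close>

lemma powser_coeff_limit:
  fixes c :: "nat \<Rightarrow> complex"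
  assumes "s > 0" "\<And>x. x \<noteq> 0 \<Longrightarrow> norm x < s \<Longrightarrow> (\<lambda>n. c n * x ^ n) sums f x"
    and "filterlim x (at 0) F" "F \<noteq> bot" "((\<lambda>t. f (x t) / x t ^ m) \<longlongrightarrow> \<gamma>) F"
  shows "c m = \<gamma>"
  using assms(2,5)
proof (induction m arbitrary: c f)
  case 0
  have "(f \<longlongrightarrow> c 0) (at 0)"
    by (rule powser_limit_0_strong[OF assms(1) 0(1)])
  from filterlim_compose[OF this assms(3)] 0(2) show ?case
    using tendsto_unique[OF assms(4)] by simp
next
  case (Suc m)
  have x0: "\<forall>\<^sub>F t in F. x t \<noteq> 0" and xl: "(x \<longlongrightarrow> 0) F"
    using assms(3) by (auto simp: filterlim_at)
  have "((\<lambda>t. x t ^ Suc m * (f (x t) / x t ^ Suc m)) \<longlongrightarrow> 0 ^ Suc m * \<gamma>) F"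
    by (intro tendsto_mult tendsto_power xl Suc.prems(2))
  then have "((\<lambda>t. x t ^ Suc m * (f (x t) / x t ^ Suc m)) \<longlongrightarrow> 0) F" by simp
  moreover have "\<forall>\<^sub>F t in F. x t ^ Suc m * (f (x t) / x t ^ Suc m) = f (x t)"
    using x0 by eventually_elim simp
  ultimately have f0: "((\<lambda>t. f (x t)) \<longlongrightarrow> 0) F" by (rule Lim_transform_eventually)
  have "(f \<longlongrightarrow> c 0) (at 0)"
    by (rule powser_limit_0_strong[OF assms(1) Suc.prems(1)])
  from tendsto_unique[OF assms(4) filterlim_compose[OF this assms(3)] f0] have c0: "c 0 = 0" .
  show ?case
  proof (rule Suc.IH[of "\<lambda>n. c (Suc n)" "\<lambda>x. f x / x"])
    fix x :: complex assume x: "x \<noteq> 0" "norm x < s"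
    have "(\<lambda>n. c (Suc n) * x ^ Suc n) sums f x"
      using sums_split_initial_segment[OF Suc.prems(1)[OF x], of 1] c0 by simp
    then have "(\<lambda>n. c (Suc n) * x ^ Suc n / x) sums (f x / x)"
      by (rule sums_divide)
    then show "(\<lambda>n. c (Suc n) * x ^ n) sums (f x / x)" using x by simp
  next
    show "((\<lambda>t. f (x t) / x t / x t ^ m) \<longlongrightarrow> \<gamma>) F"
      using Suc.prems(2) by simp
  qed
qed

text \<open>The only combination of z^2 and p with value 1 on the curve p = 1 - z^2 is p + z^2. The
  condition thus says that the Taylor series starts with p + z^2 in weight 2.\<close>

definition normalized_germ :: "(complex \<Rightarrow> complex \<Rightarrow> complex) \<Rightarrow> bool" where
  "normalized_germ A \<longleftrightarrow> holomorphic_germ A \<and> leading A 2 (\<lambda>_. 1)"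

text \<open>Near the origin \<open>A\<close> preserves differences in \<open>p\<close> up to a
  relative error tending to 0, so differences of arguments and of values have the same
  asymptotics.\<close>

lemma normalized_germ_difference_limit:
  assumes A: "normalized_germ A"
    and lims: "(x \<longlongrightarrow> 0) F" "(u \<longlongrightarrow> 0) F" "(v \<longlongrightarrow> 0) F"
    and c: "((\<lambda>t. (u t - v t) / s t) \<longlongrightarrow> c) F"
  shows "((\<lambda>t. (A (x t) (u t) - A (x t) (v t)) / s t) \<longlongrightarrow> c) F"
proof -
  define D where "D = (\<lambda>t. (A (x t) (u t) - A (x t) (v t)) / s t - (u t - v t) / s t)"
  have "(D \<longlongrightarrow> 0) F"
  proof (rule tendstoI)
    fix \<epsilon> :: real assume \<epsilon>: "\<epsilon> > 0"
    define e where "e = \<epsilon> / (norm c + 1)"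
    have e: "e > 0" "e * (norm c + 1) = \<epsilon>"
      using \<epsilon> add_nonneg_pos[OF norm_ge_zero[of c] zero_less_one] by (auto simp: e_def)
    obtain \<delta> where \<delta>: "\<delta> > 0"
      "\<And>z u v. norm z < \<delta> \<Longrightarrow> norm u < \<delta> \<Longrightarrow> norm v < \<delta> \<Longrightarrow>
         norm (A z u - A z v - (u - v)) \<le> e * norm (u - v)"
      using normalized_germ_almost_isometric[OF _ _ e(1)] A unfolding normalized_germ_def by metis
    have small: "\<forall>\<^sub>F t in F. norm (f t) < \<delta>" if "(f \<longlongrightarrow> 0) F" for f :: "'a \<Rightarrow> complex"
      using order_tendstoD(2)[OF tendsto_norm[OF that], of \<delta>] \<delta>(1) by simp
    have "\<forall>\<^sub>F t in F. norm ((u t - v t) / s t) < norm c + 1"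
      using order_tendstoD(2)[OF tendsto_norm[OF c], of "norm c + 1"] by simp
    with small[OF lims(1)] small[OF lims(2)] small[OF lims(3)]
    show "\<forall>\<^sub>F t in F. dist (D t) 0 < \<epsilon>"
    proof eventually_elim
      case (elim t)
      have "norm (D t) = norm (A (x t) (u t) - A (x t) (v t) - (u t - v t)) / norm (s t)"
        by (simp add: D_def norm_divide flip: diff_divide_distrib)
      also have "\<dots> \<le> e * norm (u t - v t) / norm (s t)"
        using \<delta>(2)[OF elim(1-3)] by (rule divide_right_mono) simp
      also have "\<dots> = e * norm ((u t - v t) / s t)" by (simp add: norm_divide)
      also have "\<dots> < e * (norm c + 1)" using elim(4) e(1) by (rule mult_strict_left_mono)
      finally show ?case using e(2) by simp
    qed
  qed
  from tendsto_add[OF this c] show ?thesis by (simp add: D_def)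
qed

lemma normalized_germ_difference_limitD:
  assumes A: "normalized_germ A"
    and lims: "(x \<longlongrightarrow> 0) F" "(u \<longlongrightarrow> 0) F" "(v \<longlongrightarrow> 0) F"
    and c: "((\<lambda>t. (A (x t) (u t) - A (x t) (v t)) / s t) \<longlongrightarrow> c) F"
  shows "((\<lambda>t. (u t - v t) / s t) \<longlongrightarrow> c) F"
proof -
  define D where "D = (\<lambda>t. (u t - v t) / s t - (A (x t) (u t) - A (x t) (v t)) / s t)"
  have "(D \<longlongrightarrow> 0) F"
  proof (rule tendstoI)
    fix \<epsilon> :: real assume \<epsilon>: "\<epsilon> > 0"
    \<comment> \<open>The bound 1/2 lets differences of arguments be estimated by twice the
      differences of values; the other bound makes the final error at most
      \<open>\<epsilon>\<close>.\<close>
    define e where "e = min (1/2) (\<epsilon> / (2 * (norm c + 1)))"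
    have nc: "norm c + 1 > 0" by (simp add: add_nonneg_pos)
    have e: "e > 0" using \<epsilon> nc by (simp add: e_def)
    have e2: "e \<le> 1/2" unfolding e_def by (rule min.cobounded1)
    have "e \<le> \<epsilon> / (2 * (norm c + 1))" by (simp add: e_def)
    then have e': "2 * e * (norm c + 1) \<le> \<epsilon>"
      using nc by (simp only: pos_le_divide_eq mult_pos_pos zero_less_numeral mult_ac)
    obtain \<delta> where \<delta>: "\<delta> > 0"
      "\<And>z u v. norm z < \<delta> \<Longrightarrow> norm u < \<delta> \<Longrightarrow> norm v < \<delta> \<Longrightarrow>
         norm (A z u - A z v - (u - v)) \<le> e * norm (u - v)"
      using normalized_germ_almost_isometric[OF _ _ e] A unfolding normalized_germ_def by metis
    have small: "\<forall>\<^sub>F t in F. norm (f t) < \<delta>" if "(f \<longlongrightarrow> 0) F" for f :: "'a \<Rightarrow> complex"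
      using order_tendstoD(2)[OF tendsto_norm[OF that], of \<delta>] \<delta>(1) by simp
    have "\<forall>\<^sub>F t in F. norm ((A (x t) (u t) - A (x t) (v t)) / s t) < norm c + 1"
      using order_tendstoD(2)[OF tendsto_norm[OF c], of "norm c + 1"] by simp
    with small[OF lims(1)] small[OF lims(2)] small[OF lims(3)]
    show "\<forall>\<^sub>F t in F. dist (D t) 0 < \<epsilon>"
    proof eventually_elim
      case (elim t)
      let ?a = "A (x t) (u t) - A (x t) (v t)" and ?b = "u t - v t"
      have ab: "norm (?a - ?b) \<le> e * norm ?b" by (rule \<delta>(2)[OF elim(1-3)])
      also have "\<dots> \<le> 1/2 * norm ?b" using e2 by (rule mult_right_mono) simp
      finally have "norm ?b \<le> 2 * norm ?a"
        using norm_triangle_ineq2[of ?b "?b - ?a"] by (simp add: norm_minus_commute)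
      then have "e * norm ?b \<le> e * (2 * norm ?a)" using e by (intro mult_left_mono) auto
      with ab have "norm (?a - ?b) \<le> 2 * e * norm ?a" by (simp add: mult_ac)
      then have "norm (?a - ?b) / norm (s t) \<le> 2 * e * norm ?a / norm (s t)"
        by (rule divide_right_mono) simp
      moreover have "norm (D t) = norm (?a - ?b) / norm (s t)"
        by (simp add: D_def norm_divide norm_minus_commute flip: diff_divide_distrib)
      ultimately have "norm (D t) \<le> 2 * e * norm (?a / s t)" by (simp add: norm_divide)
      also have "\<dots> < 2 * e * (norm c + 1)" using elim(4) e by (intro mult_strict_left_mono) auto
      finally show ?case using e' by simp
    qed
  qed
  from tendsto_add[OF this c] show ?thesis by (simp add: D_def)
qed

lemma tendsto_of_real_at_right_0: "((\<lambda>t. complex_of_real t) \<longlongrightarrow> 0) (at_right (0::real))"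
  using tendsto_of_real[OF tendsto_ident_at[of "0::real" "{0<..}"]] by simp

text \<open>Only rays into the half-plane Re z > 0 are tested, each represented by its point with Re
  z = 1/2. This suffices because polynomial identities extend from that line.\<close>

definition tangent_to_Q :: "(complex \<Rightarrow> complex) \<Rightarrow> bool" where
  "tangent_to_Q P \<longleftrightarrow> (\<forall>z. Re z = 1/2 \<longrightarrow>
     ((\<lambda>t. P (of_real t * z) / of_real t ^ 2) \<longlongrightarrow> 1 - z\<^sup>2) (at_right (0::real)))"

definition real_on_graph :: "(complex \<Rightarrow> complex \<Rightarrow> complex) \<Rightarrow> (complex \<Rightarrow> complex) \<Rightarrow> bool" where
  "real_on_graph A P \<longleftrightarrow> (\<forall>z. Re z = 1/2 \<longrightarrow>
     (\<forall>\<^sub>F t in at_right (0::real). Im (A (of_real t * z) (P (of_real t * z))) = 0))"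

lemma leading_on_graph:
  assumes "leading B n \<beta>" "tangent_to_Q P" "Re z = 1/2"
  shows "((\<lambda>t. B (of_real t * z) (P (of_real t * z)) / of_real t ^ n) \<longlongrightarrow> \<beta> z) (at_right (0::real))"
proof -
  have "((\<lambda>t. B (of_real t * z) (of_real t ^ 2 * (P (of_real t * z) / of_real t ^ 2)) / of_real t ^ n)
      \<longlongrightarrow> \<beta> z) (at_right (0::real))"
    by (rule leadingD[OF assms(1)]) (use assms(2,3) in \<open>simp add: tangent_to_Q_def\<close>)
  moreover have "\<forall>\<^sub>F t in at_right (0::real).
      B (of_real t * z) (of_real t ^ 2 * (P (of_real t * z) / of_real t ^ 2)) / of_real t ^ n
      = B (of_real t * z) (P (of_real t * z)) / of_real t ^ n"
    using eventually_at_right_less[of "0::real"] by eventually_elim simp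
  ultimately show ?thesis by (rule Lim_transform_eventually)
qed

lemma tangent_to_Q_tendsto_0:
  assumes "tangent_to_Q P" "Re z = 1/2"
  shows "((\<lambda>t. P (of_real t * z)) \<longlongrightarrow> 0) (at_right (0::real))"
proof -
  have "((\<lambda>t. P (of_real t * z) / of_real t ^ 2) \<longlongrightarrow> 1 - z\<^sup>2) (at_right (0::real))"
    using assms by (auto simp: tangent_to_Q_def)
  from tendsto_zero_lower_power[OF this, of 0] show ?thesis by simp
qed

text \<open>
  As long as the leading part of \<open>A' - \<phi> \<circ> A\<close> is real on \<open>Q\<close>, it is a real multiple of a power
  of \<open>p + z\<^sup>2\<close>, which can be absorbed into \<open>\<phi>\<close>.
\<close>
lemma real_germs_compare:
  fixes P P' g :: "complex \<Rightarrow> complex"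
  assumes A: "normalized_germ A" "real_on_graph A P" "tangent_to_Q P"
    and A': "normalized_germ A'" "real_on_graph A' P'" "tangent_to_Q P'"
    and diff: "\<And>z. Re z = 1/2 \<Longrightarrow>
      ((\<lambda>t. (P' (of_real t * z) - P (of_real t * z)) / of_real t ^ (2 * m)) \<longlongrightarrow> g z) (at_right (0::real))"
  obtains \<phi> and \<beta> :: "complex poly" where
    "\<And>x. \<phi> (cnj x) = cnj (\<phi> x)"
    "leading (\<lambda>z p. A' z p - \<phi> (A z p)) (2 * m) (poly \<beta>)"
    "\<And>z. poly \<beta> (- z) = poly \<beta> z" "\<And>z. Re z = 1/2 \<Longrightarrow> Im (poly \<beta> z) = - Im (g z)"
proof -
  \<comment> \<open>On the graph of \<open>P\<close> the function \<phi> \<circ> A is real, and on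
    the graph of \<open>P'\<close> the function A' is real. The imaginary part of A' - \<phi>
    \<circ> A on \<open>P\<close> is thus that of the difference of A' between the two graphs, which
    \<open>A'_lim\<close> evaluates.\<close>
  have real_lim: "((\<lambda>t. Im ((A' (of_real t * z) (P (of_real t * z)) - A' (of_real t * z) (P' (of_real t * z)))
        / of_real t ^ n)) \<longlongrightarrow> Im (\<beta> z)) (at_right (0::real))"
    if \<phi>: "\<And>x. \<phi> (cnj x) = cnj (\<phi> x)" and lead: "leading (\<lambda>z p. A' z p - \<phi> (A z p)) n \<beta>"
      and z: "Re z = 1/2" for \<phi> n \<beta> z
  proof -
    have "\<forall>\<^sub>F t in at_right (0::real). Im (A (of_real t * z) (P (of_real t * z))) = 0"
      "\<forall>\<^sub>F t in at_right (0::real). Im (A' (of_real t * z) (P' (of_real t * z))) = 0"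
      using A(2) A'(2) z by (auto simp: real_on_graph_def)
    then have "\<forall>\<^sub>F t in at_right (0::real).
        Im ((A' (of_real t * z) (P (of_real t * z)) - \<phi> (A (of_real t * z) (P (of_real t * z)))) / of_real t ^ n)
        = Im ((A' (of_real t * z) (P (of_real t * z)) - A' (of_real t * z) (P' (of_real t * z))) / of_real t ^ n)"
    proof eventually_elim
      case (elim t)
      let ?x = "A (of_real t * z) (P (of_real t * z))"
      have "cnj ?x = ?x" using elim by (simp add: complex_eq_iff)
      with \<phi>[of ?x] have "\<phi> ?x = cnj (\<phi> ?x)" by (simp only:)
      from arg_cong[OF this, of Im] have "Im (\<phi> ?x) = 0" by simp
      then show ?case using elim by (simp flip: of_real_power)
    qed
    with tendsto_Im[OF leading_on_graph[OF lead A(3) z]] show ?thesis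
      by (rule Lim_transform_eventually)
  qed
  have A'_lim: "((\<lambda>t. (A' (of_real t * z) (P (of_real t * z)) - A' (of_real t * z) (P' (of_real t * z)))
        / of_real t ^ (2 * m)) \<longlongrightarrow> - g z) (at_right (0::real))" if z: "Re z = 1/2" for z
  proof (rule normalized_germ_difference_limit[OF A'(1)])
    show "((\<lambda>t. of_real t * z) \<longlongrightarrow> 0) (at_right (0::real))"
      using tendsto_mult_left_zero[OF tendsto_of_real_at_right_0] .
    show "((\<lambda>t. (P (of_real t * z) - P' (of_real t * z)) / of_real t ^ (2 * m)) \<longlongrightarrow> - g z) (at_right (0::real))"
    proof -
      have "(P (of_real t * z) - P' (of_real t * z)) / of_real t ^ (2 * m)
          = - ((P' (of_real t * z) - P (of_real t * z)) / of_real t ^ (2 * m))" for t :: real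
        by (metis minus_diff_eq minus_divide_left)
      then show ?thesis using tendsto_minus[OF diff[OF z]] by simp
    qed
    show "((\<lambda>t. P (of_real t * z)) \<longlongrightarrow> 0) (at_right (0::real))"
      by (rule tangent_to_Q_tendsto_0[OF A(3) z])
    show "((\<lambda>t. P' (of_real t * z)) \<longlongrightarrow> 0) (at_right (0::real))"
      by (rule tangent_to_Q_tendsto_0[OF A'(3) z])
  qed
  have germ: "holomorphic_germ (\<lambda>z p. A' z p - \<phi> (A z p))" if "\<phi> holomorphic_on UNIV" for \<phi>
    by (rule holomorphic_germ_diff[OF _ holomorphic_germ_compose[OF _ that]])
      (use A(1) A'(1) in \<open>simp_all add: normalized_germ_def\<close>)
  have "\<exists>\<phi>. \<phi> holomorphic_on UNIV \<and> (\<forall>x. \<phi> (cnj x) = cnj (\<phi> x)) \<and>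
      (n = 0 \<or> leading (\<lambda>z p. A' z p - \<phi> (A z p)) (n - 1) (\<lambda>_. 0))" if "n \<le> 2 * m" for n
    using that
  proof (induction n)
    case 0
    show ?case by (rule exI[of _ "\<lambda>_. 0"]) auto
  next
    case (Suc n)
    then obtain \<phi> where \<phi>: "\<phi> holomorphic_on UNIV" "\<And>x. \<phi> (cnj x) = cnj (\<phi> x)"
      "n = 0 \<or> leading (\<lambda>z p. A' z p - \<phi> (A z p)) (n - 1) (\<lambda>_. 0)"
      by auto
    obtain \<beta> :: "complex poly" where \<beta>: "\<And>z. poly \<beta> (- z) = (- 1) ^ n * poly \<beta> z"
      "leading (\<lambda>z p. A' z p - \<phi> (A z p)) n (poly \<beta>)"
      using leading_exists[OF germ[OF \<phi>(1)] \<phi>(3)] by blast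
    \<comment> \<open>Below weight 2 * m the graphs agree to higher order, so the difference of A'
      between them does not contribute.\<close>
    have im0: "Im (poly \<beta> z) = 0" if z: "Re z = 1/2" for z
    proof -
      have "n < 2 * m" using Suc.prems by simp
      from tendsto_Im[OF tendsto_zero_lower_power[OF A'_lim[OF z] this]]
      show ?thesis
        using tendsto_unique[OF trivial_limit_at_right_real real_lim[OF \<phi>(2) \<beta>(2) z]] by simp
    qed
    obtain s :: real where s: "\<And>z. poly \<beta> z = of_real s" "odd n \<Longrightarrow> s = 0"
      using poly_real_on_line[OF \<beta>(1) im0] by blast
    have pb: "poly \<beta> = (\<lambda>_. of_real s)" by (rule ext) (rule s(1))
    \<comment> \<open>A ^ (n div 2) has leading part 1 in weight n when n is even; for odd n the
      constant s is 0 and nothing is added.\<close>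
    define \<phi>' where "\<phi>' = (\<lambda>x. \<phi> x + of_real s * x ^ (n div 2))"
    have "leading (\<lambda>z p. A' z p - \<phi>' (A z p)) n (\<lambda>_. 0)"
    proof (cases "odd n")
      case True
      then show ?thesis using \<beta>(2) s(2)[OF True] unfolding \<phi>'_def pb by simp
    next
      case False
      then have "leading (\<lambda>z p. of_real s * A z p ^ (n div 2)) n (\<lambda>_. of_real s)"
        using leading_power[of A "of_real s" "n div 2"] A(1) by (simp add: normalized_germ_def)
      from leading_diff[OF \<beta>(2) this] show ?thesis
        unfolding \<phi>'_def pb by (simp add: diff_diff_eq)
    qed
    moreover have "\<phi>' holomorphic_on UNIV"
      unfolding \<phi>'_def by (intro holomorphic_intros \<phi>)
    moreover have "\<phi>' (cnj x) = cnj (\<phi>' x)" for x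
      by (simp add: \<phi>'_def \<phi>(2))
    ultimately show ?case by auto
  qed
  from this[of "2 * m"] obtain \<phi> where \<phi>: "\<phi> holomorphic_on UNIV" "\<And>x. \<phi> (cnj x) = cnj (\<phi> x)"
      "2 * m = 0 \<or> leading (\<lambda>z p. A' z p - \<phi> (A z p)) (2 * m - 1) (\<lambda>_. 0)"
    by auto
  obtain \<beta> :: "complex poly" where \<beta>: "\<And>z. poly \<beta> (- z) = (- 1) ^ (2 * m) * poly \<beta> z"
      "leading (\<lambda>z p. A' z p - \<phi> (A z p)) (2 * m) (poly \<beta>)"
    using leading_exists[OF germ[OF \<phi>(1)] \<phi>(3)] by blast
  show ?thesis
  proof (rule that[OF \<phi>(2) \<beta>(2)])
    show "poly \<beta> (- z) = poly \<beta> z" for z using \<beta>(1) by simp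
    show "Im (poly \<beta> z) = - Im (g z)" if z: "Re z = 1/2" for z
      using tendsto_unique[OF trivial_limit_at_right_real real_lim[OF \<phi>(2) \<beta>(2) z]
          tendsto_Im[OF A'_lim[OF z]]] by simp
  qed
qed

section \<open>The conjugation germ and its coefficients\<close>

text \<open>
  The germ \<open>\<kappa>\<close> with \<open>cnj \<circ> A 0 \<circ> cnj \<circ> \<kappa> = A 0\<close> does not change if \<open>A\<close> is composed with a real
  function. This makes it an invariant of the surface.
\<close>
definition conjugation_germ :: "(complex \<Rightarrow> complex \<Rightarrow> complex) \<Rightarrow> (complex \<Rightarrow> complex) \<Rightarrow> real \<Rightarrow> bool" where
  "conjugation_germ A \<kappa> \<rho> \<longleftrightarrow> \<rho> > 0 \<and> \<kappa> holomorphic_on ball 0 \<rho> \<and> \<kappa> 0 = 0 \<and>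
     (\<forall>p\<in>ball 0 \<rho>. A 0 (cnj (\<kappa> p)) = cnj (A 0 p))"

lemma conjugation_germ_exists:
  assumes A: "normalized_germ A"
  obtains \<kappa> \<rho> where "conjugation_germ A \<kappa> \<rho>"
proof -
  obtain \<sigma> where \<sigma>: "\<sigma> > 0" "A 0 holomorphic_on ball 0 \<sigma>"
    using A by (auto simp: normalized_germ_def holomorphic_germ_def holomorphic_bidisc_def)
  have A0: "A 0 0 = 0" "deriv (A 0) 0 = 1"
    using normalized_germ_at_zero A by (auto simp: normalized_germ_def)
  have in0: "0 \<in> ball 0 \<sigma>" and nz: "deriv (A 0) 0 \<noteq> 0" using \<sigma>(1) A0(2) by auto
  obtain r where r: "r > 0" "ball (0::complex) r \<subseteq> ball 0 \<sigma>" "inj_on (A 0) (ball 0 r)"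
    by (rule has_complex_derivative_locally_injective[OF \<sigma>(2) in0 open_ball nz])
  have hol: "A 0 holomorphic_on ball 0 r" using \<sigma>(2) r(2) by (rule holomorphic_on_subset)
  obtain h where h: "h holomorphic_on A 0 ` ball 0 r" "\<And>z. z \<in> ball 0 r \<Longrightarrow> h (A 0 z) = z"
    using holomorphic_has_inverse[OF hol open_ball r(3)] by metis
  have op: "open (A 0 ` ball 0 r)" by (rule open_mapping_thm3[OF hol open_ball r(3)])
  have "0 \<in> A 0 ` ball 0 r" using r(1) A0(1) by force
  then obtain \<epsilon> where \<epsilon>: "\<epsilon> > 0" "ball 0 \<epsilon> \<subseteq> A 0 ` ball 0 r"
    using op open_contains_ball by blast
  have "isCont (A 0) 0"
    using hol r(1) by (metis centre_in_ball continuous_on_interior holomorphic_on_imp_continuous_on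
        interior_open open_ball)
  then obtain \<delta> where \<delta>: "\<delta> > 0" "\<And>p. norm p < \<delta> \<Longrightarrow> norm (A 0 p) < \<epsilon>"
    using \<epsilon>(1) unfolding continuous_at_eps_delta by (metis A0(1) diff_zero dist_norm)
  define \<rho> where "\<rho> = min r \<delta>"
  \<comment> \<open>The defining equation solved for \<open>\<kappa>\<close> by the local inverse
    \<open>h\<close> of A 0; the two conjugations together keep it holomorphic.\<close>
  define \<kappa> where "\<kappa> = (\<lambda>p. cnj (h (cnj (A 0 p))))"
  have "conjugation_germ A \<kappa> \<rho>"
    unfolding conjugation_germ_def
  proof (intro conjI ballI)
    show "\<rho> > 0" using r \<delta> by (simp add: \<rho>_def)
    have "cnj ` ball 0 \<epsilon> \<subseteq> ball 0 \<epsilon>" by auto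
    then have "cnj \<circ> h \<circ> cnj holomorphic_on ball 0 \<epsilon>"
      by (intro holomorphic_on_compose_cnj_cnj holomorphic_on_subset[OF h(1)]) (use \<epsilon>(2) in auto)
    moreover have "A 0 ` ball 0 \<rho> \<subseteq> ball 0 \<epsilon>" using \<delta> by (auto simp: \<rho>_def)
    ultimately have "cnj \<circ> h \<circ> cnj holomorphic_on A 0 ` ball 0 \<rho>"
      by (rule holomorphic_on_subset)
    moreover have "A 0 holomorphic_on ball 0 \<rho>"
      by (rule holomorphic_on_subset[OF hol]) (auto simp: \<rho>_def)
    ultimately have "(cnj \<circ> h \<circ> cnj) \<circ> A 0 holomorphic_on ball 0 \<rho>"
      by (rule holomorphic_on_compose[rotated])
    then show "\<kappa> holomorphic_on ball 0 \<rho>" by (simp add: \<kappa>_def o_def)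
    show "\<kappa> 0 = 0" using h(2)[of 0] r(1) A0(1) by (simp add: \<kappa>_def)
    fix p :: complex assume "p \<in> ball 0 \<rho>"
    then have "norm (cnj (A 0 p)) < \<epsilon>" using \<delta>(2) by (simp add: \<rho>_def)
    then have "cnj (A 0 p) \<in> ball 0 \<epsilon>" by simp
    then obtain q where "q \<in> ball 0 r" "cnj (A 0 p) = A 0 q" using \<epsilon>(2) by blast
    then show "A 0 (cnj (\<kappa> p)) = cnj (A 0 p)" using h(2) by (simp add: \<kappa>_def)
  qed
  then show ?thesis by (rule that)
qed

text \<open>Cauchy's estimate on half of the radius; this is the bound that the chosen digits will
  violate.\<close>

lemma conjugation_germ_coeff_bound:
  assumes "conjugation_germ A \<kappa> \<rho>"
  shows "\<exists>C R. \<forall>n. norm ((deriv ^^ n) \<kappa> 0 / fact n) \<le> C * R ^ n"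
proof -
  have \<rho>: "\<rho> > 0" and hol: "\<kappa> holomorphic_on ball 0 \<rho>"
    using assms by (auto simp: conjugation_germ_def)
  have "compact (\<kappa> ` cball 0 (\<rho>/2))"
    using \<rho> by (intro compact_continuous_image holomorphic_on_imp_continuous_on
        holomorphic_on_subset[OF hol]) auto
  then obtain M where "\<And>x. x \<in> cball 0 (\<rho>/2) \<Longrightarrow> norm (\<kappa> x) \<le> M"
    by (force dest!: compact_imp_bounded simp: bounded_iff)
  then have "norm ((deriv ^^ n) \<kappa> 0 / fact n) \<le> M / (\<rho>/2) ^ n" for n
    using \<rho> by (intro taylor_coeff_bound[OF hol]) auto
  then have "norm ((deriv ^^ n) \<kappa> 0 / fact n) \<le> M * (2/\<rho>) ^ n" for n
    by (simp add: power_divide)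
  then show ?thesis by blast
qed

text \<open>Since cnj (k t) / t^2 tends to 1, the conjugated values of \<open>\<kappa>\<close> are
  admissible as second argument of a \<open>leading\<close> limit at z = 0.\<close>

lemma conjugation_germ_limits:
  assumes A: "normalized_germ A" and \<kappa>: "conjugation_germ A \<kappa> \<rho>"
  defines "k \<equiv> \<lambda>t. \<kappa> (complex_of_real t ^ 2)"
  shows "(k \<longlongrightarrow> 0) (at_right (0::real))" "((\<lambda>t. cnj (k t) / of_real t ^ 2) \<longlongrightarrow> 1) (at_right (0::real))"
    "\<forall>\<^sub>F t in at_right (0::real). A 0 (cnj (k t)) = cnj (A 0 (of_real t ^ 2))"
proof -
  have \<rho>: "\<rho> > 0" and hol: "\<kappa> holomorphic_on ball 0 \<rho>" and \<kappa>0: "\<kappa> 0 = 0"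
    and eq: "\<And>p. p \<in> ball 0 \<rho> \<Longrightarrow> A 0 (cnj (\<kappa> p)) = cnj (A 0 p)"
    using \<kappa> by (auto simp: conjugation_germ_def)
  have t2: "((\<lambda>t. complex_of_real t ^ 2) \<longlongrightarrow> 0) (at_right (0::real))"
    using tendsto_power[OF tendsto_of_real_at_right_0, of 2] by simp
  have "isCont \<kappa> 0"
    using hol \<rho> by (metis centre_in_ball continuous_on_interior holomorphic_on_imp_continuous_on
        interior_open open_ball)
  then show k0: "(k \<longlongrightarrow> 0) (at_right 0)"
    using isCont_tendsto_compose[OF _ t2] \<kappa>0 unfolding k_def by metis
  have "\<forall>\<^sub>F t in at_right (0::real). norm (complex_of_real t ^ 2) < \<rho>"
    using order_tendstoD(2)[OF tendsto_norm[OF t2], of \<rho>] \<rho> by simp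
  then show ev: "\<forall>\<^sub>F t in at_right (0::real). A 0 (cnj (k t)) = cnj (A 0 (of_real t ^ 2))"
    unfolding k_def by eventually_elim (use eq in simp)
  have A00: "A 0 0 = 0"
    using normalized_germ_at_zero A by (auto simp: normalized_germ_def)
  have "\<forall>\<^sub>F t in at_right (0::real). 1 = (complex_of_real t ^ 2 - 0) / of_real t ^ 2"
    using eventually_at_right_less[of "0::real"] by eventually_elim simp
  then have "((\<lambda>t. (complex_of_real t ^ 2 - 0) / of_real t ^ 2) \<longlongrightarrow> 1) (at_right (0::real))"
    by (rule Lim_transform_eventually[OF tendsto_const])
  then have "((\<lambda>t. (A 0 (complex_of_real t ^ 2) - A 0 0) / of_real t ^ 2) \<longlongrightarrow> 1) (at_right (0::real))"
    by (intro normalized_germ_difference_limit[OF A] t2 tendsto_const)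
  then have l: "((\<lambda>t. cnj (A 0 (complex_of_real t ^ 2) / of_real t ^ 2)) \<longlongrightarrow> cnj 1) (at_right (0::real))"
    unfolding A00 by (intro tendsto_cnj) simp
  have "\<forall>\<^sub>F t in at_right (0::real). cnj (A 0 (complex_of_real t ^ 2) / of_real t ^ 2)
      = (A 0 (cnj (k t)) - A 0 0) / of_real t ^ 2"
    using ev by eventually_elim (simp add: A00)
  with l have "((\<lambda>t. (A 0 (cnj (k t)) - A 0 0) / of_real t ^ 2) \<longlongrightarrow> cnj 1) (at_right (0::real))"
    by (rule Lim_transform_eventually)
  then have "((\<lambda>t. (cnj (k t) - 0) / of_real t ^ 2) \<longlongrightarrow> cnj 1) (at_right (0::real))"
    by (intro normalized_germ_difference_limitD[OF A, where x = "\<lambda>_. 0" and u = "\<lambda>t. cnj (k t)" and v = "\<lambda>_. 0"])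
      (use tendsto_cnj[OF k0] in simp_all)
  then show "((\<lambda>t. cnj (k t) / of_real t ^ 2) \<longlongrightarrow> 1) (at_right (0::real))" by simp
qed

text \<open>Put B = A' - \<phi> \<circ> A on z = 0. In cnj (B p) - B (cnj (\<kappa> p)) the terms
  with \<open>\<phi>\<close> cancel, because \<open>\<phi>\<close> commutes with conjugation, and A'
  (cnj (\<kappa>' p)) - A' (cnj (\<kappa> p)) remains. As A' almost preserves differences, this
  measures \<kappa>' - \<kappa>. With p = t^2, weight 2 * m becomes degree m.\<close>

lemma conjugation_germ_coeff_diff:
  assumes A: "normalized_germ A" "conjugation_germ A \<kappa> \<rho>"
    and A': "normalized_germ A'" "conjugation_germ A' \<kappa>' \<rho>'"
    and \<phi>: "\<And>x. \<phi> (cnj x) = cnj (\<phi> x)"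
    and lead: "leading (\<lambda>z p. A' z p - \<phi> (A z p)) (2 * m) \<beta>"
  shows "(deriv ^^ m) \<kappa>' 0 / fact m - (deriv ^^ m) \<kappa> 0 / fact m = \<beta> 0 - cnj (\<beta> 0)"
proof -
  define k where "k = (\<lambda>t::real. \<kappa> (of_real t ^ 2))"
  define k' where "k' = (\<lambda>t::real. \<kappa>' (of_real t ^ 2))"
  define B where "B = (\<lambda>p. A' 0 p - \<phi> (A 0 p))"
  have k: "(k \<longlongrightarrow> 0) (at_right (0::real))"
    "((\<lambda>t. cnj (k t) / of_real t ^ 2) \<longlongrightarrow> 1) (at_right (0::real))"
    "\<forall>\<^sub>F t in at_right (0::real). A 0 (cnj (k t)) = cnj (A 0 (of_real t ^ 2))"
    unfolding k_def by (rule conjugation_germ_limits[OF A])+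
  have k': "(k' \<longlongrightarrow> 0) (at_right (0::real))"
    "\<forall>\<^sub>F t in at_right (0::real). A' 0 (cnj (k' t)) = cnj (A' 0 (of_real t ^ 2))"
    unfolding k'_def by (rule conjugation_germ_limits[OF A'])+
  have t2: "((\<lambda>t. complex_of_real t ^ 2) \<longlongrightarrow> 0) (at_right (0::real))"
    using tendsto_power[OF tendsto_of_real_at_right_0, of 2] by simp
  have B1: "((\<lambda>t. B (of_real t ^ 2) / of_real t ^ (2 * m)) \<longlongrightarrow> \<beta> 0) (at_right (0::real))"
    using leadingD[OF lead, where y = "\<lambda>_. 1" and z = 0] by (simp add: B_def)
  have "((\<lambda>t. cnj (k t) / of_real t ^ 2) \<longlongrightarrow> 1 - 0\<^sup>2) (at_right (0::real))" using k(2) by simp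
  from leadingD[OF lead this]
  have "((\<lambda>t. B (of_real t ^ 2 * (cnj (k t) / of_real t ^ 2)) / of_real t ^ (2 * m)) \<longlongrightarrow> \<beta> 0) (at_right (0::real))"
    unfolding B_def mult_zero_right .
  moreover have "\<forall>\<^sub>F t in at_right (0::real). B (of_real t ^ 2 * (cnj (k t) / of_real t ^ 2)) / of_real t ^ (2 * m)
      = B (cnj (k t)) / of_real t ^ (2 * m)"
    using eventually_at_right_less[of "0::real"] by eventually_elim simp
  ultimately have B2: "((\<lambda>t. B (cnj (k t)) / of_real t ^ (2 * m)) \<longlongrightarrow> \<beta> 0) (at_right (0::real))"
    by (rule Lim_transform_eventually)
  have l: "((\<lambda>t. cnj (B (of_real t ^ 2) / of_real t ^ (2 * m)) - B (cnj (k t)) / of_real t ^ (2 * m))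
      \<longlongrightarrow> cnj (\<beta> 0) - \<beta> 0) (at_right (0::real))"
    by (intro tendsto_diff tendsto_cnj B1 B2)
  have "\<forall>\<^sub>F t in at_right (0::real).
      cnj (B (of_real t ^ 2) / of_real t ^ (2 * m)) - B (cnj (k t)) / of_real t ^ (2 * m)
      = (A' 0 (cnj (k' t)) - A' 0 (cnj (k t))) / of_real t ^ (2 * m)"
    using k(3) k'(2)
  proof eventually_elim
    case (elim t)
    have "cnj (B (of_real t ^ 2)) - B (cnj (k t)) = A' 0 (cnj (k' t)) - A' 0 (cnj (k t))"
      by (simp add: B_def elim \<phi>)
    then show ?case by (simp flip: diff_divide_distrib)
  qed
  with l have "((\<lambda>t. (A' 0 (cnj (k' t)) - A' 0 (cnj (k t))) / of_real t ^ (2 * m))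
      \<longlongrightarrow> cnj (\<beta> 0) - \<beta> 0) (at_right (0::real))"
    by (rule Lim_transform_eventually)
  then have "((\<lambda>t. (cnj (k' t) - cnj (k t)) / of_real t ^ (2 * m)) \<longlongrightarrow> cnj (\<beta> 0) - \<beta> 0) (at_right (0::real))"
    by (intro normalized_germ_difference_limitD[OF A'(1), where x = "\<lambda>_. 0" and u = "\<lambda>t. cnj (k' t)" and v = "\<lambda>t. cnj (k t)"])
      (use tendsto_cnj[OF k(1)] tendsto_cnj[OF k'(1)] in simp_all)
  from tendsto_cnj[OF this]
  have lim: "((\<lambda>t. (\<kappa>' (of_real t ^ 2) - \<kappa> (of_real t ^ 2)) / (of_real t ^ 2) ^ m) \<longlongrightarrow> \<beta> 0 - cnj (\<beta> 0)) (at_right (0::real))"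
    by (simp add: k_def k'_def power_mult)
  have x: "filterlim (\<lambda>t. complex_of_real t ^ 2) (at 0) (at_right (0::real))"
    unfolding filterlim_at using t2 by (auto simp: eventually_at_right_less eventually_at_filter)
  show ?thesis
  proof (rule powser_coeff_limit[OF _ _ x trivial_limit_at_right_real lim])
    show "min \<rho> \<rho>' > 0" using A A' by (auto simp: conjugation_germ_def)
    fix x :: complex assume "norm x < min \<rho> \<rho>'"
    then have "(\<lambda>n. (deriv ^^ n) \<kappa>' 0 / fact n * x ^ n - (deriv ^^ n) \<kappa> 0 / fact n * x ^ n) sums (\<kappa>' x - \<kappa> x)"
      using A A' holomorphic_power_series[of \<kappa> 0 \<rho> x] holomorphic_power_series[of \<kappa>' 0 \<rho>' x]
      by (intro sums_diff) (auto simp: conjugation_germ_def)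
    then show "(\<lambda>n. ((deriv ^^ n) \<kappa>' 0 / fact n - (deriv ^^ n) \<kappa> 0 / fact n) * x ^ n) sums (\<kappa>' x - \<kappa> x)"
      by (simp add: left_diff_distrib)
  qed
qed

section \<open>From transformations to real germs\<close>

definition surface_graph :: "pseries2 \<Rightarrow> complex \<Rightarrow> complex" where
  "surface_graph r z = 2 * z * cnj z + (cnj z)\<^sup>2 + eval2 (deriv_fst r) z (cnj z)"

lemma surface_graph_tangent:
  assumes "r \<in> X"
  shows "tangent_to_Q (surface_graph r)"
  unfolding tangent_to_Q_def
proof (intro allI impI)
  fix z :: complex assume z: "Re z = 1/2"
  have cz: "cnj z = 1 - z" using z by (auto simp: complex_eq_iff)
  have van: "deriv_fst r i j = 0" if "i + j \<le> 2" for i j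
    using X_low[OF assms, of "Suc i" j] that by (simp add: deriv_fst_def)
  have "((\<lambda>t. eval2 (deriv_fst r) (of_real t * z) (of_real t ^ 1 * cnj z) / of_real t ^ 2) \<longlongrightarrow>
      (\<Sum>(i, j)\<in>{(i, j). i + 1 * j = 2}. deriv_fst r i j * z ^ i * cnj z ^ j)) (at_right (0::real))"
    using X_geometric2[OF assms] van
    by (intro eval2_weighted_limit geometric2_deriv_fst tendsto_const) auto
  also have "(\<Sum>(i, j)\<in>{(i, j). i + 1 * j = 2}. deriv_fst r i j * z ^ i * cnj z ^ j) = 0"
    by (rule sum.neutral) (auto simp: van)
  finally have lim: "((\<lambda>t. (2 * z * cnj z + (cnj z)\<^sup>2) +
      eval2 (deriv_fst r) (of_real t * z) (of_real t ^ 1 * cnj z) / of_real t ^ 2) \<longlongrightarrow>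
      (2 * z * cnj z + (cnj z)\<^sup>2) + 0) (at_right (0::real))"
    by (intro tendsto_add tendsto_const)
  have eq: "(2 * z * cnj z + (cnj z)\<^sup>2) + 0 = 1 - z\<^sup>2"
    unfolding cz by (simp add: power2_eq_square algebra_simps)
  have "\<forall>\<^sub>F t in at_right (0::real). (2 * z * cnj z + (cnj z)\<^sup>2) +
      eval2 (deriv_fst r) (of_real t * z) (of_real t ^ 1 * cnj z) / of_real t ^ 2
      = surface_graph r (of_real t * z) / of_real t ^ 2"
    using eventually_at_right_less[of "0::real"]
    by eventually_elim (simp add: surface_graph_def add_divide_distrib power2_eq_square)
  from Lim_transform_eventually[OF lim this]
  show "((\<lambda>t. surface_graph r (of_real t * z) / of_real t ^ 2) \<longlongrightarrow> 1 - z\<^sup>2) (at_right (0::real))"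
    unfolding eq .
qed

text \<open>Differentiation lowers the degree by one: agreement of the series up to and including
  degree n leaves degree n as the first one in which the graphs can differ.\<close>

lemma surface_graph_diff:
  assumes r: "r \<in> X" "r' \<in> X" and z: "Re z = 1/2"
    and low: "\<And>i j. i + j \<le> n \<Longrightarrow> r' i j = r i j"
  shows "((\<lambda>t. (surface_graph r' (of_real t * z) - surface_graph r (of_real t * z)) / of_real t ^ n) \<longlongrightarrow>
    (\<Sum>(i, j)\<in>{(i, j). i + j = n}. (deriv_fst r' i j - deriv_fst r i j) * z ^ i * cnj z ^ j)) (at_right (0::real))"
proof -
  define s where "s = (\<lambda>i j. deriv_fst r' i j - deriv_fst r i j)"
  have g: "geometric2 (deriv_fst r)" "geometric2 (deriv_fst r')"
    using X_geometric2 r geometric2_deriv_fst by auto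
  then have gs: "geometric2 s" unfolding s_def by (intro geometric2_diff)
  have van: "s i j = 0" if "i + j < n" for i j
    using low[of "Suc i" j] that by (simp add: s_def deriv_fst_def)
  have lim: "((\<lambda>t. eval2 s (of_real t * z) (of_real t ^ 1 * cnj z) / of_real t ^ n) \<longlongrightarrow>
      (\<Sum>(i, j)\<in>{(i, j). i + 1 * j = n}. s i j * z ^ i * cnj z ^ j)) (at_right (0::real))"
    using van by (intro eval2_weighted_limit gs tendsto_const) auto
  obtain \<rho> where \<rho>: "\<rho> > 0"
    "\<And>z w. norm z \<le> \<rho> \<Longrightarrow> norm w \<le> \<rho> \<Longrightarrow> (\<lambda>(i, j). deriv_fst r i j * z ^ i * w ^ j) summable_on UNIV"
    using geometric2_summable[OF g(1)] by blast
  obtain \<sigma> where \<sigma>: "\<sigma> > 0"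
    "\<And>z w. norm z \<le> \<sigma> \<Longrightarrow> norm w \<le> \<sigma> \<Longrightarrow> (\<lambda>(i, j). deriv_fst r' i j * z ^ i * w ^ j) summable_on UNIV"
    using geometric2_summable[OF g(2)] by blast
  have eq: "eval2 s z w = eval2 (deriv_fst r') z w - eval2 (deriv_fst r) z w"
    if zw: "norm z \<le> \<rho>" "norm w \<le> \<rho>" "norm z \<le> \<sigma>" "norm w \<le> \<sigma>" for z w
  proof -
    have "eval2 s z w = (\<Sum>\<^sub>\<infinity>p\<in>UNIV. (case p of (i, j) \<Rightarrow> deriv_fst r' i j * z ^ i * w ^ j)
        - (case p of (i, j) \<Rightarrow> deriv_fst r i j * z ^ i * w ^ j))"
      unfolding eval2_def s_def by (intro infsum_cong) (auto simp: algebra_simps)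
    also have "\<dots> = eval2 (deriv_fst r') z w - eval2 (deriv_fst r) z w"
      using infsum_add[OF \<sigma>(2)[OF zw(3,4)] summable_on_uminus[THEN iffD2, OF \<rho>(2)[OF zw(1,2)]]]
      by (simp add: eval2_def infsum_uminus)
    finally show ?thesis .
  qed
  have "((\<lambda>t. norm (of_real t * z)) \<longlongrightarrow> 0) (at_right (0::real))"
    using tendsto_norm[OF tendsto_mult_left_zero[OF tendsto_of_real_at_right_0, of z]] by simp
  then have "\<forall>\<^sub>F t in at_right (0::real). norm (of_real t * z) < min \<rho> \<sigma>"
    using \<rho> \<sigma> by (intro order_tendstoD(2)) auto
  then have "\<forall>\<^sub>F t in at_right (0::real). eval2 s (of_real t * z) (of_real t ^ 1 * cnj z) / of_real t ^ n
      = (surface_graph r' (of_real t * z) - surface_graph r (of_real t * z)) / of_real t ^ n"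
  proof eventually_elim
    case (elim t)
    then have "eval2 s (of_real t * z) (of_real t ^ 1 * cnj z)
        = eval2 (deriv_fst r') (of_real t * z) (of_real t ^ 1 * cnj z) - eval2 (deriv_fst r) (of_real t * z) (of_real t ^ 1 * cnj z)"
      by (intro eq) (auto simp: norm_mult)
    then show ?case by (simp add: surface_graph_def)
  qed
  from Lim_transform_eventually[OF lim this] show ?thesis by (simp add: s_def)
qed

section \<open>Holomorphic maps in two variables\<close>

lemma holomorphic2_on_continuous_on:
  assumes "holomorphic2_on F U"
  shows "continuous_on U F"
proof (rule continuous_at_imp_continuous_on, rule ballI)
  fix x assume "x \<in> U"
  then obtain D where "(F has_derivative D) (at x)"
    using assms unfolding holomorphic2_on_def by blast
  then show "isCont F x" by (rule has_derivative_continuous)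
qed

lemma holomorphic2_on_slices:
  assumes hol: "holomorphic2_on F U" and U: "(z, p) \<in> U"
  shows "(\<lambda>z. fst (F (z, p))) field_differentiable at z" "(\<lambda>z. snd (F (z, p))) field_differentiable at z"
    "(\<lambda>p. fst (F (z, p))) field_differentiable at p" "(\<lambda>p. snd (F (z, p))) field_differentiable at p"
proof -
  obtain D where D: "(F has_derivative D) (at (z, p))" and lin: "\<And>c v. D (scaleC2 c v) = scaleC2 c (D v)"
    using hol U unfolding holomorphic2_on_def by blast
  have s: "(\<lambda>h. D (h, 0)) = (\<lambda>h. scaleC2 h (D (1, 0)))" "(\<lambda>h. D (0, h)) = (\<lambda>h. scaleC2 h (D (0, 1)))"
    unfolding lin[symmetric] by (simp_all add: scaleC2_def)
  have "((\<lambda>z. (z, p)) has_derivative (\<lambda>h. (h, 0))) (at z)"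
    by (auto intro!: derivative_eq_intros)
  from has_derivative_compose[OF this D]
  have d1: "((\<lambda>z. F (z, p)) has_derivative (\<lambda>h. scaleC2 h (D (1, 0)))) (at z)"
    unfolding s(1) .
  have "((\<lambda>p. (z, p)) has_derivative (\<lambda>h. (0, h))) (at p)"
    by (auto intro!: derivative_eq_intros)
  from has_derivative_compose[OF this D]
  have d2: "((\<lambda>p. F (z, p)) has_derivative (\<lambda>h. scaleC2 h (D (0, 1)))) (at p)"
    unfolding s(2) .
  have fd: "f field_differentiable at x" if "(f has_derivative (\<lambda>h. h * c)) (at x)"
    for f :: "complex \<Rightarrow> complex" and c x
  proof -
    have "(*) c = (\<lambda>h. h * c)" by (auto simp: mult.commute)
    then show ?thesis using that unfolding field_differentiable_def has_field_derivative_def by metis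
  qed
  show "(\<lambda>z. fst (F (z, p))) field_differentiable at z"
    by (rule fd[OF has_derivative_fst[OF d1, unfolded scaleC2_def fst_conv]])
  show "(\<lambda>z. snd (F (z, p))) field_differentiable at z"
    by (rule fd[OF has_derivative_snd[OF d1, unfolded scaleC2_def snd_conv]])
  show "(\<lambda>p. fst (F (z, p))) field_differentiable at p"
    by (rule fd[OF has_derivative_fst[OF d2, unfolded scaleC2_def fst_conv]])
  show "(\<lambda>p. snd (F (z, p))) field_differentiable at p"
    by (rule fd[OF has_derivative_snd[OF d2, unfolded scaleC2_def snd_conv]])
qed

lemma has_derivative_direction_limit:
  assumes "(f has_derivative D) (at x)"
  shows "((\<lambda>t. (f (x + t *\<^sub>R v) - f x) /\<^sub>R t) \<longlongrightarrow> D v) (at_right (0::real))"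
proof -
  have "((\<lambda>t. x + t *\<^sub>R v) has_derivative (\<lambda>t. t *\<^sub>R v)) (at (0::real))"
    by (auto intro!: derivative_eq_intros)
  moreover have "(f has_derivative D) (at (x + 0 *\<^sub>R v))" using assms by simp
  ultimately have "((\<lambda>t. f (x + t *\<^sub>R v)) has_derivative (\<lambda>t. D (t *\<^sub>R v))) (at (0::real))"
    by (rule has_derivative_compose)
  then have lim: "((\<lambda>t. norm (f (x + (0 + t) *\<^sub>R v) - f (x + 0 *\<^sub>R v) - D (t *\<^sub>R v)) / norm t) \<longlongrightarrow> 0) (at (0::real))"
    unfolding has_derivative_at by blast
  have "((\<lambda>t. (f (x + t *\<^sub>R v) - f x) /\<^sub>R t - D v) \<longlongrightarrow> 0) (at (0::real))"
  proof (rule Lim_transform_eventually[THEN tendsto_norm_zero_cancel, OF lim])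
    have "norm (f (x + t *\<^sub>R v) - f x - D (t *\<^sub>R v)) / norm t = norm ((f (x + t *\<^sub>R v) - f x) /\<^sub>R t - D v)"
      if "t \<noteq> 0" for t
    proof -
      have "(f (x + t *\<^sub>R v) - f x) /\<^sub>R t - D v = (f (x + t *\<^sub>R v) - f x - D (t *\<^sub>R v)) /\<^sub>R t"
        using linear_scale[OF has_derivative_linear[OF assms], of t v] that
        by (simp add: scaleR_diff_right)
      then show ?thesis by (simp add: divide_inverse mult.commute)
    qed
    then show "\<forall>\<^sub>F t in at 0. norm (f (x + (0 + t) *\<^sub>R v) - f (x + 0 *\<^sub>R v) - D (t *\<^sub>R v)) / norm t
        = norm ((f (x + t *\<^sub>R v) - f x) /\<^sub>R t - D v)"
      by (simp add: eventually_at_filter)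
  qed
  then have "((\<lambda>t. (f (x + t *\<^sub>R v) - f x) /\<^sub>R t) \<longlongrightarrow> D v) (at (0::real))"
    by (simp only: Lim_null[symmetric])
  then show ?thesis by (rule tendsto_within_subset[of _ _ _ UNIV]) simp
qed

text \<open>The function \<open>p + z\<^sup>2\<close> is real on \<open>Q\<close>, hence its composition with the map is real on the surface.\<close>
lemma transformable_imp_real_germ:
  assumes r: "r \<in> X" and tr: "transformable_into (surface r) Q"
  obtains A where "normalized_germ A" "real_on_graph A (surface_graph r)"
proof -
  obtain F G U V where U: "open U" "(0, 0) \<in> U" and V: "open V" and F0: "F (0, 0) = (0, 0)"
    and hom: "homeomorphism U V F G" and holF: "holomorphic2_on F U" and holG: "holomorphic2_on G V"
    and img: "F ` (surface r \<inter> U) = Q \<inter> V"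
    using tr unfolding transformable_into_def by blast
  define A where "A = (\<lambda>z p. snd (F (z, p)) + (fst (F (z, p)))\<^sup>2)"
  obtain U1 U2 where U12: "open U1" "open U2" "(0, 0) \<in> U1 \<times> U2" "U1 \<times> U2 \<subseteq> U"
    using open_prod_elim[OF U] by blast
  obtain \<rho>1 where \<rho>1: "\<rho>1 > 0" "ball 0 \<rho>1 \<subseteq> U1" using U12 open_contains_ball by blast
  obtain \<rho>2 where \<rho>2: "\<rho>2 > 0" "ball 0 \<rho>2 \<subseteq> U2" using U12 open_contains_ball by blast
  define \<rho> where "\<rho> = min \<rho>1 \<rho>2"
  have \<rho>: "\<rho> > 0" "ball 0 \<rho> \<times> ball 0 \<rho> \<subseteq> U"
  proof -
    show "\<rho> > 0" using \<rho>1 \<rho>2 by (simp add: \<rho>_def)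
    have "ball 0 \<rho> \<subseteq> U1" "ball 0 \<rho> \<subseteq> U2"
      using \<rho>1(2) \<rho>2(2) by (auto simp: \<rho>_def subset_iff)
    then show "ball 0 \<rho> \<times> ball 0 \<rho> \<subseteq> U" using U12(4) by blast
  qed
  have contF: "continuous_on U F" by (rule holomorphic2_on_continuous_on[OF holF])
  have contA: "continuous_on U (\<lambda>(z, p). A z p)"
    unfolding A_def case_prod_unfold by (simp add: continuous_intros contF)
  have "holomorphic_bidisc A \<rho>"
    unfolding holomorphic_bidisc_def
  proof (intro conjI ballI)
    show "\<rho> > 0" by fact
    show "continuous_on (ball 0 \<rho> \<times> ball 0 \<rho>) (\<lambda>(z, p). A z p)"
      using contA \<rho>(2) by (rule continuous_on_subset)
    fix p :: complex assume p: "p \<in> ball 0 \<rho>"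
    show "(\<lambda>z. A z p) holomorphic_on ball 0 \<rho>"
      unfolding holomorphic_on_def
    proof
      fix z :: complex assume "z \<in> ball 0 \<rho>"
      then have "(z, p) \<in> U" using p \<rho>(2) by blast
      note sl = holomorphic2_on_slices[OF holF this]
      show "(\<lambda>z. A z p) field_differentiable at z within ball 0 \<rho>"
        unfolding A_def
        by (rule field_differentiable_at_within[OF field_differentiable_add[OF sl(2) field_differentiable_power[OF sl(1)]]])
    qed
  next
    fix z :: complex assume z: "z \<in> ball 0 \<rho>"
    show "A z holomorphic_on ball 0 \<rho>"
      unfolding holomorphic_on_def
    proof
      fix p :: complex assume "p \<in> ball 0 \<rho>"
      then have "(z, p) \<in> U" using z \<rho>(2) by blast
      note sl = holomorphic2_on_slices[OF holF this]
      show "A z field_differentiable at p within ball 0 \<rho>"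
        unfolding A_def
        by (rule field_differentiable_at_within[OF field_differentiable_add[OF sl(4) field_differentiable_power[OF sl(3)]]])
    qed
  qed
  then have germ: "holomorphic_germ A" by (auto simp: holomorphic_germ_def)
  have isCont: "isCont (\<lambda>(z, p). A z p) (0, 0)"
    using contA U by (simp add: continuous_on_eq_continuous_at)
  have A0: "A 0 0 = 0" by (simp add: A_def F0)
  have real: "real_on_graph A (surface_graph r)"
    unfolding real_on_graph_def
  proof (intro allI impI)
    fix z :: complex assume z: "Re z = 1/2"
    have "((\<lambda>t. (of_real t * z, surface_graph r (of_real t * z))) \<longlongrightarrow> (0, 0)) (at_right (0::real))"
      using tendsto_Pair[OF tendsto_mult_left_zero[OF tendsto_of_real_at_right_0, of z]
          tangent_to_Q_tendsto_0[OF surface_graph_tangent[OF r] z]] .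
    then have "\<forall>\<^sub>F t in at_right (0::real). (of_real t * z, surface_graph r (of_real t * z)) \<in> U"
      using U by (rule topological_tendstoD)
    then show "\<forall>\<^sub>F t in at_right (0::real). Im (A (of_real t * z) (surface_graph r (of_real t * z))) = 0"
    proof eventually_elim
      case (elim t)
      let ?x = "(of_real t * z, surface_graph r (of_real t * z))"
      have "?x \<in> surface r" by (simp add: surface_def surface_graph_def)
      then have "F ?x \<in> Q" using elim img by blast
      \<comment> \<open>On \<open>Q\<close> the function p + z^2 equals (z + cnj z)^2.\<close>
      then have "A (fst ?x) (snd ?x) = (fst (F ?x) + cnj (fst (F ?x)))\<^sup>2"
        by (auto simp: A_def Q_def power2_eq_square algebra_simps)
      also have "\<dots> = of_real ((2 * Re (fst (F ?x)))\<^sup>2)"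
        unfolding complex_add_cnj by simp
      finally show ?case by (metis Im_complex_of_real fst_conv snd_conv)
    qed
  qed
  \<comment> \<open>The first weight that can occur carries a polynomial that is real on the line,
    hence a real constant, and 0 in odd weight. This excludes weight 1 and makes the part of weight
    2 a real multiple of p + z^2.\<close>
  have step: "\<exists>s::real. leading A n (\<lambda>_. of_real s) \<and> (odd n \<longrightarrow> s = 0)"
    if n: "n = 0 \<or> leading A (n - 1) (\<lambda>_. 0)" for n
  proof -
    obtain \<beta> :: "complex poly" where \<beta>: "\<And>z. poly \<beta> (- z) = (- 1) ^ n * poly \<beta> z" "leading A n (poly \<beta>)"
      using leading_exists[OF germ n] by blast
    have "Im (poly \<beta> z) = 0" if z: "Re z = 1/2" for z
    proof -
      have "\<forall>\<^sub>F t in at_right (0::real). 0 = Im (A (of_real t * z) (surface_graph r (of_real t * z)) / of_real t ^ n)"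
        using real z unfolding real_on_graph_def by (auto elim!: eventually_mono simp flip: of_real_power)
      then have "((\<lambda>t. Im (A (of_real t * z) (surface_graph r (of_real t * z)) / of_real t ^ n)) \<longlongrightarrow> 0) (at_right (0::real))"
        by (rule Lim_transform_eventually[OF tendsto_const])
      with tendsto_Im[OF leading_on_graph[OF \<beta>(2) surface_graph_tangent[OF r] z]] show ?thesis
        using tendsto_unique[OF trivial_limit_at_right_real] by blast
    qed
    from poly_real_on_line[OF \<beta>(1) this]
    obtain s :: real where s: "\<And>z. poly \<beta> z = of_real s" "odd n \<Longrightarrow> s = 0" by blast
    have "poly \<beta> = (\<lambda>_. of_real s)" by (rule ext) (rule s(1))
    then show ?thesis using \<beta>(2) s(2) by auto
  qed
  have lead0: "leading A 0 (\<lambda>_. 0)"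
    unfolding leading_def
  proof (intro allI impI)
    fix z :: complex and y assume y: "(y \<longlongrightarrow> 1 - z\<^sup>2) (at_right (0::real))"
    have "((\<lambda>t. of_real t ^ 2 * y t) \<longlongrightarrow> 0 ^ 2 * (1 - z\<^sup>2)) (at_right (0::real))"
      by (intro tendsto_mult tendsto_power tendsto_of_real_at_right_0 y)
    then have "((\<lambda>t. (of_real t * z, of_real t ^ 2 * y t)) \<longlongrightarrow> (0, 0)) (at_right (0::real))"
      using tendsto_Pair[OF tendsto_mult_left_zero[OF tendsto_of_real_at_right_0, of z]] by simp
    from isCont_tendsto_compose[OF isCont this]
    show "((\<lambda>t. A (of_real t * z) (of_real t ^ 2 * y t) / of_real t ^ 0) \<longlongrightarrow> 0) (at_right (0::real))"
      by (simp add: A0)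
  qed
  have lead1: "leading A 1 (\<lambda>_. 0)" using step[of 1] lead0 by auto
  obtain s :: real where s: "leading A 2 (\<lambda>_. of_real s)" using step[of 2] lead1 by auto
  \<comment> \<open>Otherwise \<open>A\<close> has no linear terms. Its derivative at the origin is
    the second component of that of \<open>F\<close>, because the square contributes nothing there.
    So \<open>D\<close> would map into a line, although \<open>E\<close> inverts it.\<close>
  have "s \<noteq> 0"
  proof
    assume s0: "s = 0"
    obtain D where D: "(F has_derivative D) (at (0, 0))" and lin: "\<And>c v. D (scaleC2 c v) = scaleC2 c (D v)"
      using holF U unfolding holomorphic2_on_def by blast
    have "(0, 0) \<in> V" using hom U F0 unfolding homeomorphism_def by (metis imageI)
    then obtain E where E: "(G has_derivative E) (at (0, 0))" and linE: "\<And>c v. E (scaleC2 c v) = scaleC2 c (E v)"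
      using holG unfolding holomorphic2_on_def by blast
    have "((\<lambda>x. G (F x)) has_derivative (\<lambda>v. E (D v))) (at (0, 0))"
      using has_derivative_compose[OF D, of G E] E F0 by simp
    moreover have "((\<lambda>x. G (F x)) has_derivative (\<lambda>v. v)) (at (0, 0))"
    proof (rule has_derivative_transform_within_open[OF has_derivative_ident U])
      show "x = G (F x)" if "x \<in> U" for x using hom that by (simp add: homeomorphism_def)
    qed
    ultimately have ED: "E (D v) = v" for v
      using has_derivative_unique by metis
    have dA: "((\<lambda>x. A (fst x) (snd x)) has_derivative (\<lambda>v. snd (D v))) (at (0, 0))"
      unfolding A_def prod.collapse
      by (rule has_derivative_eq_rhs, (rule derivative_intros D)+) (simp add: F0)
    note dir = has_derivative_direction_limit[OF dA]
    have "((\<lambda>t. A (of_real t * 0) (of_real t ^ 2 * 1) / of_real t ^ 2) \<longlongrightarrow> of_real s) (at_right (0::real))"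
      by (rule leadingD[OF s]) simp
    then have l1: "((\<lambda>t. A 0 (of_real (t\<^sup>2)) / of_real (t\<^sup>2)) \<longlongrightarrow> 0) (at_right (0::real))"
      by (simp add: s0)
    have "filterlim (\<lambda>t. t\<^sup>2) (at_right 0) (at_right (0::real))"
      unfolding filterlim_at
      by (auto simp: eventually_at_filter intro!: tendsto_eq_intros)
    from filterlim_compose[OF dir[of "(0, 1)"] this]
    have "((\<lambda>t. A 0 (of_real (t\<^sup>2)) / of_real (t\<^sup>2)) \<longlongrightarrow> snd (D (0, 1))) (at_right (0::real))"
      by (simp add: A0 scaleR_conv_of_real divide_inverse mult.commute)
    from tendsto_unique[OF trivial_limit_at_right_real this l1] have D01: "snd (D (0, 1)) = 0" .
    have "((\<lambda>t. A (of_real t * 1) (of_real t ^ 2 * 0) / of_real t ^ 2) \<longlongrightarrow> of_real s) (at_right (0::real))"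
      by (rule leadingD[OF s]) simp
    from tendsto_zero_lower_power[OF this, of 1]
    have l2: "((\<lambda>t. A (of_real t) 0 / of_real t) \<longlongrightarrow> 0) (at_right (0::real))" by simp
    from dir[of "(1, 0)"]
    have "((\<lambda>t. A (of_real t) 0 / of_real t) \<longlongrightarrow> snd (D (1, 0))) (at_right (0::real))"
      by (simp add: A0 scaleR_conv_of_real divide_inverse mult.commute)
    from tendsto_unique[OF trivial_limit_at_right_real this l2] have D10: "snd (D (1, 0)) = 0" .
    define a where "a = fst (D (1, 0))"
    define b where "b = fst (D (0, 1))"
    have Da: "D (1, 0) = (a, 0)" and Db: "D (0, 1) = (b, 0)"
      using D01 D10 by (auto simp: a_def b_def prod_eq_iff)
    \<comment> \<open>The images of the two basis vectors lie on one line, so suitable multiples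
      coincide; injectivity of \<open>D\<close> then forces a = 0 and D (1, 0) = 0.\<close>
    have "D (scaleC2 b (1, 0)) = D (scaleC2 a (0, 1))"
      unfolding lin Da Db by (simp add: scaleC2_def)
    then have "scaleC2 b (1, 0) = scaleC2 a (0, 1)" using ED by metis
    then have "a = 0" by (simp add: scaleC2_def)
    then have "D (1, 0) = D (scaleC2 0 (1, 0))" unfolding lin Da by (simp add: scaleC2_def)
    then have "(1, 0) = scaleC2 0 (1, 0)" using ED by metis
    then show False by (simp add: scaleC2_def)
  qed
  define A' where "A' = (\<lambda>z p. A z p / of_real s)"
  have "holomorphic_germ A'"
    unfolding A'_def by (rule holomorphic_germ_compose[OF germ]) (auto intro!: holomorphic_intros simp: \<open>s \<noteq> 0\<close>)
  moreover have "leading A' 2 (\<lambda>_. 1)"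
    unfolding leading_def A'_def
  proof (intro allI impI)
    fix z :: complex and y assume "(y \<longlongrightarrow> 1 - z\<^sup>2) (at_right (0::real))"
    from tendsto_divide[OF leadingD[OF s this] tendsto_const[of "of_real s"]]
    show "((\<lambda>t. A (of_real t * z) (of_real t ^ 2 * y t) / of_real s / of_real t ^ 2) \<longlongrightarrow> 1) (at_right (0::real))"
      using \<open>s \<noteq> 0\<close> by (simp add: mult.commute)
  qed
  ultimately have "normalized_germ A'" by (simp add: normalized_germ_def)
  moreover have "real_on_graph A' (surface_graph r)"
    using real unfolding real_on_graph_def A'_def by simp
  ultimately show ?thesis by (rule that)
qed

section \<open>Perturbations\<close>

definition pert_poly :: "nat \<Rightarrow> real poly" where
  "pert_poly N = [:1, 1:] ^ 4 * [:- 1, 1:] ^ (N - 4)"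

text \<open>
  In degree \<open>N = 2 * m + 1\<close>, with \<open>m \<ge> 2\<close>, the perturbation is \<open>\<i> * \<sigma> m * \<epsilon> ^ N\<close> times
  \<open>(z + w) ^ 4 * (z - w) ^ (N - 4)\<close>; \<open>pert_poly\<close> is its dehomogenization at \<open>w = 1\<close>.
\<close>
definition pert :: "real \<Rightarrow> (nat \<Rightarrow> real) \<Rightarrow> pseries2" where
  "pert \<epsilon> \<sigma> i j = (if odd (i + j) \<and> 5 \<le> i + j
     then \<i> * of_real (\<sigma> ((i + j) div 2) * \<epsilon> ^ (i + j) * coeff (pert_poly (i + j)) i) else 0)"

text \<open>Each multiplication by a factor x + c with |c| = 1 at most doubles the largest
  coefficient.\<close>

lemma coeff_linear_power_mult_bound:
  fixes p :: "real poly"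
  assumes "\<bar>c\<bar> = 1" "\<And>i. \<bar>coeff p i\<bar> \<le> M"
  shows "\<bar>coeff ([:c, 1:] ^ k * p) i\<bar> \<le> 2 ^ k * M"
proof (induction k arbitrary: i)
  case 0
  show ?case using assms by simp
next
  case (Suc k)
  have M: "M \<ge> 0" using assms(2)[of 0] by linarith
  let ?q = "[:c, 1:] ^ k * p"
  have "[:c, 1:] ^ Suc k * p = [:c, 1:] * ?q" by (simp only: power_Suc mult.assoc)
  also have "\<dots> = smult c ?q + pCons 0 ?q" by simp
  finally have "[:c, 1:] ^ Suc k * p = smult c ?q + pCons 0 ?q" .
  then have "\<bar>coeff ([:c, 1:] ^ Suc k * p) i\<bar> \<le> \<bar>c * coeff ?q i\<bar> + \<bar>coeff (pCons 0 ?q) i\<bar>"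
    by (simp only: coeff_add coeff_smult abs_triangle_ineq)
  also have "\<dots> \<le> 2 ^ k * M + 2 ^ k * M"
  proof (rule add_mono)
    show "\<bar>c * coeff ?q i\<bar> \<le> 2 ^ k * M" using Suc assms(1) by (simp add: abs_mult)
    show "\<bar>coeff (pCons 0 ?q) i\<bar> \<le> 2 ^ k * M"
      using Suc M by (auto simp: coeff_pCons split: nat.split)
  qed
  also have "\<dots> = 2 ^ Suc k * M" by simp
  finally show ?case .
qed

lemma coeff_pert_poly_bound:
  assumes "4 \<le> N"
  shows "\<bar>coeff (pert_poly N) i\<bar> \<le> 2 ^ N"
proof -
  have "\<bar>coeff ([:- 1, 1 :: real:] ^ (N - 4) * 1) i\<bar> \<le> 2 ^ (N - 4) * 1" for i
    by (rule coeff_linear_power_mult_bound) auto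
  then have "\<bar>coeff ([:1, 1 :: real:] ^ 4 * [:- 1, 1:] ^ (N - 4)) i\<bar> \<le> 2 ^ 4 * 2 ^ (N - 4)"
    by (intro coeff_linear_power_mult_bound) auto
  also have "(2::real) ^ 4 * 2 ^ (N - 4) = 2 ^ N"
    by (metis assms le_add_diff_inverse power_add)
  finally show ?thesis by (simp add: pert_poly_def)
qed

lemma degree_pert_poly:
  assumes "4 \<le> N"
  shows "degree (pert_poly N) = N"
  using assms unfolding pert_poly_def by (subst degree_mult_eq) (auto simp: degree_power_eq)

text \<open>Reversing the coefficients exchanges z and w. It fixes x + 1 and negates x - 1, which
  occurs to the odd power N - 4. Conjugation of the factor \<i> in \<open>pert\<close> compensates
  the sign.\<close>

lemma coeff_pert_poly_reflect:
  assumes "4 \<le> N" "odd N" "i \<le> N"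
  shows "coeff (pert_poly N) (N - i) = - coeff (pert_poly N) i"
proof -
  have "reflect_poly [:1, 1 :: real:] = [:1, 1:]" "reflect_poly [:- 1, 1 :: real:] = - [:- 1, 1:]"
    by (simp_all add: reflect_poly_pCons)
  then have "reflect_poly (pert_poly N) = [:1, 1:] ^ 4 * (- [:- 1, 1:]) ^ (N - 4)"
    unfolding pert_poly_def reflect_poly_mult reflect_poly_power by (simp only:)
  also have "\<dots> = - pert_poly N"
    using assms(1,2) power_minus_odd[of "N - 4" "[:- 1, 1 :: real:]"] unfolding pert_poly_def by simp
  finally have "coeff (reflect_poly (pert_poly N)) i = - coeff (pert_poly N) i" by simp
  then show ?thesis using assms by (simp add: coeff_reflect_poly degree_pert_poly)
qed

lemma pert_norm:
  assumes "\<epsilon> \<ge> 0" "\<And>n. \<bar>\<sigma> n\<bar> \<le> 1"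
  shows "norm (pert \<epsilon> \<sigma> i j) \<le> (2 * \<epsilon>) ^ (i + j)"
proof (cases "odd (i + j) \<and> 5 \<le> i + j")
  case True
  have "norm (pert \<epsilon> \<sigma> i j) = \<bar>\<sigma> ((i + j) div 2)\<bar> * \<epsilon> ^ (i + j) * \<bar>coeff (pert_poly (i + j)) i\<bar>"
    using True assms(1) by (simp add: pert_def norm_mult abs_mult del: of_real_mult of_real_power)
  also have "\<dots> \<le> 1 * \<epsilon> ^ (i + j) * 2 ^ (i + j)"
    using True assms by (intro mult_mono coeff_pert_poly_bound) auto
  finally show ?thesis by (simp add: power_mult_distrib mult.commute)
next
  case False
  then have "pert \<epsilon> \<sigma> i j = 0" by (simp only: pert_def if_False)
  then show ?thesis using assms(1) by simp
qed

lemma pert_hermitian: "pert \<epsilon> \<sigma> j i = cnj (pert \<epsilon> \<sigma> i j)"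
proof (cases "odd (i + j) \<and> 5 \<le> i + j")
  case True
  then show ?thesis
    using coeff_pert_poly_reflect[of "i + j" i] by (simp add: pert_def add.commute)
next
  case False
  then have "pert \<epsilon> \<sigma> j i = 0" "pert \<epsilon> \<sigma> i j = 0"
    by (simp_all only: pert_def add.commute[of j i] if_False)
  then show ?thesis by simp
qed

lemma poly_eq_sum_le:
  fixes p :: "'a::comm_semiring_1 poly"
  assumes "degree p \<le> n"
  shows "poly p x = (\<Sum>i\<le>n. coeff p i * x ^ i)"
  unfolding poly_altdef
  by (rule sum.mono_neutral_left) (use assms in \<open>auto simp: coeff_eq_0 not_le\<close>)

text \<open>Up to a factor, this is the coefficient of degree n in the mixed derivative on w = - z.
  It is a combination of the first two derivatives of \<open>pert_poly\<close> at - 1, where the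
  fourth power of x + 1 makes both vanish.\<close>

lemma pert_poly_sum_neg:
  assumes "4 \<le> n + 2"
  shows "(\<Sum>i\<le>n. real (Suc i) * real (Suc (n - i)) * coeff (pert_poly (n + 2)) (Suc i) * (- 1) ^ (n - i)) = 0"
proof -
  define q where "q = pderiv (pert_poly (n + 2))"
  have dq: "degree q = n + 1"
    unfolding q_def degree_pderiv using degree_pert_poly[OF assms] by simp
  define v where "v = [:1, 1 :: real:] * [:- 1, 1:] ^ (n + 2 - 4)"
  have "pert_poly (n + 2) = [:1, 1:] * ([:1, 1:] * ([:1, 1:] * v))"
    unfolding pert_poly_def v_def by (simp add: eval_nat_numeral mult.assoc del: mult_pCons_left)
  then have q0: "poly q (- 1) = 0" and q1: "poly (pderiv q) (- 1) = 0"
    unfolding q_def by (simp_all add: pderiv_mult pderiv_add pderiv_pCons del: mult_pCons_left)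
  have "poly (pCons 0 (pderiv q)) (- 1) = (\<Sum>i\<le>n + 1. real i * coeff q i * (- 1) ^ i)"
    by (subst poly_eq_sum_le[where n = "n + 1"])
      (use dq in \<open>auto simp: degree_pCons_eq_if degree_pderiv coeff_pCons coeff_pderiv split: nat.split intro!: sum.cong\<close>)
  then have s1: "(\<Sum>i\<le>n + 1. real i * coeff q i * (- 1) ^ i) = 0" using q1 by simp
  have s0: "(\<Sum>i\<le>n + 1. coeff q i * (- 1) ^ i) = 0"
    using q0 poly_eq_sum_le[of q "n + 1" "- 1"] dq by simp
  have "(\<Sum>i\<le>n. real (Suc i) * real (Suc (n - i)) * coeff (pert_poly (n + 2)) (Suc i) * (- 1) ^ (n - i))
      = (\<Sum>i\<le>n. (- 1) ^ n * ((real (n + 1) - real i) * coeff q i * (- 1) ^ i))"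
  proof (rule sum.cong[OF refl])
    fix i assume "i \<in> {..n}"
    then have i: "i \<le> n" by simp
    have "(- 1 :: real) ^ (n - i) = (- 1) ^ n * (- 1) ^ i"
      using i by (auto simp: minus_one_power_iff)
    moreover have "real (Suc (n - i)) = real (n + 1) - real i" using i by (simp add: of_nat_diff)
    ultimately show "real (Suc i) * real (Suc (n - i)) * coeff (pert_poly (n + 2)) (Suc i) * (- 1) ^ (n - i)
        = (- 1) ^ n * ((real (n + 1) - real i) * coeff q i * (- 1) ^ i)"
      by (simp add: q_def coeff_pderiv mult_ac)
  qed
  \<comment> \<open>The added term i = n + 1 has the factor (n + 1) - i = 0.\<close>
  also have "\<dots> = (- 1) ^ n * (\<Sum>i\<le>n + 1. (real (n + 1) - real i) * coeff q i * (- 1) ^ i)"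
    by (simp add: sum_distrib_left)
  also have "(\<Sum>i\<le>n + 1. (real (n + 1) - real i) * coeff q i * (- 1) ^ i)
      = real (n + 1) * (\<Sum>i\<le>n + 1. coeff q i * (- 1) ^ i) - (\<Sum>i\<le>n + 1. real i * coeff q i * (- 1) ^ i)"
    by (simp only: sum_distrib_left sum_subtractf[symmetric] left_diff_distrib mult.assoc)
  finally show ?thesis unfolding s0 s1 by simp
qed

lemma subst_neg_pert: "subst_neg (deriv_fst (deriv_snd (pert \<epsilon> \<sigma>))) = 0"
proof (rule fps_ext)
  fix n
  show "subst_neg (deriv_fst (deriv_snd (pert \<epsilon> \<sigma>))) $ n = 0 $ n"
  proof (cases "odd (n + 2) \<and> 5 \<le> n + 2")
    case True
    have N: "Suc i + Suc (n - i) = n + 2" if "i \<le> n" for i using that by simp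
    have "subst_neg (deriv_fst (deriv_snd (pert \<epsilon> \<sigma>))) $ n
        = (\<Sum>i\<le>n. of_nat (Suc i) * (of_nat (Suc (n - i)) * pert \<epsilon> \<sigma> (Suc i) (Suc (n - i))) * (- 1) ^ (n - i))"
      by (simp add: subst_neg_def deriv_fst_def deriv_snd_def)
    also have "\<dots> = (\<Sum>i\<le>n. \<i> * of_real (\<sigma> ((n + 2) div 2) * \<epsilon> ^ (n + 2)) * of_real
          (real (Suc i) * real (Suc (n - i)) * coeff (pert_poly (n + 2)) (Suc i) * (- 1) ^ (n - i)))"
      using True N unfolding pert_def by (intro sum.cong) (auto simp: mult_ac)
    also have "\<dots> = \<i> * of_real (\<sigma> ((n + 2) div 2) * \<epsilon> ^ (n + 2)) * of_real
          (\<Sum>i\<le>n. real (Suc i) * real (Suc (n - i)) * coeff (pert_poly (n + 2)) (Suc i) * (- 1) ^ (n - i))"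
      by (simp only: sum_distrib_left of_real_sum)
    also have "\<dots> = 0" using pert_poly_sum_neg[of n] True by simp
    finally show ?thesis by simp
  next
    case False
    have "pert \<epsilon> \<sigma> (Suc i) (Suc (n - i)) = 0" if "i \<le> n" for i
    proof -
      have "Suc i + Suc (n - i) = n + 2" using that by simp
      then show ?thesis using False by (simp only: pert_def if_False)
    qed
    then show ?thesis by (simp add: subst_neg_def deriv_fst_def deriv_snd_def)
  qed
qed

text \<open>The root in \<open>d\<close> turns the coefficient bound (2 * \<epsilon>) ^ (i + j) into
  2 * \<epsilon>, uniformly in the digits \<open>\<sigma>\<close>.\<close>

lemma add_pert_in_X:
  assumes r: "r \<in> X" and \<epsilon>: "\<epsilon> > 0" and \<sigma>: "\<And>n. \<bar>\<sigma> n\<bar> \<le> 1"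
  shows "(\<lambda>i j. r i j + pert \<epsilon> \<sigma> i j) \<in> X" "d r (\<lambda>i j. r i j + pert \<epsilon> \<sigma> i j) \<le> 2 * \<epsilon>"
proof -
  let ?r = "\<lambda>i j. r i j + pert \<epsilon> \<sigma> i j"
  have pn: "norm (pert \<epsilon> \<sigma> i j) \<le> (2 * \<epsilon>) ^ (i + j)" for i j
    using \<epsilon> \<sigma> by (intro pert_norm) auto
  have "geometric2 (\<lambda>i j. - pert \<epsilon> \<sigma> i j)"
    unfolding geometric2_def using \<epsilon> pn by (intro exI[of _ 1] exI[of _ "2 * \<epsilon>"]) auto
  from geometric2_diff[OF X_geometric2[OF r] this] have conv: "convergent2 ?r"
    by (intro geometric2_imp_convergent2) simp
  have low: "?r i j = 0" if "i + j \<le> 3" for i j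
    using X_low[OF r that] that by (simp add: pert_def)
  have herm: "?r j i = cnj (?r i j)" for i j
  proof -
    have "r j i = cnj (r i j)" using r unfolding X_def by blast
    then show ?thesis using pert_hermitian[of \<epsilon> \<sigma> j i] by simp
  qed
  have "subst_neg (deriv_fst (deriv_snd ?r)) = subst_neg (deriv_fst (deriv_snd r)) + subst_neg (deriv_fst (deriv_snd (pert \<epsilon> \<sigma>)))"
    by (rule fps_ext) (simp add: subst_neg_def deriv_fst_def deriv_snd_def distrib_left distrib_right sum.distrib
        del: of_nat_Suc)
  moreover have "subst_neg (deriv_fst (deriv_snd r)) = 0" using r unfolding X_def by blast
  ultimately have "subst_neg (deriv_fst (deriv_snd ?r)) = 0" by (simp add: subst_neg_pert)
  then show X: "?r \<in> X" using conv low herm unfolding X_def by blast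
  show "d r ?r \<le> 2 * \<epsilon>"
  proof (rule d_least[OF r X])
    fix i j :: nat assume ij: "i + j > 3"
    have "root (i + j) (cmod (r i j - ?r i j)) \<le> root (i + j) ((2 * \<epsilon>) ^ (i + j))"
      using pn[of i j] ij by (intro real_root_le_mono) auto
    also have "\<dots> = 2 * \<epsilon>" using \<epsilon> ij by (intro real_root_power_cancel) auto
    finally show "root (i + j) (cmod (r i j - ?r i j)) \<le> 2 * \<epsilon>" .
  qed
qed

lemma pderiv_pert_poly:
  assumes "5 \<le> N"
  shows "pderiv (pert_poly N) = smult 4 ([:1, 1:] ^ 3 * [:- 1, 1:] ^ (N - 4))
    + smult (real (N - 4)) ([:1, 1:] ^ 4 * [:- 1, 1:] ^ (N - 5))"
proof -
  have p1: "pderiv ([:1, 1 :: real:] ^ 4) = smult 4 ([:1, 1:] ^ 3)"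
    using pderiv_power_Suc[of "[:1, 1 :: real:]" 3] by (simp add: pderiv_pCons eval_nat_numeral)
  obtain k where k: "N - 4 = Suc k" using assms by (cases "N - 4") auto
  then have k': "N - 5 = k" by simp
  have p2: "pderiv ([:- 1, 1 :: real:] ^ Suc k) = smult (real (Suc k)) ([:- 1, 1:] ^ k)"
    using pderiv_power_Suc[of "[:- 1, 1 :: real:]" k] by (simp add: pderiv_pCons)
  show ?thesis
    unfolding pert_poly_def pderiv_mult k k' p1 p2 by (simp add: algebra_simps del: mult_pCons_left)
qed

lemma sum_antidiagonal:
  fixes f :: "nat \<Rightarrow> nat \<Rightarrow> 'a::comm_monoid_add"
  shows "(\<Sum>(i, j)\<in>{(i, j). i + j = n}. f i j) = (\<Sum>i\<le>n. f i (n - i))"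
  by (rule sum.reindex_bij_witness[of _ "\<lambda>i. (i, n - i)" fst]) auto

text \<open>The homogeneous sum is w ^ (2 * m) times the derivative of the dehomogenized polynomial
  at z / w. The powers of z + w = 1 disappear, which leaves the two terms of the product
  rule.\<close>

lemma pert_leading_value:
  assumes m: "m \<ge> 2" and z: "z + w = 1" "w \<noteq> (0::complex)"
  shows "(\<Sum>(i, j)\<in>{(i, j). i + j = 2 * m}. deriv_fst (pert \<epsilon> \<sigma>) i j * z ^ i * w ^ j)
    = \<i> * of_real (\<sigma> m * \<epsilon> ^ (2 * m + 1)) *
      (4 * (z - w) ^ (2 * m - 3) + of_nat (2 * m - 3) * (z - w) ^ (2 * m - 4))"
proof -
  define c where "c = \<i> * complex_of_real (\<sigma> m * \<epsilon> ^ (2 * m + 1))"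
  define q where "q = map_poly complex_of_real (pderiv (pert_poly (2 * m + 1)))"
  have dq: "degree q \<le> 2 * m"
    using degree_pert_poly[of "2 * m + 1"] m unfolding q_def
    by (simp add: degree_map_poly degree_pderiv)
  have "deriv_fst (pert \<epsilon> \<sigma>) i (2 * m - i) * z ^ i * w ^ (2 * m - i) = c * w ^ (2 * m) * (coeff q i * (z / w) ^ i)"
    if i: "i \<le> 2 * m" for i
  proof -
    have s: "Suc i + (2 * m - i) = 2 * m + 1" using i by simp
    have "pert \<epsilon> \<sigma> (Suc i) (2 * m - i) = c * of_real (coeff (pert_poly (2 * m + 1)) (Suc i))"
      unfolding pert_def s c_def using m by simp
    then have "deriv_fst (pert \<epsilon> \<sigma>) i (2 * m - i) = c * coeff q i"
      by (simp add: deriv_fst_def q_def coeff_map_poly coeff_pderiv)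
    moreover have "w ^ (2 * m) = w ^ (2 * m - i) * w ^ i" using i by (simp flip: power_add)
    ultimately show ?thesis using z(2) by (simp add: power_divide)
  qed
  then have "(\<Sum>(i, j)\<in>{(i, j). i + j = 2 * m}. deriv_fst (pert \<epsilon> \<sigma>) i j * z ^ i * w ^ j)
      = (\<Sum>i\<le>2 * m. c * w ^ (2 * m) * (coeff q i * (z / w) ^ i))"
    unfolding sum_antidiagonal by (intro sum.cong) auto
  also have "\<dots> = c * (w ^ (2 * m) * poly q (z / w))"
    unfolding poly_eq_sum_le[OF dq] by (simp add: sum_distrib_left mult.assoc)
  also have "w ^ (2 * m) * poly q (z / w)
      = 4 * (z - w) ^ (2 * m - 3) + of_nat (2 * m - 3) * (z - w) ^ (2 * m - 4)"
  proof -
    have add: "map_poly complex_of_real (p1 + p2) = map_poly complex_of_real p1 + map_poly complex_of_real p2"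
      and mult: "map_poly complex_of_real (p1 * p2) = map_poly complex_of_real p1 * map_poly complex_of_real p2"
      and smult: "map_poly complex_of_real (smult a p1) = smult (of_real a) (map_poly complex_of_real p1)" for p1 p2 a
      by (auto intro!: poly_eqI simp: coeff_map_poly coeff_mult)
    have power: "map_poly complex_of_real (p1 ^ n) = map_poly complex_of_real p1 ^ n" for p1 n
      by (induction n) (simp_all add: mult)
    have lin: "map_poly complex_of_real [:c, 1:] = [:of_real c, 1:]" for c
      by (simp add: map_poly_pCons)
    have N: "2 * m + 1 - 4 = 2 * m - 3" "2 * m + 1 - 5 = 2 * m - 4" "5 \<le> 2 * m + 1"
      using m by auto
    have q: "q = smult 4 ([:1, 1:] ^ 3 * [:- 1, 1:] ^ (2 * m - 3))
      + smult (of_nat (2 * m - 3)) ([:1, 1:] ^ 4 * [:- 1, 1:] ^ (2 * m - 4))"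
      unfolding q_def pderiv_pert_poly[OF N(3)] N(1,2) add mult smult power lin by simp
    have e1: "w ^ (2 * m) = w ^ 3 * w ^ (2 * m - 3)" and e2: "w ^ (2 * m) = w ^ 4 * w ^ (2 * m - 4)"
      using m by (simp_all flip: power_add)
    have zw: "w * (1 + z / w) = 1" "w * (z / w - 1) = z - w"
      using z by (simp_all add: field_simps)
    have "w ^ (2 * m) * poly q (z / w)
      = 4 * (w ^ (2 * m) * ((1 + z / w) ^ 3 * (z / w - 1) ^ (2 * m - 3)))
        + of_nat (2 * m - 3) * (w ^ (2 * m) * ((1 + z / w) ^ 4 * (z / w - 1) ^ (2 * m - 4)))"
      unfolding q by (simp add: poly_power algebra_simps)
    also have "w ^ (2 * m) * ((1 + z / w) ^ 3 * (z / w - 1) ^ (2 * m - 3))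
        = (w * (1 + z / w)) ^ 3 * (w * (z / w - 1)) ^ (2 * m - 3)"
      unfolding e1 power_mult_distrib by (simp only: mult_ac)
    also have "w ^ (2 * m) * ((1 + z / w) ^ 4 * (z / w - 1) ^ (2 * m - 4))
        = (w * (1 + z / w)) ^ 4 * (w * (z / w - 1)) ^ (2 * m - 4)"
      unfolding e2 power_mult_distrib by (simp only: mult_ac)
    finally show ?thesis unfolding zw by simp
  qed
  finally show ?thesis by (simp add: c_def)
qed

section \<open>Density\<close>

text \<open>A relation and not a function, since \<open>A\<close> is not unique and exists only for
  suitable surfaces.\<close>

definition kappa_jet :: "pseries2 \<Rightarrow> (nat \<Rightarrow> complex) \<Rightarrow> bool" where
  "kappa_jet r K \<longleftrightarrow> (\<exists>A \<kappa> \<rho>. normalized_germ A \<and> real_on_graph A (surface_graph r) \<and>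
     conjugation_germ A \<kappa> \<rho> \<and> K = (\<lambda>n. (deriv ^^ n) \<kappa> 0 / fact n))"

lemma kappa_jet_exists:
  assumes "r \<in> X" "transformable_into (surface r) Q"
  shows "\<exists>K. kappa_jet r K"
  using transformable_imp_real_germ[OF assms] conjugation_germ_exists unfolding kappa_jet_def by metis

lemma kappa_jet_bound:
  assumes "kappa_jet r K"
  shows "\<exists>C R. \<forall>n. norm (K n) \<le> C * R ^ n"
proof -
  obtain A \<kappa> \<rho> where "conjugation_germ A \<kappa> \<rho>" "K = (\<lambda>n. (deriv ^^ n) \<kappa> 0 / fact n)"
    using assms unfolding kappa_jet_def by blast
  then show ?thesis using conjugation_germ_coeff_bound by simp
qed

definition jet_weight :: "real \<Rightarrow> nat \<Rightarrow> complex" where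
  "jet_weight \<epsilon> m = - 2 * \<i> * of_real (\<epsilon> ^ (2 * m + 1) * real (2 * m - 3)) * euler_number (2 * m - 4)"

text \<open>The identity is exact and not merely a linearization. The graphs first differ in degree
  2 * m, and only the leading part of A' - \<phi> \<circ> A in that weight enters the coefficient;
  digits beyond m and the choice of the germs have no influence.\<close>

lemma kappa_jet_pert_diff:
  assumes r: "r \<in> X" and \<epsilon>: "\<epsilon> > 0" and \<sigma>: "\<And>n. \<bar>\<sigma> n\<bar> \<le> 1" and \<sigma>': "\<And>n. \<bar>\<sigma>' n\<bar> \<le> 1"
    and K: "kappa_jet (\<lambda>i j. r i j + pert \<epsilon> \<sigma> i j) K"
    and K': "kappa_jet (\<lambda>i j. r i j + pert \<epsilon> \<sigma>' i j) K'"
    and m: "m \<ge> 2" and eq: "\<And>n. n < m \<Longrightarrow> \<sigma>' n = \<sigma> n"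
  shows "K' m - K m = of_real (\<sigma>' m - \<sigma> m) * jet_weight \<epsilon> m"
proof -
  define s where "s = (\<lambda>i j. r i j + pert \<epsilon> \<sigma> i j)"
  define s' where "s' = (\<lambda>i j. r i j + pert \<epsilon> \<sigma>' i j)"
  have sX: "s \<in> X" "s' \<in> X"
    using add_pert_in_X(1)[where \<sigma> = \<sigma>, OF r \<epsilon> \<sigma>] add_pert_in_X(1)[where \<sigma> = \<sigma>', OF r \<epsilon> \<sigma>'] by (simp_all add: s_def s'_def)
  obtain A \<kappa> \<rho> where A: "normalized_germ A" "real_on_graph A (surface_graph s)"
    "conjugation_germ A \<kappa> \<rho>" "K = (\<lambda>n. (deriv ^^ n) \<kappa> 0 / fact n)"
    using K unfolding kappa_jet_def s_def by blast
  obtain A' \<kappa>' \<rho>' where A': "normalized_germ A'" "real_on_graph A' (surface_graph s')"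
    "conjugation_germ A' \<kappa>' \<rho>'" "K' = (\<lambda>n. (deriv ^^ n) \<kappa>' 0 / fact n)"
    using K' unfolding kappa_jet_def s'_def by blast
  define c where "c = (\<sigma>' m - \<sigma> m) * \<epsilon> ^ (2 * m + 1)"
  define g where "g = (\<lambda>z::complex. \<i> * of_real c *
      (4 * (2 * z - 1) ^ (2 * m - 3) + of_nat (2 * m - 3) * (2 * z - 1) ^ (2 * m - 4)))"
  \<comment> \<open>The digit of index m acts in degree 2 * m + 1, so an odd degree of at most 2 * m
    involves only digits below m.\<close>
  have low: "s' i j = s i j" if "i + j \<le> 2 * m" for i j
  proof (cases "odd (i + j)")
    case True
    then have "(i + j) div 2 < m" using that by presburger
    then show ?thesis using eq[of "(i + j) div 2"] by (simp add: s_def s'_def pert_def)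
  qed (simp add: s_def s'_def pert_def)
  have diff: "((\<lambda>t. (surface_graph s' (of_real t * z) - surface_graph s (of_real t * z)) / of_real t ^ (2 * m))
      \<longlongrightarrow> g z) (at_right (0::real))" if z: "Re z = 1/2" for z
  proof -
    have cz: "cnj z = 1 - z" using z by (auto simp: complex_eq_iff)
    have w: "cnj z \<noteq> 0" "z + cnj z = 1" "z - cnj z = 2 * z - 1"
      using z cz by (auto simp: complex_eq_iff)
    have "(\<Sum>(i, j)\<in>{(i, j). i + j = 2 * m}. (deriv_fst s' i j - deriv_fst s i j) * z ^ i * cnj z ^ j)
        = (\<Sum>(i, j)\<in>{(i, j). i + j = 2 * m}. deriv_fst (pert \<epsilon> \<sigma>') i j * z ^ i * cnj z ^ j)
        - (\<Sum>(i, j)\<in>{(i, j). i + j = 2 * m}. deriv_fst (pert \<epsilon> \<sigma>) i j * z ^ i * cnj z ^ j)"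
      unfolding sum_antidiagonal sum_subtractf[symmetric]
      by (intro sum.cong) (auto simp: s_def s'_def deriv_fst_def ring_distribs)
    also have "\<dots> = g z"
      unfolding pert_leading_value[OF m w(2,1)] w(3) g_def c_def by (simp add: algebra_simps)
    finally have sum: "(\<Sum>(i, j)\<in>{(i, j). i + j = 2 * m}. (deriv_fst s' i j - deriv_fst s i j) * z ^ i * cnj z ^ j) = g z" .
    show ?thesis unfolding sum[symmetric] by (rule surface_graph_diff[OF sX z low])
  qed
  obtain \<phi> and \<beta> :: "complex poly" where \<phi>: "\<And>x. \<phi> (cnj x) = cnj (\<phi> x)"
    and lead: "leading (\<lambda>z p. A' z p - \<phi> (A z p)) (2 * m) (poly \<beta>)"
    and even: "\<And>z. poly \<beta> (- z) = poly \<beta> z" and im: "\<And>z. Re z = 1/2 \<Longrightarrow> Im (poly \<beta> z) = - Im (g z)"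
    using real_germs_compare[OF A(1,2) surface_graph_tangent[OF sX(1)]
        A'(1,2) surface_graph_tangent[OF sX(2)] diff] by blast
  have "K' m - K m = poly \<beta> 0 - cnj (poly \<beta> 0)"
    using conjugation_germ_coeff_diff[OF A(1,3) A'(1,3) \<phi> lead] unfolding A(4) A'(4) .
  also have "\<dots> = - 2 * \<i> * of_real (c * real (2 * m - 3)) * euler_number (2 * m - 4)"
  proof (rule poly_im_power_on_line[OF even])
    show "even (2 * m - 4)" by simp
    fix z :: complex assume z: "Re z = 1/2"
    have y: "2 * z - 1 = \<i> * of_real (2 * Im z)" using z by (auto simp: complex_eq_iff)
    obtain l where l: "2 * m - 4 = 2 * l" using m by (metis dvd_diff_nat dvd_triv_left evenE even_numeral)
    then have l': "2 * m - 3 = Suc (2 * l)" using m by simp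
    have y2: "(2 * z - 1) ^ (2 * l) = of_real ((- (2 * Im z)\<^sup>2) ^ l)"
      unfolding y by (simp add: power_mult power_mult_distrib)
    have y3: "(2 * z - 1) ^ Suc (2 * l) = \<i> * of_real (2 * Im z * (- (2 * Im z)\<^sup>2) ^ l)"
      unfolding power_Suc y2 unfolding y by simp
    have gz: "g z = \<i> * of_real (c * real (2 * m - 3) * (- (2 * Im z)\<^sup>2) ^ l)
        - of_real (4 * c * (2 * Im z * (- (2 * Im z)\<^sup>2) ^ l))"
      unfolding g_def l l' y2 y3 by (simp add: algebra_simps)
    have "Im (\<i> * of_real a - of_real b) = a" for a b :: real by simp
    then have "Im (g z) = c * real (2 * m - 3) * (- (2 * Im z)\<^sup>2) ^ l"
      unfolding gz .
    then show "Im (poly \<beta> z) = - (c * real (2 * m - 3)) * Re ((2 * z - 1) ^ (2 * m - 4))"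
      using im[OF z] unfolding l y2 by simp
  qed
  also have "\<dots> = of_real (\<sigma>' m - \<sigma> m) * jet_weight \<epsilon> m"
    by (simp add: jet_weight_def c_def)
  finally show ?thesis .
qed

text \<open>
  The digits \<open>\<sigma> m\<close> are chosen one after the other. Each one only shifts the coefficients
  \<open>K \<sigma> n\<close> with \<open>n \<ge> m\<close>, and one of its two values makes \<open>K \<sigma> m\<close> large.
\<close>
lemma large_digits_exist:
  fixes K :: "(nat \<Rightarrow> real) \<Rightarrow> nat \<Rightarrow> complex" and W :: "nat \<Rightarrow> complex"
  assumes shift: "\<And>\<sigma> \<sigma>' m. range \<sigma> \<subseteq> {0, 1} \<Longrightarrow> range \<sigma>' \<subseteq> {0, 1} \<Longrightarrow> m \<ge> M \<Longrightarrow>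
      (\<And>n. n < m \<Longrightarrow> \<sigma>' n = \<sigma> n) \<Longrightarrow> K \<sigma>' m - K \<sigma> m = of_real (\<sigma>' m - \<sigma> m) * W m"
  obtains \<sigma> where "range \<sigma> \<subseteq> {0, 1}" "\<And>m. m \<ge> M \<Longrightarrow> norm (W m) \<le> 2 * norm (K \<sigma> m)"
proof -
  \<comment> \<open>The digit stays 0 if the coefficient is already at least half of W m; otherwise
    adding W m makes it so.\<close>
  define digit where "digit = (\<lambda>m \<sigma>. if norm (W m) \<le> 2 * norm (K \<sigma> m) then 0 else 1 :: real)"
  define s where "s = rec_nat (\<lambda>_. 0 :: real) (\<lambda>m \<sigma>. \<sigma>(m := digit m \<sigma>))"
  have s0: "s 0 = (\<lambda>_. 0)" and sS: "s (Suc m) = (s m)(m := digit m (s m))" for m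
    by (simp_all add: s_def)
  have range: "range (s m) \<subseteq> {0, 1}" for m
    by (induction m) (auto simp: s0 sS digit_def)
  have zero: "n \<ge> m \<Longrightarrow> s m n = 0" for m n
    by (induction m arbitrary: n) (auto simp: s0 sS)
  define \<sigma> where "\<sigma> = (\<lambda>m. s (Suc m) m)"
  have agree: "n < m \<Longrightarrow> s m n = \<sigma> n" for m n
    by (induction m) (auto simp: s0 sS \<sigma>_def less_Suc_eq)
  have range\<sigma>: "range \<sigma> \<subseteq> {0, 1}"
    using range unfolding \<sigma>_def by blast
  show ?thesis
  proof (rule that[OF range\<sigma>])
    fix m assume m: "m \<ge> M"
    \<comment> \<open>\<open>s m\<close> has the final digits below m and 0 at m, so this compares
      the chosen digit with the digit 0 on which the choice was based.\<close>
    have "K \<sigma> m - K (s m) m = of_real (\<sigma> m - s m m) * W m"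
      by (rule shift[OF range range\<sigma> m]) (simp add: agree)
    then have d: "K \<sigma> m = K (s m) m + of_real (\<sigma> m) * W m"
      by (simp add: zero algebra_simps)
    show "norm (W m) \<le> 2 * norm (K \<sigma> m)"
    proof (cases "norm (W m) \<le> 2 * norm (K (s m) m)")
      case True
      then show ?thesis using d by (simp add: \<sigma>_def sS digit_def)
    next
      case False
      then have "K \<sigma> m = K (s m) m + W m" using d by (simp add: \<sigma>_def sS digit_def)
      moreover have "norm (W m) \<le> norm (K (s m) m + W m) + norm (K (s m) m)"
        using norm_triangle_ineq4[of "K (s m) m + W m" "K (s m) m"] by simp
      ultimately show ?thesis using False by simp
    qed
  qed
qed

text \<open>The factor 2 * m - 3 is at least 1 and \<epsilon> ^ (2 * m + 1) is geometric, so a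
  geometric bound on the weights would pass to the Euler numbers of even index.\<close>

lemma jet_weight_not_geometric:
  assumes \<epsilon>: "\<epsilon> > 0"
  shows "\<not> (\<exists>C R. \<forall>m\<ge>2. norm (jet_weight \<epsilon> m) \<le> C * R ^ m)"
proof
  assume "\<exists>C R. \<forall>m\<ge>2. norm (jet_weight \<epsilon> m) \<le> C * R ^ m"
  then obtain C R where CR: "\<And>m. m \<ge> 2 \<Longrightarrow> norm (jet_weight \<epsilon> m) \<le> C * R ^ m" by blast
  \<comment> \<open>The index k = 2 * l of the Euler number belongs to m = l + 2, whence the square
    root; division by \<open>\<epsilon>\<close> undoes its power in the weight.\<close>
  define T where "T = sqrt \<bar>R\<bar> / \<epsilon>"
  have "norm (euler_number k) \<le> (\<bar>C\<bar> * \<bar>R\<bar>\<^sup>2 / \<epsilon> ^ 5) * T ^ k" if "even k" for k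
  proof -
    obtain l where l: "k = 2 * l" using \<open>even k\<close> by blast
    have w: "norm (jet_weight \<epsilon> (l + 2)) = (2 * real (2 * l + 1)) * (\<epsilon> ^ (2 * l + 5) * norm (euler_number k))"
      using \<epsilon> by (simp add: jet_weight_def l norm_mult norm_power abs_mult eval_nat_numeral del: of_nat_Suc of_nat_add)
    have "1 \<le> 2 * real (2 * l + 1)" by simp
    then have "1 * (\<epsilon> ^ (2 * l + 5) * norm (euler_number k))
        \<le> (2 * real (2 * l + 1)) * (\<epsilon> ^ (2 * l + 5) * norm (euler_number k))"
      using \<epsilon> by (intro mult_right_mono) auto
    then have "\<epsilon> ^ (2 * l + 5) * norm (euler_number k) \<le> norm (jet_weight \<epsilon> (l + 2))"
      unfolding w by (simp only: mult_1)
    also have "\<dots> \<le> \<bar>C * R ^ (l + 2)\<bar>" using CR[of "l + 2"] by simp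
    also have "\<dots> = \<bar>C\<bar> * \<bar>R\<bar>\<^sup>2 * \<bar>R\<bar> ^ l" by (simp add: abs_mult power_abs power_add power2_eq_square)
    finally have "norm (euler_number k) \<le> \<bar>C\<bar> * \<bar>R\<bar>\<^sup>2 * \<bar>R\<bar> ^ l / \<epsilon> ^ (2 * l + 5)"
      using \<epsilon> by (simp add: pos_le_divide_eq mult.commute)
    also have "\<dots> = (\<bar>C\<bar> * \<bar>R\<bar>\<^sup>2 / \<epsilon> ^ 5) * T ^ k"
      by (simp add: T_def l power_divide power_add power_mult)
    finally show ?thesis .
  qed
  then show False using euler_number_not_geometric by blast
qed

theorem theorem1p1:
  shows "Metric_space.mtopology X d closure_of S = X"
proof -
  interpret Metric_space X d by (rule Metric_space_X_d)
  have "\<exists>s\<in>S. d r s < e" if r: "r \<in> X" and e: "e > 0" for r e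
  proof (rule ccontr)
    assume none: "\<not> (\<exists>s\<in>S. d r s < e)"
    define \<epsilon> where "\<epsilon> = e / 4"
    have \<epsilon>: "\<epsilon> > 0" "2 * \<epsilon> < e" using e by (auto simp: \<epsilon>_def)
    have bound: "\<bar>\<sigma> n\<bar> \<le> 1" if "range \<sigma> \<subseteq> {0, 1}" for \<sigma> :: "nat \<Rightarrow> real" and n
    proof -
      have "\<sigma> n \<in> {0, 1}" using that by blast
      then show ?thesis by auto
    qed
    \<comment> \<open>Every perturbation lies within 2 * \<epsilon> < e of \<open>r\<close>, so by
      assumption it is transformable and possesses a jet, whatever the digits are.\<close>
    have ex: "\<exists>K. kappa_jet (\<lambda>i j. r i j + pert \<epsilon> \<sigma> i j) K" if \<sigma>: "range \<sigma> \<subseteq> {0, 1}" for \<sigma>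
    proof (rule kappa_jet_exists)
      note s = add_pert_in_X[where \<sigma> = \<sigma>, OF r \<epsilon>(1) bound[OF \<sigma>]]
      show "(\<lambda>i j. r i j + pert \<epsilon> \<sigma> i j) \<in> X" by (rule s(1))
      show "transformable_into (surface (\<lambda>i j. r i j + pert \<epsilon> \<sigma> i j)) Q"
        using none s(1) le_less_trans[OF s(2) \<epsilon>(2)] unfolding S_def by blast
    qed
    define K where "K = (\<lambda>\<sigma>. SOME K. kappa_jet (\<lambda>i j. r i j + pert \<epsilon> \<sigma> i j) K)"
    have K: "kappa_jet (\<lambda>i j. r i j + pert \<epsilon> \<sigma> i j) (K \<sigma>)" if "range \<sigma> \<subseteq> {0, 1}" for \<sigma>
      unfolding K_def using ex[OF that] by (rule someI_ex)
    have shift: "K \<sigma>' m - K \<sigma> m = of_real (\<sigma>' m - \<sigma> m) * jet_weight \<epsilon> m"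
      if \<sigma>: "range \<sigma> \<subseteq> {0, 1}" "range \<sigma>' \<subseteq> {0, 1}" and m: "m \<ge> 2"
        and eq: "\<And>n. n < m \<Longrightarrow> \<sigma>' n = \<sigma> n" for \<sigma> \<sigma>' :: "nat \<Rightarrow> real" and m
      by (rule kappa_jet_pert_diff[where \<sigma> = \<sigma> and \<sigma>' = \<sigma>',
            OF r \<epsilon>(1) bound[OF \<sigma>(1)] bound[OF \<sigma>(2)] K[OF \<sigma>(1)] K[OF \<sigma>(2)] m eq])
    obtain \<sigma> where \<sigma>: "range \<sigma> \<subseteq> {0, 1}" "\<And>m. m \<ge> 2 \<Longrightarrow> norm (jet_weight \<epsilon> m) \<le> 2 * norm (K \<sigma> m)"
      using large_digits_exist[of 2 K "jet_weight \<epsilon>", OF shift] by blast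
    obtain C R where CR: "\<And>n. norm (K \<sigma> n) \<le> C * R ^ n"
      using kappa_jet_bound[OF K[OF \<sigma>(1)]] by blast
    have "norm (jet_weight \<epsilon> m) \<le> (2 * C) * R ^ m" if "m \<ge> 2" for m
      using \<sigma>(2)[OF that] CR[of m] by simp
    then show False using jet_weight_not_geometric[OF \<epsilon>(1)] by blast
  qed
  then show ?thesis
    unfolding metric_closure_of by (auto simp: S_def)
qed

end
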